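(* Let $V$ be a complex Hilbert space and let $g\in\mathrm{Sp}(V)$ be such that $A_g$ is of Hilbert–Schmidt class. Then the prescription $$U(g):=\Vert e^{Z_g}\Vert^{-1}U_g$$ determines a unitary operator on $S[V]$; that is, $U(g)$ maps $SV$ into $S[V]$ and extends by continuity to a unitary operator $S[V]\to S[V]$.
   Context: $V$ is a complex Hilbert space with inner product $\langle\cdot|\cdot\rangle$ (antilinear in the first slot, linear in the second) and complex structure $J = i\,\cdot$. $\mathbb N=\{0,1,2,\dots\}$. $SV=\bigoplus_{d\in\mathbb N}S^dV$ is the (algebraic) symmetric algebra, with the inner product for which different degrees are orthogonal, $1\in S^0V=\mathbb C$ is a unit vector, and $\langle x_1\cdots x_d|y_1\cdots y_d\rangle=\sum_{\pi}\prod_{k=1}^d\langle x_k|y_{\pi(k)}\rangle$ ($\pi$ over permutations of $1,\dots,d$). $SV'$ is the space of all antilinear functionals $SV\to\mathbb C$; $SV$ is embedded in $SV'$ by $\phi\mapsto\langle\cdot|\phi\rangle$. Fock space: for $\Phi\in SV'$, $M\subset V$ a finite-dimensional complex subspace and $d\in\mathbb N$, let $\Phi_M^d\in S^dM$ be the unique element with $\Phi(\psi)=\langle\psi|\Phi_M^d\rangle$ for $\psi\in S^dM$; put $\Vert\Phi_M\Vert=(\sum_d\Vert\Phi_M^d\Vert^2)^{1/2}\in[0,\infty]$ and $\Vert\Phi\Vert=\sup_M\Vert\Phi_M\Vert$. Symmetric Fock space is $S[V]=\{\Phi\in SV':\Vert\Phi\Vert<\infty\}$, a Hilbert space under the inner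 product $\langle\Phi|\Psi\rangle=\frac14\sum_{p=0}^3i^{-p}\Vert\Phi+i^p\Psi\Vert^2$, containing $SV$ isometrically as a dense subspace. Product in $SV'$: let $\Delta:SV\to SV\otimes SV$ be the algebra homomorphism with $\Delta(v)=v\otimes 1+1\otimes v$ for $v\in V$; put $[\Phi\Psi](\theta)=[\Phi\otimes\Psi](\Delta\theta)$, where $[\Phi\otimes\Psi](\xi\otimes\eta)=\Phi(\xi)\Psi(\eta)$. Creators and annihilators: for $v\in V$, $c(v):SV\to SV$ is multiplication by $v$, and $a(v):SV\to SV$ is the unique linear derivation with $a(v)1=0$ and $a(v)w=\langle v|w\rangle$ for $w\in V$. They extend to $SV'$ by $[c(v)\Phi](\psi)=\Phi(a(v)\psi)$ and $[a(v)\Phi](\psi)=\Phi(c(v)\psi)$. Symplectic group: $\Omega=\mathrm{Im}\langle\cdot|\cdot\rangle$; $\mathrm{Sp}(V)$ is the group of real-linear automorphisms $g$ of $V$ with $\Omega(gx,gy)=\Omega(x,y)$. Put $C_g=\frac12(g-JgJ)$ (complex-linear) and $A_g=\frac12(g+JgJ)$ (antilinear). $C_g$ is invertible, and $Z_g=-A_gC_g^{-1}$ is antilinear, symmetric ($\langle y|Z_gx\rangle=\langle x|Z_gy\rangle$) and has operator norm $<1$. For $v\in V$ put $c_g(v)=c(C_gv)+a(A_gv)$. $e^{Z_g}=\sum_{n\in\mathbb N}\zeta_g^n/n!\in SV'$, where $\zeta_g\in SV'$ vanishes on $S^dV$ for $d\neq2$ and $\zeta_g(xy)=\langle y|Z_gx\rangle$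 for $x,y\in V$. The linear map $U_g:SV\to SV'$ is defined by $U_g1=e^{Z_g}$ and $U_g(v_1\cdots v_n)=c_g(v_1)\cdots c_g(v_n)e^{Z_g}$ for $v_1,\dots,v_n\in V$. *)

theory Defs
  imports "HOL-Analysis.Analysis" "HOL-Library.Poly_Mapping" "HOL-Library.Function_Algebras"
begin

section \<open>Complex vector spaces, Hilbert spaces and commutative algebras\<close>

class scaleC =
  fixes scaleC :: "complex \<Rightarrow> 'a \<Rightarrow> 'a" (infixr \<open>*\<^sub>C\<close> 75)

class complex_vector = ab_group_add + scaleC +
  assumes scaleC_add_right: "a *\<^sub>C (x + y) = a *\<^sub>C x + a *\<^sub>C y"
    and scaleC_add_left: "(a + b) *\<^sub>C x = a *\<^sub>C x + b *\<^sub>C x"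
    and scaleC_scaleC: "a *\<^sub>C b *\<^sub>C x = (a * b) *\<^sub>C x"
    and scaleC_one: "1 *\<^sub>C x = x"

global_interpretation complex_vector: vector_space "scaleC :: complex \<Rightarrow> 'a \<Rightarrow> 'a :: complex_vector"
  defines csubspace = complex_vector.subspace
    and cspan = complex_vector.span
  by unfold_locales (simp_all add: scaleC_add_right scaleC_add_left scaleC_scaleC scaleC_one)

definition clinear :: "('a::complex_vector \<Rightarrow> 'b::complex_vector) \<Rightarrow> bool"
  where "clinear f \<longleftrightarrow> (\<forall>x y. f (x + y) = f x + f y) \<and> (\<forall>c x. f (c *\<^sub>C x) = c *\<^sub>C f x)"

definition antilinear :: "('a::complex_vector \<Rightarrow> 'b::complex_vector) \<Rightarrow> bool"
  where "antilinear f \<longleftrightarrow> (\<forall>x y. f (x + y) = f x + f y) \<and> (\<forall>c x. f (c *\<^sub>C x) = cnj c *\<^sub>C f x)"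

instantiation complex :: complex_vector
begin
definition scaleC_complex :: "complex \<Rightarrow> complex \<Rightarrow> complex"
  where "scaleC_complex c x = c * x"
instance by standard (simp_all add: scaleC_complex_def algebra_simps)
end

instantiation "fun" :: (type, complex_vector) complex_vector
begin
definition scaleC_fun :: "complex \<Rightarrow> ('a \<Rightarrow> 'b) \<Rightarrow> 'a \<Rightarrow> 'b"
  where "scaleC_fun c f = (\<lambda>x. c *\<^sub>C f x)"
instance
  by standard
    (simp_all add: scaleC_fun_def fun_eq_iff scaleC_add_right scaleC_add_left scaleC_scaleC scaleC_one)
end

class complex_hilbert = banach + complex_vector +
  fixes cinner :: "'a \<Rightarrow> 'a \<Rightarrow> complex"
  assumes scaleR_scaleC: "r *\<^sub>R x = complex_of_real r *\<^sub>C x"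
    and cinner_commute: "cinner x y = cnj (cinner y x)"
    and cinner_add_right: "cinner x (y + z) = cinner x y + cinner x z"
    and cinner_scaleC_right: "cinner x (c *\<^sub>C y) = c * cinner x y"
    and norm_eq_sqrt_cinner: "norm x = sqrt (Re (cinner x x))"

text \<open>
  The class \<^emph>\<open>comm_ring_1\<close> of the library would add the requirement \<open>0 \<noteq> 1\<close>.
\<close>

class complex_comm_algebra = comm_ring + comm_monoid_mult + complex_vector +
  assumes scaleC_mult_left: "(c *\<^sub>C x) * y = c *\<^sub>C (x * y)"

definition calgebra_hom :: "('a::complex_comm_algebra \<Rightarrow> 'b::complex_comm_algebra) \<Rightarrow> bool"
  where "calgebra_hom f \<longleftrightarrow> clinear f \<and> f 1 = 1 \<and> (\<forall>x y. f (x * y) = f x * f y)"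

text \<open>The ideal generated by a set: the submodule it spans in the ring as a module over itself.\<close>

definition ideal_gen :: "'a::comm_ring_1 set \<Rightarrow> 'a set"
  where "ideal_gen = module.span (*)"

lemma module_comm_ring_1: "module ((*) :: 'a \<Rightarrow> 'a \<Rightarrow> 'a::comm_ring_1)"
  by unfold_locales (simp_all add: algebra_simps)

lemmas ideal_gen_zero = module.span_zero[OF module_comm_ring_1, folded ideal_gen_def]
  and ideal_gen_base = module.span_base[OF module_comm_ring_1, folded ideal_gen_def]
  and ideal_gen_add = module.span_add[OF module_comm_ring_1, folded ideal_gen_def]
  and ideal_gen_diff = module.span_diff[OF module_comm_ring_1, folded ideal_gen_def]
  and ideal_gen_neg = module.span_neg[OF module_comm_ring_1, folded ideal_gen_def]
  and ideal_gen_mult_left = module.span_scale[OF module_comm_ring_1, folded ideal_gen_def]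

lemma ideal_gen_mult_right: "f \<in> ideal_gen R \<Longrightarrow> f * g \<in> ideal_gen R"
  by (metis ideal_gen_mult_left mult.commute)

lemma equivp_ideal_gen: "equivp (\<lambda>f g. f - g \<in> ideal_gen R)"
proof (rule equivpI)
  show "reflp (\<lambda>f g. f - g \<in> ideal_gen R)"
    by (simp add: reflp_def ideal_gen_zero)
  show "symp (\<lambda>f g. f - g \<in> ideal_gen R)"
    by (metis (mono_tags, lifting) ideal_gen_neg minus_diff_eq sympI)
  show "transp (\<lambda>f g. f - g \<in> ideal_gen R)"
  proof (rule transpI)
    fix f g h assume "f - g \<in> ideal_gen R" "g - h \<in> ideal_gen R"
    then have "(f - g) + (g - h) \<in> ideal_gen R" by (rule ideal_gen_add)
    then show "f - h \<in> ideal_gen R" by simp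
  qed
qed

lemma ideal_gen_respects:
  assumes "f - f' \<in> ideal_gen R" "g - g' \<in> ideal_gen R"
  shows "(f + g) - (f' + g') \<in> ideal_gen R" "(f - g) - (f' - g') \<in> ideal_gen R"
    "f * g - f' * g' \<in> ideal_gen R"
    "- f - - f' \<in> ideal_gen R"
proof -
  have "(f - f') + (g - g') \<in> ideal_gen R" "(f - f') - (g - g') \<in> ideal_gen R"
    using assms by (auto intro: ideal_gen_add ideal_gen_diff)
  then show "(f + g) - (f' + g') \<in> ideal_gen R" "(f - g) - (f' - g') \<in> ideal_gen R"
    by (simp_all add: algebra_simps)
  have "(f - f') * g + f' * (g - g') \<in> ideal_gen R"
    using assms by (intro ideal_gen_add ideal_gen_mult_right ideal_gen_mult_left)
  then show "f * g - f' * g' \<in> ideal_gen R" by (simp add: algebra_simps)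
  have "- (f - f') \<in> ideal_gen R" using assms(1) by (rule ideal_gen_neg)
  then show "- f - - f' \<in> ideal_gen R" by simp
qed


section \<open>The symmetric algebra\<close>

text \<open>
  \<open>'v multiset \<Rightarrow>\<^sub>0 complex\<close> is the free commutative complex algebra (polynomial ring) on the
  underlying set of \<open>'v\<close>; a multiset is a monomial. The symmetric algebra is its quotient by the
  relations saying that \<open>v \<mapsto> [v]\<close> is linear.
\<close>

inductive_set sym_rel :: "('v::complex_vector multiset \<Rightarrow>\<^sub>0 complex) set"
  where
    "Poly_Mapping.single {#x + y#} 1 - Poly_Mapping.single {#x#} 1 - Poly_Mapping.single {#y#} 1 \<in> sym_rel"
  | "Poly_Mapping.single {#c *\<^sub>C x#} 1 - Poly_Mapping.single {#x#} c \<in> sym_rel"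

quotient_type (overloaded) 'v symalg =
  "'v::complex_vector multiset \<Rightarrow>\<^sub>0 complex" / "\<lambda>f g. f - g \<in> ideal_gen sym_rel"
  by (rule equivp_ideal_gen)

instantiation symalg :: (complex_vector) complex_comm_algebra
begin

lift_definition zero_symalg :: "'a symalg" is 0 .
lift_definition one_symalg :: "'a symalg" is 1 .
lift_definition plus_symalg :: "'a symalg \<Rightarrow> 'a symalg \<Rightarrow> 'a symalg" is "(+)"
  by (rule ideal_gen_respects)
lift_definition minus_symalg :: "'a symalg \<Rightarrow> 'a symalg \<Rightarrow> 'a symalg" is "(-)"
  by (rule ideal_gen_respects)
lift_definition uminus_symalg :: "'a symalg \<Rightarrow> 'a symalg" is uminus
  by (rule ideal_gen_respects)
lift_definition times_symalg :: "'a symalg \<Rightarrow> 'a symalg \<Rightarrow> 'a symalg" is "(*)"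
  by (rule ideal_gen_respects)
lift_definition scaleC_symalg :: "complex \<Rightarrow> 'a symalg \<Rightarrow> 'a symalg"
  is "\<lambda>c f. Poly_Mapping.single 0 c * f"
  by (rule ideal_gen_respects) (auto simp: ideal_gen_zero)

instance
proof
  fix x y z :: "'a symalg" and a b :: complex
  note [simp] = ideal_gen_zero
  show "x + y + z = x + (y + z)" by transfer (simp add: algebra_simps)
  show "x + y = y + x" by transfer (simp add: algebra_simps)
  show "0 + x = x" by transfer simp
  show "- x + x = 0" by transfer simp
  show "x - y = x + - y" by transfer simp
  show "x * y * z = x * (y * z)" by transfer (simp add: algebra_simps)
  show "x * y = y * x" by transfer (simp add: algebra_simps)
  show "(x + y) * z = x * z + y * z" by transfer (simp add: algebra_simps)
  show "1 * x = x" by transfer simp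
  show "a *\<^sub>C (x + y) = a *\<^sub>C x + a *\<^sub>C y" by transfer (simp add: algebra_simps)
  show "(a + b) *\<^sub>C x = a *\<^sub>C x + b *\<^sub>C x" by transfer (simp add: algebra_simps single_add)
  show "a *\<^sub>C b *\<^sub>C x = (a * b) *\<^sub>C x"
    by transfer (simp add: mult.assoc[symmetric] mult_single)
  show "1 *\<^sub>C x = x" by transfer simp
  show "a *\<^sub>C x * y = a *\<^sub>C (x * y)" by transfer (simp add: mult.assoc)
qed

end

lift_definition sym_incl :: "'v::complex_vector \<Rightarrow> 'v symalg"
  is "\<lambda>v. Poly_Mapping.single {#v#} 1" .

text \<open>The product \<open>v\<^sub>1 \<cdots> v\<^sub>n\<close> in the symmetric algebra, and the subspace \<open>S\<^sup>d M\<close>.\<close>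

definition sym_prod :: "'v::complex_vector list \<Rightarrow> 'v symalg"
  where "sym_prod vs = prod_list (map sym_incl vs)"

definition sym_pow :: "nat \<Rightarrow> 'v::complex_vector set \<Rightarrow> 'v symalg set"
  where "sym_pow d M = cspan {sym_prod vs | vs. length vs = d \<and> set vs \<subseteq> M}"

definition sym_inner :: "'v::complex_hilbert symalg \<Rightarrow> 'v symalg \<Rightarrow> complex"
  where "sym_inner = (THE B.
    (\<forall>\<psi>. clinear (B \<psi>)) \<and> (\<forall>\<phi>. antilinear (\<lambda>\<psi>. B \<psi> \<phi>)) \<and>
    (\<forall>xs ys. length xs \<noteq> length ys \<longrightarrow> B (sym_prod xs) (sym_prod ys) = 0) \<and>
    (\<forall>xs ys. length xs = length ys \<longrightarrow> B (sym_prod xs) (sym_prod ys) =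
      (\<Sum>\<pi> | \<pi> permutes {..<length xs}. \<Prod>k<length xs. cinner (xs ! k) (ys ! \<pi> k))))"

definition sym_norm :: "'v::complex_hilbert symalg \<Rightarrow> real"
  where "sym_norm \<psi> = sqrt (Re (sym_inner \<psi> \<psi>))"

text \<open>
  The dual \<open>SV'\<close> consists of the \<^const>\<open>antilinear\<close> functions \<^typ>\<open>'v::complex_vector symalg \<Rightarrow> complex\<close>,
  with the pointwise vector space structure. The pointwise product \<open>\<Phi> * \<Psi>\<close> of functions is
  not the product of \<open>SV'\<close>, which is \<open>dual_times\<close> below.
\<close>

definition dual_embed :: "'v::complex_hilbert symalg \<Rightarrow> 'v symalg \<Rightarrow> complex"
  where "dual_embed \<phi> = (\<lambda>\<psi>. sym_inner \<psi> \<phi>)"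


section \<open>Fock space\<close>

definition fin_dim_csubspace :: "'v::complex_vector set \<Rightarrow> bool"
  where "fin_dim_csubspace M \<longleftrightarrow> (\<exists>B. finite B \<and> M = cspan B)"

definition fock_component :: "('v::complex_hilbert symalg \<Rightarrow> complex) \<Rightarrow> 'v set \<Rightarrow> nat \<Rightarrow> 'v symalg"
  where "fock_component \<Phi> M d =
    (THE \<phi>. \<phi> \<in> sym_pow d M \<and> (\<forall>\<psi>\<in>sym_pow d M. \<Phi> \<psi> = sym_inner \<psi> \<phi>))"

definition ennreal_sqrt :: "ennreal \<Rightarrow> ennreal"
  where "ennreal_sqrt s = (if s = \<infinity> then \<infinity> else ennreal (sqrt (enn2real s)))"

definition fock_norm_on :: "('v::complex_hilbert symalg \<Rightarrow> complex) \<Rightarrow> 'v set \<Rightarrow> ennreal"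
  where "fock_norm_on \<Phi> M = ennreal_sqrt (suminf (\<lambda>d. ennreal ((sym_norm (fock_component \<Phi> M d))\<^sup>2)))"

definition fock_norm_ext :: "('v::complex_hilbert symalg \<Rightarrow> complex) \<Rightarrow> ennreal"
  where "fock_norm_ext \<Phi> = (SUP M\<in>Collect fin_dim_csubspace. fock_norm_on \<Phi> M)"

definition fock_space :: "('v::complex_hilbert symalg \<Rightarrow> complex) set"
  where "fock_space = {\<Phi>. antilinear \<Phi> \<and> fock_norm_ext \<Phi> < \<infinity>}"

definition fock_norm :: "('v::complex_hilbert symalg \<Rightarrow> complex) \<Rightarrow> real"
  where "fock_norm \<Phi> = enn2real (fock_norm_ext \<Phi>)"

definition fock_inner ::
    "('v::complex_hilbert symalg \<Rightarrow> complex) \<Rightarrow> ('v symalg \<Rightarrow> complex) \<Rightarrow> complex"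
  where "fock_inner \<Phi> \<Psi> =
    1/4 * (\<Sum>p\<in>{0..3::nat}. inverse (\<i> ^ p) * complex_of_real ((fock_norm (\<Phi> + \<i> ^ p *\<^sub>C \<Psi>))\<^sup>2))"

definition fock_unitary ::
    "(('v::complex_hilbert symalg \<Rightarrow> complex) \<Rightarrow> 'v symalg \<Rightarrow> complex) \<Rightarrow> bool"
  where "fock_unitary T \<longleftrightarrow>
    bij_betw T fock_space fock_space \<and>
    (\<forall>\<Phi>\<in>fock_space. \<forall>\<Psi>\<in>fock_space. T (\<Phi> + \<Psi>) = T \<Phi> + T \<Psi>) \<and>
    (\<forall>c. \<forall>\<Phi>\<in>fock_space. T (c *\<^sub>C \<Phi>) = c *\<^sub>C T \<Phi>) \<and>
    (\<forall>\<Phi>\<in>fock_space. \<forall>\<Psi>\<in>fock_space. fock_inner (T \<Phi>) (T \<Psi>) = fock_inner \<Phi> \<Psi>)"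

text \<open>
  \<open>T\<close> is a continuous map of Fock space to itself that agrees with \<open>L\<close> on the embedded copy of \<open>SV\<close>.
  Values of \<open>T\<close> outside Fock space are fixed to be \<open>undefined\<close>, so that \<open>T\<close> can be unique.
\<close>

definition continuous_extension ::
    "('v::complex_hilbert symalg \<Rightarrow> 'v symalg \<Rightarrow> complex) \<Rightarrow>
     (('v symalg \<Rightarrow> complex) \<Rightarrow> 'v symalg \<Rightarrow> complex) \<Rightarrow> bool"
  where "continuous_extension L T \<longleftrightarrow>
    T \<in> fock_space \<rightarrow>\<^sub>E fock_space \<and>
    (\<forall>\<phi>. T (dual_embed \<phi>) = L \<phi>) \<and>
    (\<forall>\<Phi>\<in>fock_space. \<forall>\<epsilon>>0. \<exists>\<delta>>0. \<forall>\<Psi>\<in>fock_space.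
       fock_norm (\<Psi> - \<Phi>) < \<delta> \<longrightarrow> fock_norm (T \<Psi> - T \<Phi>) < \<epsilon>)"


section \<open>Tensor products of algebras and the product in the dual\<close>

text \<open>
  \<open>'a mult_monoid\<close> is the multiplicative monoid of \<open>'a\<close>, written additively, so that
  \<open>'a mult_monoid \<times> 'b mult_monoid \<Rightarrow>\<^sub>0 complex\<close> is its monoid algebra: the free vector space on
  \<open>'a \<times> 'b\<close> with \<open>(a, b) (c, d) = (a c, b d)\<close>. The span of the bilinearity relations is already
  an ideal there, so the quotient is the usual tensor product with its algebra structure.
\<close>

datatype 'a mult_monoid = Mult_Monoid 'a

instantiation mult_monoid :: (comm_monoid_mult) comm_monoid_add
begin
definition zero_mult_monoid :: "'a mult_monoid" where "0 = Mult_Monoid 1"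
fun plus_mult_monoid :: "'a mult_monoid \<Rightarrow> 'a mult_monoid \<Rightarrow> 'a mult_monoid"
  where "Mult_Monoid a + Mult_Monoid b = Mult_Monoid (a * b)"
instance
proof
  fix x y z :: "'a mult_monoid"
  show "x + y + z = x + (y + z)" by (cases x; cases y; cases z) (simp add: mult.assoc)
  show "x + y = y + x" by (cases x; cases y) (simp add: mult.commute)
  show "0 + x = x" by (cases x) (simp add: zero_mult_monoid_def)
qed
end

definition pure_tensor ::
    "'a::complex_comm_algebra \<Rightarrow> 'b::complex_comm_algebra \<Rightarrow> complex \<Rightarrow>
     ('a mult_monoid \<times> 'b mult_monoid) \<Rightarrow>\<^sub>0 complex"
  where "pure_tensor a b c = Poly_Mapping.single (Mult_Monoid a, Mult_Monoid b) c"

inductive_set tensor_rel ::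
    "('a::complex_comm_algebra mult_monoid \<times> 'b::complex_comm_algebra mult_monoid \<Rightarrow>\<^sub>0 complex) set"
  where
    "pure_tensor (a + a') b 1 - pure_tensor a b 1 - pure_tensor a' b 1 \<in> tensor_rel"
  | "pure_tensor a (b + b') 1 - pure_tensor a b 1 - pure_tensor a b' 1 \<in> tensor_rel"
  | "pure_tensor (c *\<^sub>C a) b 1 - pure_tensor a b c \<in> tensor_rel"
  | "pure_tensor a (c *\<^sub>C b) 1 - pure_tensor a b c \<in> tensor_rel"

quotient_type (overloaded) ('a, 'b) tensor =
  "'a::complex_comm_algebra mult_monoid \<times> 'b::complex_comm_algebra mult_monoid \<Rightarrow>\<^sub>0 complex"
  / "\<lambda>f g. f - g \<in> ideal_gen tensor_rel"
  by (rule equivp_ideal_gen)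

instantiation tensor :: (complex_comm_algebra, complex_comm_algebra) complex_comm_algebra
begin

lift_definition zero_tensor :: "('a, 'b) tensor" is 0 .
lift_definition one_tensor :: "('a, 'b) tensor" is 1 .
lift_definition plus_tensor :: "('a, 'b) tensor \<Rightarrow> ('a, 'b) tensor \<Rightarrow> ('a, 'b) tensor" is "(+)"
  by (rule ideal_gen_respects)
lift_definition minus_tensor :: "('a, 'b) tensor \<Rightarrow> ('a, 'b) tensor \<Rightarrow> ('a, 'b) tensor" is "(-)"
  by (rule ideal_gen_respects)
lift_definition uminus_tensor :: "('a, 'b) tensor \<Rightarrow> ('a, 'b) tensor" is uminus
  by (rule ideal_gen_respects)
lift_definition times_tensor :: "('a, 'b) tensor \<Rightarrow> ('a, 'b) tensor \<Rightarrow> ('a, 'b) tensor" is "(*)"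
  by (rule ideal_gen_respects)
lift_definition scaleC_tensor :: "complex \<Rightarrow> ('a, 'b) tensor \<Rightarrow> ('a, 'b) tensor"
  is "\<lambda>c f. Poly_Mapping.single 0 c * f"
  by (rule ideal_gen_respects) (auto simp: ideal_gen_zero)

instance
proof
  fix x y z :: "('a, 'b) tensor" and a b :: complex
  note [simp] = ideal_gen_zero
  show "x + y + z = x + (y + z)" by transfer (simp add: algebra_simps)
  show "x + y = y + x" by transfer (simp add: algebra_simps)
  show "0 + x = x" by transfer simp
  show "- x + x = 0" by transfer simp
  show "x - y = x + - y" by transfer simp
  show "x * y * z = x * (y * z)" by transfer (simp add: algebra_simps)
  show "x * y = y * x" by transfer (simp add: algebra_simps)
  show "(x + y) * z = x * z + y * z" by transfer (simp add: algebra_simps)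
  show "1 * x = x" by transfer simp
  show "a *\<^sub>C (x + y) = a *\<^sub>C x + a *\<^sub>C y" by transfer (simp add: algebra_simps)
  show "(a + b) *\<^sub>C x = a *\<^sub>C x + b *\<^sub>C x" by transfer (simp add: algebra_simps single_add)
  show "a *\<^sub>C b *\<^sub>C x = (a * b) *\<^sub>C x"
    by transfer (simp add: mult.assoc[symmetric] mult_single)
  show "1 *\<^sub>C x = x" by transfer simp
  show "a *\<^sub>C x * y = a *\<^sub>C (x * y)" by transfer (simp add: mult.assoc)
qed

end

lift_definition tensor :: "'a::complex_comm_algebra \<Rightarrow> 'b::complex_comm_algebra \<Rightarrow> ('a, 'b) tensor"
  (infixr \<open>\<otimes>\<^sub>T\<close> 70)
  is "\<lambda>a b. pure_tensor a b 1" .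

definition sym_coproduct :: "'v::complex_vector symalg \<Rightarrow> ('v symalg, 'v symalg) tensor"
  where "sym_coproduct = (THE \<Delta>. calgebra_hom \<Delta> \<and>
    (\<forall>v. \<Delta> (sym_incl v) = sym_incl v \<otimes>\<^sub>T 1 + 1 \<otimes>\<^sub>T sym_incl v))"

definition dual_tensor ::
    "('v::complex_vector symalg \<Rightarrow> complex) \<Rightarrow> ('v symalg \<Rightarrow> complex) \<Rightarrow>
     ('v symalg, 'v symalg) tensor \<Rightarrow> complex"
  where "dual_tensor \<Phi> \<Psi> = (THE F. antilinear F \<and> (\<forall>\<xi> \<eta>. F (\<xi> \<otimes>\<^sub>T \<eta>) = \<Phi> \<xi> * \<Psi> \<eta>))"

definition dual_times ::
    "('v::complex_vector symalg \<Rightarrow> complex) \<Rightarrow> ('v symalg \<Rightarrow> complex) \<Rightarrow> 'v symalg \<Rightarrow> complex"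
  where "dual_times \<Phi> \<Psi> = (\<lambda>\<theta>. dual_tensor \<Phi> \<Psi> (sym_coproduct \<theta>))"

primrec dual_power :: "('v::complex_hilbert symalg \<Rightarrow> complex) \<Rightarrow> nat \<Rightarrow> 'v symalg \<Rightarrow> complex"
  where
    "dual_power \<Phi> 0 = dual_embed 1"
  | "dual_power \<Phi> (Suc n) = dual_times \<Phi> (dual_power \<Phi> n)"


section \<open>Creators and annihilators\<close>

definition creator :: "'v::complex_vector \<Rightarrow> 'v symalg \<Rightarrow> 'v symalg"
  where "creator v \<psi> = sym_incl v * \<psi>"

definition annihilator :: "'v::complex_hilbert \<Rightarrow> 'v symalg \<Rightarrow> 'v symalg"
  where "annihilator v = (THE D. clinear D \<and> (\<forall>\<phi> \<psi>. D (\<phi> * \<psi>) = D \<phi> * \<psi> + \<phi> * D \<psi>) \<and>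
    D 1 = 0 \<and> (\<forall>w. D (sym_incl w) = cinner v w *\<^sub>C 1))"

definition dual_creator ::
    "'v::complex_hilbert \<Rightarrow> ('v symalg \<Rightarrow> complex) \<Rightarrow> 'v symalg \<Rightarrow> complex"
  where "dual_creator v \<Phi> = (\<lambda>\<psi>. \<Phi> (annihilator v \<psi>))"

definition dual_annihilator ::
    "'v::complex_hilbert \<Rightarrow> ('v symalg \<Rightarrow> complex) \<Rightarrow> 'v symalg \<Rightarrow> complex"
  where "dual_annihilator v \<Phi> = (\<lambda>\<psi>. \<Phi> (creator v \<psi>))"


section \<open>The symplectic group and the operators \<open>U\<close>\<close>

definition Sp :: "('v::complex_hilbert \<Rightarrow> 'v) set"
  where "Sp = {g. linear g \<and> bij g \<and> (\<forall>x y. Im (cinner (g x) (g y)) = Im (cinner x y))}"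

definition C_part :: "('v::complex_hilbert \<Rightarrow> 'v) \<Rightarrow> 'v \<Rightarrow> 'v"
  where "C_part g v = (1/2) *\<^sub>R (g v - \<i> *\<^sub>C g (\<i> *\<^sub>C v))"

definition A_part :: "('v::complex_hilbert \<Rightarrow> 'v) \<Rightarrow> 'v \<Rightarrow> 'v"
  where "A_part g v = (1/2) *\<^sub>R (g v + \<i> *\<^sub>C g (\<i> *\<^sub>C v))"

definition Z_op :: "('v::complex_hilbert \<Rightarrow> 'v) \<Rightarrow> 'v \<Rightarrow> 'v"
  where "Z_op g v = - A_part g (inv (C_part g) v)"

definition orthonormal_basis :: "'v::complex_hilbert set \<Rightarrow> bool"
  where "orthonormal_basis E \<longleftrightarrow>
    (\<forall>e\<in>E. \<forall>f\<in>E. cinner e f = (if e = f then 1 else 0)) \<and> closure (cspan E) = UNIV"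

text \<open>
  Stated for real-linear maps, so that it applies to antilinear ones. Whether the sum is finite
  does not depend on the choice of the (complex) orthonormal basis.
\<close>

definition hilbert_schmidt :: "('v::complex_hilbert \<Rightarrow> 'v) \<Rightarrow> bool"
  where "hilbert_schmidt A \<longleftrightarrow> bounded_linear A \<and>
    (\<exists>E. orthonormal_basis E \<and> (\<lambda>e. (norm (A e))\<^sup>2) summable_on E)"

definition zeta :: "('v::complex_hilbert \<Rightarrow> 'v) \<Rightarrow> 'v symalg \<Rightarrow> complex"
  where "zeta g = (THE \<zeta>. antilinear \<zeta> \<and> (\<forall>d. d \<noteq> 2 \<longrightarrow> (\<forall>\<psi>\<in>sym_pow d UNIV. \<zeta> \<psi> = 0)) \<and>
    (\<forall>x y. \<zeta> (sym_incl x * sym_incl y) = cinner y (Z_op g x)))"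

text \<open>At each argument only finitely many terms of the following series are nonzero.\<close>

definition exp_Z :: "('v::complex_hilbert \<Rightarrow> 'v) \<Rightarrow> 'v symalg \<Rightarrow> complex"
  where "exp_Z g = (\<lambda>\<theta>. suminf (\<lambda>n. dual_power (zeta g) n \<theta> / fact n))"

definition c_op ::
    "('v::complex_hilbert \<Rightarrow> 'v) \<Rightarrow> 'v \<Rightarrow> ('v symalg \<Rightarrow> complex) \<Rightarrow> 'v symalg \<Rightarrow> complex"
  where "c_op g v \<Phi> = dual_creator (C_part g v) \<Phi> + dual_annihilator (A_part g v) \<Phi>"

definition U_op :: "('v::complex_hilbert \<Rightarrow> 'v) \<Rightarrow> 'v symalg \<Rightarrow> 'v symalg \<Rightarrow> complex"
  where "U_op g = (THE L. clinear L \<and>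
    (\<forall>vs. L (sym_prod vs) = foldr (c_op g) vs (exp_Z g)))"

definition U_normalized :: "('v::complex_hilbert \<Rightarrow> 'v) \<Rightarrow> 'v symalg \<Rightarrow> 'v symalg \<Rightarrow> complex"
  where "U_normalized g \<phi> = complex_of_real (inverse (fock_norm (exp_Z g))) *\<^sub>C U_op g \<phi>"


section \<open>Existence and uniqueness for the definite descriptions\<close>

text \<open>
  The objects defined by \<open>THE\<close> in \<^const>\<open>sym_inner\<close>, \<^const>\<open>sym_coproduct\<close>, \<^const>\<open>dual_tensor\<close> and
  \<^const>\<open>annihilator\<close> exist and are unique: \<open>sym_inner_ex1\<close>, \<open>sym_coproduct_ex1\<close>, \<open>dual_tensor_ex1\<close>,
  \<open>annihilator_ex1\<close>.
\<close>

text \<open>The linear extension of a map on the basis of a free vector space.\<close>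

definition lin_ext :: "('k \<Rightarrow> 'a::complex_vector) \<Rightarrow> ('k \<Rightarrow>\<^sub>0 complex) \<Rightarrow> 'a"
  where "lin_ext h p = (\<Sum>k\<in>Poly_Mapping.keys p. Poly_Mapping.lookup p k *\<^sub>C h k)"

lemma lin_ext_superset:
  assumes "finite A" "Poly_Mapping.keys p \<subseteq> A"
  shows "lin_ext h p = (\<Sum>k\<in>A. Poly_Mapping.lookup p k *\<^sub>C h k)"
  unfolding lin_ext_def
  by (rule sum.mono_neutral_left) (use assms in \<open>auto simp: in_keys_iff\<close>)

lemma lin_ext_single [simp]: "lin_ext h (Poly_Mapping.single k c) = c *\<^sub>C h k"
  by (subst lin_ext_superset[of "{k}"]) auto

lemma lin_ext_0 [simp]: "lin_ext h 0 = 0"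
  by (simp add: lin_ext_def)

lemma lin_ext_add: "lin_ext h (p + q) = lin_ext h p + lin_ext h q"
proof -
  let ?A = "Poly_Mapping.keys p \<union> Poly_Mapping.keys q"
  have "Poly_Mapping.keys (p + q) \<subseteq> ?A" by (rule Poly_Mapping.keys_add)
  then show ?thesis
    by (simp add: lin_ext_superset[of ?A] lookup_add scaleC_add_left sum.distrib)
qed

lemma lin_ext_uminus: "lin_ext h (- p) = - lin_ext h p"
  by (metis add.inverse_unique add.right_inverse lin_ext_0 lin_ext_add)

lemma lin_ext_diff: "lin_ext h (p - q) = lin_ext h p - lin_ext h q"
  by (metis diff_conv_add_uminus lin_ext_add lin_ext_uminus)

lemma poly_mapping_induct_add:
  fixes p :: "'k \<Rightarrow>\<^sub>0 'b::monoid_add"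
  assumes "P 0" "\<And>k c. P (Poly_Mapping.single k c)" "\<And>p q. P p \<Longrightarrow> P q \<Longrightarrow> P (p + q)"
  shows "P p"
proof (induction p rule: update_induct)
  case const then show ?case by (rule assms(1))
next
  case (update p a b)
  have "Poly_Mapping.update a b p = Poly_Mapping.single a b + p"
    using update(1) by (intro poly_mapping_eqI)
      (auto simp: lookup_update lookup_add lookup_single in_keys_iff when_def)
  then show ?case using assms update by auto
qed

lemma lin_ext_smult:
  fixes p :: "'k::comm_monoid_add \<Rightarrow>\<^sub>0 complex"
  shows "lin_ext h (Poly_Mapping.single 0 c * p) = c *\<^sub>C lin_ext h p"
  by (induction p rule: poly_mapping_induct_add)
    (simp_all add: mult_single distrib_left lin_ext_add scaleC_add_right scaleC_scaleC)

lemma scaleC_mult_right: "x * (c *\<^sub>C y) = c *\<^sub>C (x * (y::'a::complex_comm_algebra))"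
  by (metis mult.commute scaleC_mult_left)

lemma lin_ext_mult:
  fixes p q :: "'k::comm_monoid_add \<Rightarrow>\<^sub>0 complex" and h :: "'k \<Rightarrow> 'a::complex_comm_algebra"
  assumes h: "\<And>k l. h (k + l) = h k * h l"
  shows "lin_ext h (p * q) = lin_ext h p * lin_ext h q"
proof (induction p rule: poly_mapping_induct_add)
  case (2 k c)
  show ?case
    by (induction q rule: poly_mapping_induct_add)
      (simp_all add: mult_single distrib_left lin_ext_add h scaleC_mult_left scaleC_mult_right scaleC_scaleC scaleC_add_right distrib_right ac_simps)
qed (simp_all add: distrib_right lin_ext_add)

lemma lin_ext_ideal:
  fixes p :: "'k::comm_monoid_add \<Rightarrow>\<^sub>0 complex"
  assumes "p \<in> ideal_gen R" and R: "\<And>r k. r \<in> R \<Longrightarrow> lin_ext h (Poly_Mapping.single k 1 * r) = 0"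
  shows "lin_ext h p = 0"
proof -
  have *: "lin_ext h (q * r) = 0" if "r \<in> R" for q r
  proof (induction q rule: poly_mapping_induct_add)
    case (2 k c)
    have "Poly_Mapping.single k c * r = Poly_Mapping.single 0 c * (Poly_Mapping.single k 1 * r)"
      by (simp add: mult.assoc[symmetric] mult_single)
    then show ?case using R[OF that] by (simp add: lin_ext_smult)
  qed (simp_all add: distrib_right lin_ext_add)
  have "p \<in> module.span (*) R" using assms by (simp add: ideal_gen_def)
  then show ?thesis
  proof (induction rule: module.span_induct_alt[OF module_comm_ring_1, consumes 1, case_names 1 2])
    case 1 show ?case by simp
  next
    case (2 c x y) then show ?case by (simp add: lin_ext_add *)
  qed
qed

lemma clinear_lemmas:
  assumes "clinear f"
  shows "f (x + y) = f x + f y" "f (c *\<^sub>C x) = c *\<^sub>C f x" "f 0 = 0" "f (- x) = - f x" "f (x - y) = f x - f y"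
proof -
  show 1: "f (x + y) = f x + f y" for x y using assms by (simp add: clinear_def)
  show "f (c *\<^sub>C x) = c *\<^sub>C f x" using assms by (simp add: clinear_def)
  show 0: "f 0 = 0" using 1[of 0 0] by simp
  show 2: "f (- x) = - f x" for x using 1[of x "-x"] 0 by (simp add: eq_neg_iff_add_eq_0 add.commute)
  show "f (x - y) = f x - f y" using 1[of x "-y"] 2[of y] by simp
qed

subsection \<open>Universal property of the symmetric algebra\<close>

lemma abs_symalg_single: "abs_symalg (Poly_Mapping.single m c) = c *\<^sub>C prod_mset (image_mset sym_incl m)"
proof -
  have 1: "abs_symalg (Poly_Mapping.single m 1) = prod_mset (image_mset sym_incl m)" 
  proof (induction m)
    case empty then show ?case by (simp add: one_symalg.abs_eq)
  next
    case (add x m)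
    have "Poly_Mapping.single (add_mset x m) (1::complex) = Poly_Mapping.single {#x#} 1 * Poly_Mapping.single m 1"
      by (simp add: mult_single)
    then show ?case using add by (simp add: times_symalg.abs_eq[symmetric] sym_incl.abs_eq)
  qed
  have "Poly_Mapping.single m c = Poly_Mapping.single 0 c * Poly_Mapping.single m 1"
    by (simp add: mult_single)
  then show ?thesis using 1 by (simp add: scaleC_symalg.abs_eq[symmetric])
qed

lemma symalg_induct [case_names prod add scale]:
  assumes "\<And>vs. P (sym_prod vs)" "\<And>x y. P x \<Longrightarrow> P y \<Longrightarrow> P (x + y)" "\<And>c x. P x \<Longrightarrow> P (c *\<^sub>C x)"
  shows "P \<phi>"
proof (induction \<phi> rule: symalg.abs_induct)
  case (1 p)
  show ?case
  proof (induction p rule: poly_mapping_induct_add)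
    case 1
    have "0 = 0 *\<^sub>C sym_prod []" by simp
    then have "P 0" using assms by metis
    then show ?case by (simp add: zero_symalg.abs_eq)
  next
    case (2 k c)
    obtain vs where "mset vs = k" using ex_mset by blast
    then have "prod_mset (image_mset sym_incl k) = sym_prod vs"
      by (metis mset_map prod_mset_prod_list sym_prod_def)
    then show ?case using assms by (simp add: abs_symalg_single)
  next
    case (3 p q)
    then show ?case using assms by (simp flip: plus_symalg.abs_eq)
  qed
qed

lemma sym_incl_add: "sym_incl (x + y) = sym_incl x + sym_incl y"
  by transfer (use sym_rel.intros(1) in \<open>force simp: algebra_simps intro!: ideal_gen_base\<close>)

lemma sym_incl_scale: "sym_incl (c *\<^sub>C x) = c *\<^sub>C sym_incl x"
  by transfer (use sym_rel.intros(2) in \<open>force simp: mult_single intro!: ideal_gen_base\<close>)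

lemma clinear_sym_incl: "clinear sym_incl"
  by (simp add: clinear_def sym_incl_add sym_incl_scale)

lemma symalg_linear_lift:
  fixes h :: "'v::complex_vector multiset \<Rightarrow> 'a::complex_vector"
  assumes "\<And>x y m. h (add_mset (x + y) m) = h (add_mset x m) + h (add_mset y m)"
    and "\<And>c x m. h (add_mset (c *\<^sub>C x) m) = c *\<^sub>C h (add_mset x m)"
  shows "\<exists>F. clinear F \<and> (\<forall>p. F (abs_symalg p) = lin_ext h p)"
proof -
  have ker: "lin_ext h p = 0" if "p \<in> ideal_gen sym_rel" for p
    using that
  proof (rule lin_ext_ideal)
    fix r k assume "r \<in> (sym_rel :: ('v multiset \<Rightarrow>\<^sub>0 complex) set)"
    then show "lin_ext h (Poly_Mapping.single k 1 * r) = 0"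
      by cases (simp_all add: right_diff_distrib mult_single lin_ext_diff assms)
  qed
  define F where "F \<phi> = lin_ext h (rep_symalg \<phi>)" for \<phi>
  have F: "F (abs_symalg p) = lin_ext h p" for p
  proof -
    have "rep_symalg (abs_symalg p) - p \<in> ideal_gen sym_rel"
      using Quotient3_abs_rep[OF Quotient3_symalg, of "abs_symalg p"] by (simp only: symalg.abs_eq_iff)
    then show ?thesis using ker[of "rep_symalg (abs_symalg p) - p"] by (simp add: F_def lin_ext_diff)
  qed
  have "clinear F"
    unfolding clinear_def
  proof (intro conjI allI)
    fix x y :: "'v symalg" and c
    show "F (x + y) = F x + F y"
      by (induction x; induction y) (simp add: plus_symalg.abs_eq F lin_ext_add)
    show "F (c *\<^sub>C x) = c *\<^sub>C F x"
      by (induction x) (simp add: scaleC_symalg.abs_eq F lin_ext_smult)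
  qed
  then show ?thesis using F by blast
qed

lemma clinear_symalg_unique:
  assumes "clinear F" "clinear G" "\<And>vs. F (sym_prod vs) = G (sym_prod vs)"
  shows "F = G"
proof
  fix \<phi> show "F \<phi> = G \<phi>"
    by (induction \<phi> rule: symalg_induct) (use assms in \<open>auto simp: clinear_def\<close>)
qed

theorem symalg_universal:
  fixes f :: "'v::complex_vector \<Rightarrow> 'a::complex_comm_algebra"
  assumes "clinear f"
  shows "\<exists>!F. calgebra_hom F \<and> (\<forall>v. F (sym_incl v) = f v)"
proof (rule ex_ex1I)
  let ?h = "\<lambda>m. prod_mset (image_mset f m)"
  obtain F where F: "clinear F" "\<And>p. F (abs_symalg p) = lin_ext ?h p"
    using symalg_linear_lift[of ?h] clinear_lemmas[OF assms]
    by (auto simp: distrib_right scaleC_mult_left)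
  have "F (x * y) = F x * F y" for x y
    by (induction x; induction y) (simp add: times_symalg.abs_eq F lin_ext_mult)
  moreover have "F 1 = 1" 
    by (simp add: one_symalg.abs_eq F flip: single_one)
  moreover have "F (sym_incl v) = f v" for v
    by (simp add: sym_incl.abs_eq F scaleC_one)
  ultimately show "\<exists>F. calgebra_hom F \<and> (\<forall>v. F (sym_incl v) = f v)"
    using F(1) by (auto simp: calgebra_hom_def)
next
  fix F G assume F: "calgebra_hom F \<and> (\<forall>v. F (sym_incl v) = f v)"
    and G: "calgebra_hom G \<and> (\<forall>v. G (sym_incl v) = f v)"
  have "F (sym_prod vs) = G (sym_prod vs)" for vs
    by (induction vs) (use F G in \<open>auto simp: calgebra_hom_def sym_prod_def\<close>)
  then show "F = G" using F G by (intro clinear_symalg_unique) (auto simp: calgebra_hom_def)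
qed

subsection \<open>Universal property of the tensor product, coproduct, tensor product of functionals\<close>

lemma tensor_add_left: "(a + a') \<otimes>\<^sub>T b = a \<otimes>\<^sub>T b + a' \<otimes>\<^sub>T b"
  by transfer (use tensor_rel.intros(1) in \<open>force simp: algebra_simps intro!: ideal_gen_base\<close>)
lemma tensor_add_right: "a \<otimes>\<^sub>T (b + b') = a \<otimes>\<^sub>T b + a \<otimes>\<^sub>T b'"
  by transfer (use tensor_rel.intros(2) in \<open>force simp: algebra_simps intro!: ideal_gen_base\<close>)
lemma tensor_scale_left: "(c *\<^sub>C a) \<otimes>\<^sub>T b = c *\<^sub>C (a \<otimes>\<^sub>T b)"
  by transfer (use tensor_rel.intros(3) in \<open>force simp: pure_tensor_def mult_single intro!: ideal_gen_base\<close>)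
lemma tensor_scale_right: "a \<otimes>\<^sub>T (c *\<^sub>C b) = c *\<^sub>C (a \<otimes>\<^sub>T b)"
  by transfer (use tensor_rel.intros(4) in \<open>force simp: pure_tensor_def mult_single intro!: ideal_gen_base\<close>)
lemma tensor_mult: "(a \<otimes>\<^sub>T b) * (c \<otimes>\<^sub>T d) = (a * c) \<otimes>\<^sub>T (b * d)"
  by transfer (simp add: pure_tensor_def mult_single ideal_gen_zero)
lemma tensor_one: "1 \<otimes>\<^sub>T 1 = 1"
  by transfer (simp add: pure_tensor_def zero_mult_monoid_def[symmetric] zero_prod_def[symmetric] ideal_gen_zero)

theorem sym_coproduct_ex1:
  "\<exists>!\<Delta>. calgebra_hom \<Delta> \<and> (\<forall>v. \<Delta> (sym_incl v) = sym_incl v \<otimes>\<^sub>T 1 + 1 \<otimes>\<^sub>T sym_incl v)"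
  by (rule symalg_universal)
    (simp add: clinear_def sym_incl_add sym_incl_scale tensor_add_left tensor_add_right
      tensor_scale_left tensor_scale_right scaleC_add_right algebra_simps)

lemma tensor_induct [case_names pure add scale]:
  assumes "\<And>a b. P (a \<otimes>\<^sub>T b)" "\<And>x y. P x \<Longrightarrow> P y \<Longrightarrow> P (x + y)" "\<And>c x. P x \<Longrightarrow> P (c *\<^sub>C x)"
  shows "P \<xi>"
proof (induction \<xi> rule: tensor.abs_induct)
  case (1 p)
  show ?case
  proof (induction p rule: poly_mapping_induct_add)
    case 1
    have "0 = 0 *\<^sub>C (0 \<otimes>\<^sub>T 0)" by simp
    then have "P 0" using assms by metis
    then show ?case by (simp add: zero_tensor.abs_eq)
  next
    case (2 k c)
    obtain a b where k: "k = (Mult_Monoid a, Mult_Monoid b)" by (metis mult_monoid.exhaust surj_pair)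
    have "Poly_Mapping.single k c = Poly_Mapping.single 0 c * Poly_Mapping.single k 1"
      by (simp add: mult_single)
    then have "abs_tensor (Poly_Mapping.single k c) = c *\<^sub>C (a \<otimes>\<^sub>T b)"
      by (simp add: scaleC_tensor.abs_eq[symmetric] tensor.abs_eq pure_tensor_def k)
    then show ?case using assms by simp
  next
    case (3 p q)
    then show ?case using assms by (simp flip: plus_tensor.abs_eq)
  qed
qed

theorem tensor_universal:
  fixes \<beta> :: "'a::complex_comm_algebra \<Rightarrow> 'b::complex_comm_algebra \<Rightarrow> 'c::complex_vector"
  assumes l: "\<And>b. clinear (\<lambda>a. \<beta> a b)" and r: "\<And>a. clinear (\<beta> a)"
  shows "\<exists>F. clinear F \<and> (\<forall>a b. F (a \<otimes>\<^sub>T b) = \<beta> a b)"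
proof -
  define h where "h k = \<beta> (case fst k of Mult_Monoid a \<Rightarrow> a) (case snd k of Mult_Monoid b \<Rightarrow> b)" for k
  have ker: "lin_ext h p = 0" if "p \<in> ideal_gen tensor_rel" for p
    using that
  proof (rule lin_ext_ideal)
    fix r and k :: "'a mult_monoid \<times> 'b mult_monoid" assume "r \<in> (tensor_rel :: ('a mult_monoid \<times> 'b mult_monoid \<Rightarrow>\<^sub>0 complex) set)"
    moreover obtain a b where k: "k = (Mult_Monoid a, Mult_Monoid b)" by (metis mult_monoid.exhaust surj_pair)
    ultimately show "lin_ext h (Poly_Mapping.single k 1 * r) = 0"
      using clinear_lemmas(1,2)[OF l] clinear_lemmas(1,2)[OF r]
      by cases (simp_all add: right_diff_distrib mult_single lin_ext_diff pure_tensor_def h_def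
          distrib_left scaleC_mult_right scaleC_one)
  qed
  define F where "F \<phi> = lin_ext h (rep_tensor \<phi>)" for \<phi>
  have F: "F (abs_tensor p) = lin_ext h p" for p
  proof -
    have "rep_tensor (abs_tensor p) - p \<in> ideal_gen tensor_rel"
      using Quotient3_abs_rep[OF Quotient3_tensor, of "abs_tensor p"] by (simp only: tensor.abs_eq_iff)
    then show ?thesis using ker[of "rep_tensor (abs_tensor p) - p"] by (simp add: F_def lin_ext_diff)
  qed
  have "clinear F"
    unfolding clinear_def
  proof (intro conjI allI)
    fix x y :: "('a, 'b) tensor" and c
    show "F (x + y) = F x + F y"
      by (induction x; induction y) (simp add: plus_tensor.abs_eq F lin_ext_add)
    show "F (c *\<^sub>C x) = c *\<^sub>C F x"
      by (induction x) (simp add: scaleC_tensor.abs_eq F lin_ext_smult)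
  qed
  moreover have "F (a \<otimes>\<^sub>T b) = \<beta> a b" for a b
    by (simp add: tensor.abs_eq F pure_tensor_def h_def scaleC_one)
  ultimately show ?thesis by blast
qed

theorem dual_tensor_ex1:
  assumes "antilinear \<Phi>" "antilinear \<Psi>"
  shows "\<exists>!F. antilinear F \<and> (\<forall>\<xi> \<eta>. F (\<xi> \<otimes>\<^sub>T \<eta>) = \<Phi> \<xi> * (\<Psi> \<eta> :: complex))"
proof (rule ex_ex1I)
  obtain G where G: "clinear G" "\<And>a b. G (a \<otimes>\<^sub>T b) = cnj (\<Phi> a * \<Psi> b)"
    using tensor_universal[of "\<lambda>a b. cnj (\<Phi> a * \<Psi> b)"] assms
    by (auto simp: clinear_def antilinear_def algebra_simps scaleC_complex_def)
  then show "\<exists>F. antilinear F \<and> (\<forall>\<xi> \<eta>. F (\<xi> \<otimes>\<^sub>T \<eta>) = \<Phi> \<xi> * \<Psi> \<eta>)"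
    by (intro exI[of _ "\<lambda>x. cnj (G x)"]) (auto simp: clinear_def antilinear_def scaleC_complex_def)
next
  fix F G assume F: "antilinear F \<and> (\<forall>\<xi> \<eta>. F (\<xi> \<otimes>\<^sub>T \<eta>) = \<Phi> \<xi> * \<Psi> \<eta>)"
    and G: "antilinear G \<and> (\<forall>\<xi> \<eta>. G (\<xi> \<otimes>\<^sub>T \<eta>) = \<Phi> \<xi> * \<Psi> \<eta>)"
  show "F = G"
  proof
    fix x show "F x = G x"
      by (induction x rule: tensor_induct) (use F G in \<open>auto simp: antilinear_def\<close>)
  qed
qed


subsection \<open>Annihilators\<close>

theorem annihilator_ex1:
  "\<exists>!D. clinear D \<and> (\<forall>\<phi> \<psi>. D (\<phi> * \<psi>) = D \<phi> * \<psi> + \<phi> * D \<psi>) \<and>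
    D 1 = 0 \<and> (\<forall>w. D (sym_incl w) = cinner v w *\<^sub>C (1 :: 'v::complex_hilbert symalg))"
proof (rule ex_ex1I)
  let ?mon = "\<lambda>m. prod_mset (image_mset (sym_incl :: 'v \<Rightarrow> _) m)"
  define h where "h m = sum_mset (image_mset (\<lambda>x. cinner v x *\<^sub>C ?mon (m - {#x#})) m)" for m
  have h0: "h {#} = 0" by (simp add: h_def)
  have h: "h (add_mset x m) = cinner v x *\<^sub>C ?mon m + sym_incl x * h m" for x m
  proof -
    have "image_mset (\<lambda>y. cinner v y *\<^sub>C ?mon (add_mset x m - {#y#})) m =
        image_mset (\<lambda>y. sym_incl x * (cinner v y *\<^sub>C ?mon (m - {#y#}))) m"
    proof (rule image_mset_cong)
      fix y assume "y \<in># m"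
      then have "add_mset x m - {#y#} = add_mset x (m - {#y#})"
        by (metis add_mset_remove_trivial insert_DiffM add_mset_commute)
      then show "cinner v y *\<^sub>C ?mon (add_mset x m - {#y#}) = sym_incl x * (cinner v y *\<^sub>C ?mon (m - {#y#}))"
        by (simp add: scaleC_mult_right)
    qed
    moreover have "sum_mset (image_mset (\<lambda>y. sym_incl x * f y) m) = sym_incl x * sum_mset (image_mset f m)" for f
      by (induction m) (auto simp: distrib_left)
    ultimately show ?thesis by (simp add: h_def)
  qed
  obtain D where D: "clinear D" "\<And>p. D (abs_symalg p) = lin_ext h p"
    using symalg_linear_lift[of h] 
    by (auto simp: h sym_incl_add sym_incl_scale cinner_add_right cinner_scaleC_right scaleC_add_left
      scaleC_add_right scaleC_scaleC distrib_right scaleC_mult_left)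
  have leib: "h (m + n) = h m * ?mon n + ?mon m * h n" for m n
    by (induction m) (simp_all add: h h0 distrib_left distrib_right scaleC_mult_left mult.assoc)
  have Dmon: "D (?mon m) = h m" for m
    using D(2)[of "Poly_Mapping.single m 1"] by (simp add: abs_symalg_single scaleC_one)
  have "D (\<phi> * \<psi>) = D \<phi> * \<psi> + \<phi> * D \<psi>" for \<phi> \<psi>
  proof (induction \<phi> rule: symalg_induct)
    case (prod vs)
    show ?case
    proof (induction \<psi> rule: symalg_induct)
      case (prod ws)
      have *: "sym_prod us = ?mon (mset us)" for us by (metis mset_map prod_mset_prod_list sym_prod_def)
      have "D (?mon (mset vs) * ?mon (mset ws)) = h (mset vs + mset ws)"
        by (metis Dmon image_mset_union prod_mset_Un)
      then show ?case unfolding * by (simp only: leib Dmon)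
    qed (simp_all add: distrib_left distrib_right clinear_lemmas[OF D(1)] scaleC_mult_left scaleC_mult_right scaleC_add_right algebra_simps)
  qed (simp_all add: distrib_left distrib_right clinear_lemmas[OF D(1)] scaleC_mult_left scaleC_mult_right scaleC_add_right algebra_simps)
  moreover have "D 1 = 0" using Dmon[of "{#}"] h0 by simp
  moreover have "D (sym_incl w) = cinner v w *\<^sub>C 1" for w using Dmon[of "{#w#}"] h[of w "{#}"] h0 by simp
  ultimately show "\<exists>D. clinear D \<and> (\<forall>\<phi> \<psi>. D (\<phi> * \<psi>) = D \<phi> * \<psi> + \<phi> * D \<psi>) \<and>
    D 1 = 0 \<and> (\<forall>w. D (sym_incl w) = cinner v w *\<^sub>C (1 :: 'v symalg))" using D(1) by blast
next
  fix D E :: "'v symalg \<Rightarrow> 'v symalg"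
  assume D: "clinear D \<and> (\<forall>\<phi> \<psi>. D (\<phi> * \<psi>) = D \<phi> * \<psi> + \<phi> * D \<psi>) \<and> D 1 = 0 \<and> (\<forall>w. D (sym_incl w) = cinner v w *\<^sub>C 1)"
    and E: "clinear E \<and> (\<forall>\<phi> \<psi>. E (\<phi> * \<psi>) = E \<phi> * \<psi> + \<phi> * E \<psi>) \<and> E 1 = 0 \<and> (\<forall>w. E (sym_incl w) = cinner v w *\<^sub>C 1)"
  have "D (sym_prod vs) = E (sym_prod vs)" for vs
    by (induction vs) (use D E in \<open>auto simp: sym_prod_def\<close>)
  then show "D = E" using D E by (intro clinear_symalg_unique) auto
qed

subsection \<open>The inner product of the symmetric algebra\<close>

definition permanent :: "'v::complex_hilbert list \<Rightarrow> 'v list \<Rightarrow> complex"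
  where "permanent xs ys = (if length xs = length ys then (\<Sum>\<pi> | \<pi> permutes {..<length xs}. \<Prod>k<length xs. cinner (xs ! k) (ys ! \<pi> k)) else 0)"

lemma permanent_mset_right:
  assumes "mset ys = mset ys'"
  shows "permanent xs ys = permanent xs ys'"
proof (cases "length xs = length ys")
  case True
  let ?n = "length ys"
  obtain \<sigma> where \<sigma>: "\<sigma> permutes {..<?n}" "permute_list \<sigma> ys = ys'"
    using mset_eq_permutation[of ys' ys] assms by metis
  have *: "ys' ! \<pi> k = ys ! (\<sigma> \<circ> \<pi>) k" if "\<pi> permutes {..<?n}" "k < ?n" for \<pi> k
    using permute_list_nth[OF \<sigma>(1), of "\<pi> k"] \<sigma>(2) that permutes_in_image[OF that(1), of k] by simp
  have "permanent xs ys' = (\<Sum>\<pi> | \<pi> permutes {..<?n}. \<Prod>k<?n. cinner (xs ! k) (ys ! (\<sigma> \<circ> \<pi>) k))"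
    unfolding permanent_def using True mset_eq_length[OF assms] * by simp
  also have "\<dots> = permanent xs ys"
    unfolding permanent_def using True setum_permutations_compose_left[OF \<sigma>(1), of "\<lambda>\<pi>. \<Prod>k<?n. cinner (xs ! k) (ys ! \<pi> k)"] by simp
  finally show ?thesis by simp
qed (use assms mset_eq_length in \<open>force simp: permanent_def\<close>)

lemma permanent_commute: "permanent ys xs = cnj (permanent xs ys)"
proof (cases "length xs = length ys")
  case True
  let ?n = "length ys"
  have "cnj (permanent xs ys) = (\<Sum>\<pi> | \<pi> permutes {..<?n}. \<Prod>k<?n. cinner (ys ! \<pi> k) (xs ! k))"
    unfolding permanent_def using True by (auto intro!: sum.cong prod.cong simp: cinner_commute[of "ys ! _"])
  also have "\<dots> = (\<Sum>\<pi> | \<pi> permutes {..<?n}. \<Prod>k<?n. cinner (ys ! k) (xs ! inv \<pi> k))"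
  proof (rule sum.cong)
    fix \<pi> assume "\<pi> \<in> {\<pi>. \<pi> permutes {..<?n}}"
    then have \<pi>: "\<pi> permutes {..<?n}" by simp
    show "(\<Prod>k<?n. cinner (ys ! \<pi> k) (xs ! k)) = (\<Prod>k<?n. cinner (ys ! k) (xs ! inv \<pi> k))"
      using prod.permute[OF \<pi>, of "\<lambda>k. cinner (ys ! k) (xs ! inv \<pi> k)"] permutes_inverses(2)[OF \<pi>]
      by (simp add: o_def)
  qed simp
  also have "\<dots> = permanent ys xs"
    unfolding permanent_def using True sum_permutations_inverse[of "\<lambda>\<pi>. \<Prod>k<?n. cinner (ys ! k) (xs ! \<pi> k)" "{..<?n}"] by auto
  finally show ?thesis by simp
qed (auto simp: permanent_def)

lemma cinner_add_left: "cinner (x + y) z = cinner x z + cinner y z"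
  by (metis cinner_commute cinner_add_right complex_cnj_add)
lemma cinner_scaleC_left: "cinner (c *\<^sub>C x) z = cnj c * cinner x z"
  by (metis cinner_commute cinner_scaleC_right complex_cnj_mult)

lemma permanent_Cons: "permanent (x # xs) ys = (if Suc (length xs) = length ys
    then \<Sum>\<pi> | \<pi> permutes {..<Suc (length xs)}. cinner x (ys ! \<pi> 0) * (\<Prod>k<length xs. cinner (xs ! k) (ys ! \<pi> (Suc k)))
    else 0)"
  proof -
  have "(\<Prod>k<length (x # xs). cinner ((x # xs) ! k) (ys ! \<pi> k)) =
    cinner x (ys ! \<pi> 0) * (\<Prod>k<length xs. cinner (xs ! k) (ys ! \<pi> (Suc k)))" for \<pi>
    by (simp only: length_Cons prod.lessThan_Suc_shift nth_Cons_0 nth_Cons_Suc o_def)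
  then show ?thesis unfolding permanent_def by (simp only: length_Cons)
qed
lemma permanent_add_left: "permanent ((x + y) # xs) ys = permanent (x # xs) ys + permanent (y # xs) ys"
  unfolding permanent_Cons by (simp add: cinner_add_left distrib_right sum.distrib)
lemma permanent_scale_left: "permanent ((c *\<^sub>C x) # xs) ys = cnj c * permanent (x # xs) ys"
  unfolding permanent_Cons by (simp add: cinner_scaleC_left mult.assoc sum_distrib_left)

lemma permanent_mset_left: "mset xs = mset xs' \<Longrightarrow> permanent xs ys = permanent xs' ys"
  by (metis permanent_commute permanent_mset_right)
lemma permanent_add_right: "permanent ys ((x + y) # xs) = permanent ys (x # xs) + permanent ys (y # xs)"
  by (metis permanent_commute permanent_add_left complex_cnj_add)
lemma permanent_scale_right: "permanent ys ((c *\<^sub>C x) # xs) = c * permanent ys (x # xs)"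
  by (metis permanent_commute permanent_scale_left complex_cnj_mult complex_cnj_cnj)

theorem sym_inner_ex1:
  "\<exists>!B. (\<forall>\<psi>. clinear (B \<psi>)) \<and> (\<forall>\<phi>. antilinear (\<lambda>\<psi>. B \<psi> \<phi>)) \<and>
    (\<forall>xs ys. length xs \<noteq> length ys \<longrightarrow> B (sym_prod xs) (sym_prod ys) = 0) \<and>
    (\<forall>xs ys. length xs = length ys \<longrightarrow> B (sym_prod xs) (sym_prod ys) =
      (\<Sum>\<pi> | \<pi> permutes {..<length xs}. \<Prod>k<length xs. cinner (xs ! k) ((ys :: 'v::complex_hilbert list) ! \<pi> k)))"
proof (rule ex_ex1I)
  define l :: "'v multiset \<Rightarrow> 'v list" where "l m = (SOME xs. mset xs = m)" for m
  have l: "mset (l m) = m" for m unfolding l_def using ex_mset[of m] by (rule someI_ex)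
  define H where "H m n = permanent (l m) (l n)" for m n
  have H: "H (mset xs) (mset ys) = permanent xs ys" for xs ys
    unfolding H_def using permanent_mset_left permanent_mset_right l by metis
  have mp: "abs_symalg (Poly_Mapping.single (mset xs) 1) = sym_prod xs" for xs :: "'v list"
    by (metis abs_symalg_single mset_map prod_mset_prod_list sym_prod_def scaleC_one)
  have "\<exists>F. clinear F \<and> (\<forall>p. F (abs_symalg p) = lin_ext (\<lambda>m. cnj (H m n)) p)" for n
  proof (rule symalg_linear_lift)
    fix x y and m :: "'v multiset" and c
    obtain xs ys where [simp]: "m = mset xs" "n = mset ys" by (metis ex_mset)
    show "cnj (H (add_mset (x + y) m) n) = cnj (H (add_mset x m) n) + cnj (H (add_mset y m) n)"
      "cnj (H (add_mset (c *\<^sub>C x) m) n) = c *\<^sub>C cnj (H (add_mset x m) n)"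
      using H[of "_ # xs" ys] by (simp_all add: permanent_add_left permanent_scale_left scaleC_complex_def)
  qed
  then obtain L where L: "\<And>n. clinear (L n)" "\<And>n p. L n (abs_symalg p) = lin_ext (\<lambda>m. cnj (H m n)) p"
    by metis
  have Lp: "L (mset ys) (sym_prod xs) = cnj (permanent xs ys)" for xs ys
    using L(2)[of "mset ys" "Poly_Mapping.single (mset xs) 1"] by (simp add: mp H scaleC_one)
  have L': "L (add_mset (x + y) n) \<psi> = L (add_mset x n) \<psi> + L (add_mset y n) \<psi>"
    "L (add_mset (c *\<^sub>C x) n) \<psi> = cnj c * L (add_mset x n) \<psi>" for x y n c \<psi>
  proof (atomize (full), induction \<psi> rule: symalg_induct)
    case (prod vs)
    obtain ys where [simp]: "n = mset ys" by (metis ex_mset)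
    show ?case using Lp[of "_ # ys" vs] by (simp add: permanent_add_right permanent_scale_right)
  qed (auto simp: clinear_lemmas[OF L(1)] scaleC_complex_def algebra_simps)
  have "\<exists>F. clinear F \<and> (\<forall>p. F (abs_symalg p) = lin_ext (\<lambda>n. cnj (L n \<psi>)) p)" for \<psi>
    by (rule symalg_linear_lift) (simp_all add: L' scaleC_complex_def)
  then obtain B where B: "\<And>\<psi>. clinear (B \<psi>)" "\<And>\<psi> p. B \<psi> (abs_symalg p) = lin_ext (\<lambda>n. cnj (L n \<psi>)) p"
    by metis
  have "antilinear (\<lambda>\<psi>. B \<psi> \<phi>)" for \<phi>
    by (induction \<phi> rule: symalg.abs_induct)
      (simp add: antilinear_def B lin_ext_def clinear_lemmas[OF L(1)] scaleC_complex_def algebra_simps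
         sum.distrib sum_distrib_left)
  moreover have "B (sym_prod xs) (sym_prod ys) = permanent xs ys" for xs ys
    using B(2)[of "sym_prod xs" "Poly_Mapping.single (mset ys) 1"] by (simp add: mp Lp scaleC_one)
  ultimately show "\<exists>B. (\<forall>\<psi>. clinear (B \<psi>)) \<and> (\<forall>\<phi>. antilinear (\<lambda>\<psi>. B \<psi> \<phi>)) \<and>
    (\<forall>xs ys. length xs \<noteq> length ys \<longrightarrow> B (sym_prod xs) (sym_prod ys) = 0) \<and>
    (\<forall>xs ys. length xs = length ys \<longrightarrow> B (sym_prod xs) (sym_prod ys) =
      (\<Sum>\<pi> | \<pi> permutes {..<length xs}. \<Prod>k<length xs. cinner (xs ! k) ((ys :: 'v list) ! \<pi> k)))"
    using B(1) by (intro exI[of _ B]) (auto simp: permanent_def)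
next
  fix B C :: "'v symalg \<Rightarrow> 'v symalg \<Rightarrow> complex"
  assume B: "(\<forall>\<psi>. clinear (B \<psi>)) \<and> (\<forall>\<phi>. antilinear (\<lambda>\<psi>. B \<psi> \<phi>)) \<and>
    (\<forall>xs ys. length xs \<noteq> length ys \<longrightarrow> B (sym_prod xs) (sym_prod ys) = 0) \<and>
    (\<forall>xs ys. length xs = length ys \<longrightarrow> B (sym_prod xs) (sym_prod ys) =
      (\<Sum>\<pi> | \<pi> permutes {..<length xs}. \<Prod>k<length xs. cinner (xs ! k) (ys ! \<pi> k)))"
   and C: "(\<forall>\<psi>. clinear (C \<psi>)) \<and> (\<forall>\<phi>. antilinear (\<lambda>\<psi>. C \<psi> \<phi>)) \<and>
    (\<forall>xs ys. length xs \<noteq> length ys \<longrightarrow> C (sym_prod xs) (sym_prod ys) = 0) \<and>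
    (\<forall>xs ys. length xs = length ys \<longrightarrow> C (sym_prod xs) (sym_prod ys) =
      (\<Sum>\<pi> | \<pi> permutes {..<length xs}. \<Prod>k<length xs. cinner (xs ! k) (ys ! \<pi> k)))"
  have 1: "B (sym_prod xs) (sym_prod ys) = C (sym_prod xs) (sym_prod ys)" for xs ys
    using B C by (cases "length xs = length ys") auto
  have 2: "B (sym_prod xs) = C (sym_prod xs)" for xs
    using B C 1 by (intro clinear_symalg_unique) auto
  show "B = C"
  proof
    fix \<psi> show "B \<psi> = C \<psi>"
      by (induction \<psi> rule: symalg_induct) (use B C 2 in \<open>auto simp: antilinear_def fun_eq_iff\<close>)
  qed
qed

end

theory Submission
  imports Defs
begin

text \<open>
  Let \<open>C\<close> and \<open>A\<close> be the complex-linear and the antilinear part of \<open>g\<close>, and put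
  \<open>c\<^sub>g(v) = c(Cv) + a(Av)\<close> and \<open>a\<^sub>g(v) = a(Cv) + c(Av)\<close>. Because \<open>g\<close> preserves \<open>\<Omega>\<close>, these operators
  satisfy the commutation relations of \<open>c(v)\<close> and \<open>a(v)\<close> (\<open>c_op_commute\<close>, \<open>a_op_c_op\<close>). The Gaussian
  \<open>e\<^sup>Z\<close> solves \<open>a(v) e\<^sup>Z = c(Zv) e\<^sup>Z\<close>, so \<open>ZC = - A\<close> means that it is annihilated by every \<open>a\<^sub>g(v)\<close>: it is
  a vacuum for the new operators. Hence \<open>U\<^sub>g\<close> intertwines \<open>c(v), a(v)\<close> with \<open>c\<^sub>g(v), a\<^sub>g(v)\<close>. As \<open>c\<^sub>g(v)\<close> and
  \<open>a\<^sub>g(v)\<close> are adjoint to each other, the form \<open>\<langle>U\<^sub>g \<phi>|U\<^sub>g \<psi>\<rangle>\<close> obeys the recursion that determines the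
  inner product of \<open>SV\<close>, up to the factor \<open>\<parallel>e\<^sup>Z\<parallel>\<^sup>2\<close>; so \<open>U(g)\<close> is isometric (\<open>dip_U\<close>).

  For this to make sense, \<open>e\<^sup>Z\<close> has to lie in Fock space together with all its images under ladder
  operators, and adjointness has to hold on these vectors. Fock space is the space of bounded
  antilinear functionals on the pre-Hilbert space \<open>SV\<close> (\<open>fock_space_eq_antidual\<close>), in which \<open>SV\<close> is dense
  and which is complete. A functional is called dilatable here if it stays bounded after a
  dilation of \<open>V\<close> by some \<open>r > 1\<close>. A dilation beats the growth \<open>\<surd>d\<close> of the ladder operators in
  degree \<open>d\<close>; so they preserve dilatability, and they are adjoint to each other on dilatable
  functionals (\<open>dip_creator\<close>). The Gaussian is dilatable: if \<open>F\<^sub>d\<close> is the component of \<open>e\<^sup>Z\<close> of degree \<open>d\<close>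
  over a finite-dimensional subspace, then the differential equation and the number operator give
  \<open>d \<parallel>F\<^sub>d\<parallel>\<^sup>2 \<le> (h + t (d - 2)) \<parallel>F\<^bsub>d-2\<^esub>\<parallel>\<^sup>2\<close>, where \<open>h\<close> bounds the squared Hilbert-Schmidt norm and
  \<open>t < 1\<close> the squared operator norm of \<open>Z\<close> (\<open>gaussian_recursion\<close>). This bounds \<open>\<Sum>\<^sub>d \<parallel>F\<^sub>d\<parallel>\<^sup>2\<close> independently of
  the subspace, and \<open>t < 1\<close> leaves room for a dilation.

  The isometric extension \<open>T\<close> of \<open>U(g)\<close> has closed range, so it is onto as soon as its range contains
  \<open>SV\<close>. It intertwines the operators \<open>c, a\<close> belonging to \<open>g\<^sup>-\<^sup>1\<close> with the plain \<open>c, a\<close>. So \<open>T\<close> maps the Gaussian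
  of \<open>g\<^sup>-\<^sup>1\<close> to a functional that is annihilated by all \<open>a(v)\<close>, that is, to a multiple of the vacuum
  \<open>1\<close>; the multiple is not zero because \<open>T\<close> is isometric. Applying creators shows that \<open>T\<close> inverts
  \<open>U\<close> of \<open>g\<^sup>-\<^sup>1\<close> on \<open>SV\<close> up to this factor (\<open>U_normalized_unitary\<close>).
\<close>

section \<open>Complex inner product spaces and their antiduals\<close>

lemma antilinear_lemmas:
  assumes "antilinear f"
  shows "f (x + y) = f x + f y" "f (c *\<^sub>C x) = cnj c *\<^sub>C f x" "f 0 = 0" "f (- x) = - f x" "f (x - y) = f x - f y"
proof -
  show 1: "f (x + y) = f x + f y" for x y using assms by (simp add: antilinear_def)
  show "f (c *\<^sub>C x) = cnj c *\<^sub>C f x" using assms by (simp add: antilinear_def)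
  show 0: "f 0 = 0" using 1[of 0 0] by simp
  show 2: "f (- x) = - f x" for x using 1[of x "-x"] 0 by (simp add: eq_neg_iff_add_eq_0 add.commute)
  show "f (x - y) = f x - f y" using 1[of x "-y"] 2[of y] by simp
qed

lemma antilinear_sum: "antilinear f \<Longrightarrow> f (sum h I) = (\<Sum>i\<in>I. f (h i))"
  by (induction I rule: infinite_finite_induct) (simp_all add: antilinear_lemmas)

lemma clinear_sum: "clinear f \<Longrightarrow> f (sum h I) = (\<Sum>i\<in>I. f (h i))"
  by (induction I rule: infinite_finite_induct) (simp_all add: clinear_lemmas)

lemma antilinear_add_fun: "antilinear F \<Longrightarrow> antilinear G \<Longrightarrow> antilinear (F + G)"
  by (simp add: antilinear_def scaleC_add_right algebra_simps)

lemma antilinear_diff_fun: "antilinear F \<Longrightarrow> antilinear G \<Longrightarrow> antilinear (F - G)"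
  by (simp add: antilinear_def complex_vector.scale_right_diff_distrib algebra_simps)

lemma antilinear_scale_fun: "antilinear F \<Longrightarrow> antilinear (c *\<^sub>C F)"
  by (simp add: antilinear_def scaleC_add_right scaleC_fun_def scaleC_scaleC mult.commute)

lemma tendsto_0_bound:
  fixes f :: "nat \<Rightarrow> 'b::real_normed_vector"
  assumes "g \<longlonglongrightarrow> 0" "\<And>n. norm (f n) \<le> g n"
  shows "f \<longlonglongrightarrow> 0"
  by (rule Lim_null_comparison[OF _ assms(1)]) (simp add: assms(2))

text \<open>
  Both \<open>V\<close> and its symmetric algebra are instances; the latter is not complete, and its inner product
  becomes positive definite only through a proof, so a locale takes the place of a type class.
\<close>

locale pre_hilbert =
  fixes ip :: "'a::complex_vector \<Rightarrow> 'a \<Rightarrow> complex"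
  assumes ip_add_right: "ip x (y + z) = ip x y + ip x z"
    and ip_scale_right: "ip x (c *\<^sub>C y) = c * ip x y"
    and ip_commute: "ip x y = cnj (ip y x)"
    and ip_ge_0: "0 \<le> Re (ip x x)"
    and ip_definite: "Re (ip x x) = 0 \<Longrightarrow> x = 0"
begin

definition nrm :: "'a \<Rightarrow> real"
  where "nrm x = sqrt (Re (ip x x))"

definition emb :: "'a \<Rightarrow> 'a \<Rightarrow> complex"
  where "emb \<phi> = (\<lambda>\<psi>. ip \<psi> \<phi>)"

lemma emb_apply: "emb \<phi> \<psi> = ip \<psi> \<phi>"
  by (simp add: emb_def)

lemma clinear_ip: "clinear (ip x)"
  by (simp add: clinear_def ip_add_right ip_scale_right scaleC_complex_def)

lemma antilinear_emb: "antilinear (emb x)"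
  unfolding antilinear_def emb_def
  by (metis clinear_ip ip_commute clinear_lemmas(1,2) complex_cnj_add complex_cnj_mult scaleC_complex_def)

lemmas ip_right = clinear_lemmas[OF clinear_ip, unfolded scaleC_complex_def]
lemmas ip_left = antilinear_lemmas[OF antilinear_emb, unfolded emb_def scaleC_complex_def]
lemmas ip_sum_right = clinear_sum[OF clinear_ip]

lemma emb_add: "emb (x + y) = emb x + emb y"
  by (simp add: emb_def fun_eq_iff ip_right)

lemma emb_diff: "emb (x - y) = emb x - emb y"
  by (simp add: emb_def fun_eq_iff ip_right)

lemma emb_scale: "emb (c *\<^sub>C x) = c *\<^sub>C emb x"
  by (simp add: emb_def fun_eq_iff ip_right scaleC_fun_def scaleC_complex_def)

lemma nrm_ge_0 [simp]: "0 \<le> nrm x"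
  by (simp add: nrm_def ip_ge_0)

lemma nrm_sq: "(nrm x)\<^sup>2 = Re (ip x x)"
  by (simp add: nrm_def ip_ge_0)

lemma ip_self: "ip x x = complex_of_real ((nrm x)\<^sup>2)"
  by (metis Reals_cnj_iff complex_is_Real_iff ip_commute nrm_sq of_real_Re)

lemma nrm_eq_0_iff [simp]: "nrm x = 0 \<longleftrightarrow> x = 0"
  using ip_definite[of x] by (auto simp: nrm_def ip_right)

lemma nrm_0 [simp]: "nrm 0 = 0" by simp

lemma nrm_scale: "nrm (c *\<^sub>C x) = cmod c * nrm x"
proof -
  have "ip (c *\<^sub>C x) (c *\<^sub>C x) = (c * cnj c) * ip x x"
    by (simp add: ip_left ip_right mult_ac)
  also have "\<dots> = complex_of_real ((cmod c * nrm x)\<^sup>2)"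
    unfolding ip_self complex_norm_square[symmetric] by (simp add: power_mult_distrib)
  finally have "ip (c *\<^sub>C x) (c *\<^sub>C x) = complex_of_real ((cmod c * nrm x)\<^sup>2)" .
  then show ?thesis
    by (simp add: nrm_def[of "c *\<^sub>C x"] del: of_real_mult of_real_power)
qed

lemma nrm_add_sq: "(nrm (x + y))\<^sup>2 = (nrm x)\<^sup>2 + (nrm y)\<^sup>2 + 2 * Re (ip x y)"
  using ip_commute[of y x] by (simp add: nrm_sq ip_left ip_right)

lemma nrm_add_sq_orth: "ip x y = 0 \<Longrightarrow> (nrm (x + y))\<^sup>2 = (nrm x)\<^sup>2 + (nrm y)\<^sup>2"
  by (simp add: nrm_add_sq)

lemma nrm_sum_sq_orth:
  assumes "finite I" "\<And>i j. i \<in> I \<Longrightarrow> j \<in> I \<Longrightarrow> i \<noteq> j \<Longrightarrow> ip (f i) (f j) = 0"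
  shows "(nrm (sum f I))\<^sup>2 = (\<Sum>i\<in>I. (nrm (f i))\<^sup>2)"
  using assms
proof (induction I)
  case (insert i I)
  then have "ip (f i) (sum f I) = 0"
    unfolding ip_sum_right by (intro sum.neutral) (metis insert_iff)
  with insert show ?case by (simp add: nrm_add_sq_orth)
qed simp

lemma Cauchy_Schwarz: "cmod (ip x y) \<le> nrm x * nrm y"
proof (cases "x = 0")
  case False
  then have nx: "nrm x > 0" using nrm_ge_0[of x] nrm_eq_0_iff[of x] by linarith
  define c where "c = ip x y / complex_of_real ((nrm x)\<^sup>2)"
  define z where "z = y - c *\<^sub>C x"
  have "ip x z = 0"
    using nx by (simp add: z_def c_def ip_right ip_left ip_self[of x])
  then have "ip (c *\<^sub>C x) z = 0" by (simp add: ip_left)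
  then have "(nrm (c *\<^sub>C x + z))\<^sup>2 = (nrm (c *\<^sub>C x))\<^sup>2 + (nrm z)\<^sup>2" by (rule nrm_add_sq_orth)
  then have "(nrm (c *\<^sub>C x))\<^sup>2 \<le> (nrm y)\<^sup>2" by (simp add: z_def)
  then have "nrm (c *\<^sub>C x) \<le> nrm y" by (simp add: power2_le_iff_abs_le)
  moreover have "nrm (c *\<^sub>C x) = cmod (ip x y) / nrm x"
    using nx by (simp add: nrm_scale c_def norm_divide norm_mult power2_eq_square)
  ultimately show ?thesis using nx by (simp add: field_simps)
qed (use ip_left(3) in simp)

lemma nrm_triangle: "nrm (x + y) \<le> nrm x + nrm y"
proof (rule power2_le_imp_le)
  have "Re (ip x y) \<le> nrm x * nrm y"
    using Cauchy_Schwarz complex_Re_le_cmod order_trans by blast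
  then show "(nrm (x + y))\<^sup>2 \<le> (nrm x + nrm y)\<^sup>2"
    by (simp add: nrm_add_sq power2_sum)
qed simp

lemma nrm_sum_le: "nrm (sum f I) \<le> (\<Sum>i\<in>I. nrm (f i))"
proof (induction I rule: infinite_finite_induct)
  case (insert i I)
  then show ?case using nrm_triangle[of "f i" "sum f I"] by simp
qed simp_all

subsection \<open>Orthonormal systems\<close>

text \<open>
  Finiteness is included, so that all expansions are finite sums.
\<close>

definition orthonormal :: "'a set \<Rightarrow> bool"
  where "orthonormal B \<longleftrightarrow> finite B \<and> (\<forall>e\<in>B. \<forall>f\<in>B. ip e f = (if e = f then 1 else 0))"

lemma orthonormal_finite: "orthonormal B \<Longrightarrow> finite B"
  by (simp add: orthonormal_def)

lemma orthonormal_ip_sum: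
  assumes "orthonormal B" "e \<in> B"
  shows "ip e (\<Sum>f\<in>B. c f *\<^sub>C f) = c e"
proof -
  have "ip e (\<Sum>f\<in>B. c f *\<^sub>C f) = (\<Sum>f\<in>B. if f = e then c e else 0)"
    unfolding ip_sum_right using assms
    by (intro sum.cong) (auto simp: ip_right orthonormal_def)
  then show ?thesis using assms by (simp add: orthonormal_def)
qed

lemma orthonormal_nrm_sum:
  assumes "orthonormal B"
  shows "(nrm (\<Sum>f\<in>B. c f *\<^sub>C f))\<^sup>2 = (\<Sum>f\<in>B. (cmod (c f))\<^sup>2)"
proof -
  have "(nrm (\<Sum>f\<in>B. c f *\<^sub>C f))\<^sup>2 = (\<Sum>f\<in>B. (nrm (c f *\<^sub>C f))\<^sup>2)"
    using assms by (intro nrm_sum_sq_orth) (auto simp: orthonormal_def ip_left ip_right)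
  also have "\<dots> = (\<Sum>f\<in>B. (cmod (c f))\<^sup>2)"
    using assms by (intro sum.cong) (auto simp: nrm_scale power_mult_distrib nrm_sq orthonormal_def)
  finally show ?thesis .
qed

lemma orthonormal_residual:
  assumes "orthonormal B" "w \<in> cspan B"
  shows "ip w (x - (\<Sum>e\<in>B. ip e x *\<^sub>C e)) = 0"
  using assms(2)
proof (induction rule: complex_vector.span_induct_alt)
  case base then show ?case by (simp add: ip_left)
next
  case (step c e w)
  then show ?case using orthonormal_ip_sum[OF assms(1), of e "\<lambda>f. ip f x"] by (simp add: ip_left ip_right)
qed

lemma sum_in_cspan: "finite B \<Longrightarrow> (\<Sum>e\<in>B. c e *\<^sub>C e) \<in> cspan B"
  by (intro complex_vector.span_sum complex_vector.span_scale complex_vector.span_base)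

lemma orthonormal_expand:
  assumes "orthonormal B" "x \<in> cspan B"
  shows "x = (\<Sum>e\<in>B. ip e x *\<^sub>C e)"
proof -
  let ?r = "x - (\<Sum>e\<in>B. ip e x *\<^sub>C e)"
  have "?r \<in> cspan B"
    using assms by (intro complex_vector.span_diff sum_in_cspan) (auto simp: orthonormal_def)
  then have "ip ?r ?r = 0" by (rule orthonormal_residual[OF assms(1)])
  then have "nrm ?r = 0" by (simp add: nrm_def)
  then show ?thesis by simp
qed

lemma Parseval_span:
  assumes "orthonormal B" "x \<in> cspan B"
  shows "(nrm x)\<^sup>2 = (\<Sum>e\<in>B. (cmod (ip e x))\<^sup>2)"
  by (subst orthonormal_expand[OF assms]) (rule orthonormal_nrm_sum[OF assms(1)])

lemma Bessel:
  assumes "orthonormal B"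
  shows "(\<Sum>e\<in>B. (cmod (ip e x))\<^sup>2) \<le> (nrm x)\<^sup>2"
proof -
  define p where "p = (\<Sum>e\<in>B. ip e x *\<^sub>C e)"
  have "p \<in> cspan B" unfolding p_def using assms by (intro sum_in_cspan) (auto simp: orthonormal_def)
  then have "ip p (x - p) = 0" unfolding p_def by (rule orthonormal_residual[OF assms])
  then have "(nrm (p + (x - p)))\<^sup>2 = (nrm p)\<^sup>2 + (nrm (x - p))\<^sup>2" by (rule nrm_add_sq_orth)
  then have "(nrm p)\<^sup>2 \<le> (nrm x)\<^sup>2" by simp
  then show ?thesis using orthonormal_nrm_sum[OF assms, of "\<lambda>e. ip e x"] by (simp add: p_def)
qed

text \<open>
  Gram-Schmidt: the next vector contributes the normalized remainder after its projection to the span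
  of the previous ones, unless the remainder is zero.
\<close>

lemma exists_orthonormal:
  assumes "finite S"
  obtains B where "orthonormal B" "cspan B = cspan S"
proof -
  have "\<exists>B. orthonormal B \<and> cspan B = cspan S"
    using assms
  proof induction
    case empty
    have "orthonormal {}" by (simp add: orthonormal_def)
    then show ?case by blast
  next
    case (insert x S)
    then obtain B where B: "orthonormal B" "cspan B = cspan S" by blast
    define p where "p = (\<Sum>e\<in>B. ip e x *\<^sub>C e)"
    have p: "p \<in> cspan B" unfolding p_def using B by (intro sum_in_cspan) (auto simp: orthonormal_def)
    show ?case
    proof (cases "x = p")
      case True
      then have "cspan (insert x S) = cspan S"
        using p B by (intro complex_vector.span_redundant) auto
      then show ?thesis using B by blast
    next
      case False
      define y where "y = complex_of_real (1 / nrm (x - p)) *\<^sub>C (x - p)"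
      have n: "nrm (x - p) > 0" using False by (simp add: order_less_le)
      have ny: "nrm y = 1" using n False by (simp add: y_def nrm_scale norm_divide)
      then have yy: "ip y y = 1" by (simp add: ip_self)
      have oy: "ip e y = 0" if "e \<in> B" for e
        using orthonormal_residual[OF B(1) complex_vector.span_base[OF that], of x]
        by (simp add: y_def p_def ip_right)
      moreover have "ip y e = 0" if "e \<in> B" for e using oy[OF that] ip_commute[of y e] by simp
      ultimately have on: "orthonormal (insert y B)"
        using B(1) yy by (auto simp: orthonormal_def)
      have "cspan (insert y B) \<subseteq> cspan (insert x S)"
      proof (rule complex_vector.span_minimal)
        have "B \<subseteq> cspan (insert x S)"
          using B(2) complex_vector.span_superset complex_vector.span_mono[of S "insert x S"] by blast
        moreover have "p \<in> cspan (insert x S)"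
          using p B(2) complex_vector.span_mono[of S "insert x S"] by blast
        moreover have "x \<in> cspan (insert x S)" by (simp add: complex_vector.span_base)
        ultimately show "insert y B \<subseteq> cspan (insert x S)"
          using complex_vector.span_scale[OF complex_vector.span_diff] by (simp add: y_def)
      qed (rule complex_vector.subspace_span)
      moreover have "cspan (insert x S) \<subseteq> cspan (insert y B)"
      proof (rule complex_vector.span_minimal)
        have "x = p + complex_of_real (nrm (x - p)) *\<^sub>C y"
          using n by (simp add: y_def scaleC_scaleC scaleC_one)
        moreover have "p \<in> cspan (insert y B)"
          using p complex_vector.span_mono[of B "insert y B"] by blast
        ultimately have "x \<in> cspan (insert y B)"
          by (metis complex_vector.span_add complex_vector.span_scale complex_vector.span_base insertI1)
        moreover have "S \<subseteq> cspan (insert y B)"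
          using B(2) complex_vector.span_superset complex_vector.span_mono[of B "insert y B"] by blast
        ultimately show "insert x S \<subseteq> cspan (insert y B)" by blast
      qed (rule complex_vector.subspace_span)
      ultimately show ?thesis using on by blast
    qed
  qed
  then show ?thesis using that by blast
qed

lemma Riesz_cspan:
  assumes "finite S" "antilinear F"
  shows "\<exists>!\<phi>. \<phi> \<in> cspan S \<and> (\<forall>\<psi>\<in>cspan S. F \<psi> = ip \<psi> \<phi>)"
proof -
  obtain B where B: "orthonormal B" "cspan B = cspan S" using exists_orthonormal[OF assms(1)] .
  define \<phi> where "\<phi> = (\<Sum>e\<in>B. F e *\<^sub>C e)"
  have \<phi>: "\<phi> \<in> cspan S" unfolding \<phi>_def using B by (metis sum_in_cspan orthonormal_def)
  have "F \<psi> = ip \<psi> \<phi>" if "\<psi> \<in> cspan B" for \<psi>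
    using that
  proof (induction rule: complex_vector.span_induct_alt)
    case base then show ?case by (simp add: ip_left antilinear_lemmas[OF assms(2)])
  next
    case (step c e w)
    then show ?case using orthonormal_ip_sum[OF B(1), of e F]
      by (simp add: ip_left antilinear_lemmas[OF assms(2)] \<phi>_def scaleC_complex_def)
  qed
  moreover have "\<phi>' = \<phi>''" if "\<phi>' \<in> cspan S" "\<phi>'' \<in> cspan S" "\<forall>\<psi>\<in>cspan S. F \<psi> = ip \<psi> \<phi>'" "\<forall>\<psi>\<in>cspan S. F \<psi> = ip \<psi> \<phi>''" for \<phi>' \<phi>''
  proof -
    have "\<phi>' - \<phi>'' \<in> cspan S" using that by (intro complex_vector.span_diff)
    then have "ip (\<phi>' - \<phi>'') \<phi>' = ip (\<phi>' - \<phi>'') \<phi>''" using that by metis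
    then have "ip (\<phi>' - \<phi>'') (\<phi>' - \<phi>'') = 0" by (simp add: ip_right)
    then have "nrm (\<phi>' - \<phi>'') = 0" by (simp add: nrm_def)
    then show ?thesis by simp
  qed
  ultimately show ?thesis using \<phi> B(2) by (metis (no_types, lifting))
qed

text \<open>
  A scalar matrix acts on tuples of vectors with the same bound as on tuples of numbers: expand the
  vectors in an orthonormal basis of their span and apply the scalar bound to each coordinate.
\<close>

lemma contraction_vector_valued:
  fixes y :: "'i \<Rightarrow> 'i \<Rightarrow> complex"
  assumes "finite I" and y: "\<And>c. (\<Sum>i\<in>I. (cmod (\<Sum>j\<in>I. y i j * c j))\<^sup>2) \<le> t * (\<Sum>j\<in>I. (cmod (c j))\<^sup>2)"
  shows "(\<Sum>i\<in>I. (nrm (\<Sum>j\<in>I. y i j *\<^sub>C G j))\<^sup>2) \<le> t * (\<Sum>j\<in>I. (nrm (G j))\<^sup>2)"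
proof -
  obtain U where U: "orthonormal U" "cspan U = cspan (G ` I)"
    using exists_orthonormal[of "G ` I"] assms(1) by auto
  have G: "G j \<in> cspan U" if "j \<in> I" for j using that U by (simp add: complex_vector.span_base)
  have "(\<Sum>i\<in>I. (nrm (\<Sum>j\<in>I. y i j *\<^sub>C G j))\<^sup>2) = (\<Sum>i\<in>I. \<Sum>u\<in>U. (cmod (\<Sum>j\<in>I. y i j * ip u (G j)))\<^sup>2)"
  proof (rule sum.cong)
    fix i
    have "(\<Sum>j\<in>I. y i j *\<^sub>C G j) \<in> cspan U"
      by (intro complex_vector.span_sum complex_vector.span_scale G)
    from Parseval_span[OF U(1) this]
    show "(nrm (\<Sum>j\<in>I. y i j *\<^sub>C G j))\<^sup>2 = (\<Sum>u\<in>U. (cmod (\<Sum>j\<in>I. y i j * ip u (G j)))\<^sup>2)"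
      by (simp add: ip_sum_right ip_right)
  qed simp
  also have "\<dots> = (\<Sum>u\<in>U. \<Sum>i\<in>I. (cmod (\<Sum>j\<in>I. y i j * ip u (G j)))\<^sup>2)" by (rule sum.swap)
  also have "\<dots> \<le> (\<Sum>u\<in>U. t * (\<Sum>j\<in>I. (cmod (ip u (G j)))\<^sup>2))" by (intro sum_mono y)
  also have "\<dots> = t * (\<Sum>j\<in>I. \<Sum>u\<in>U. (cmod (ip u (G j)))\<^sup>2)"
    by (subst sum.swap) (simp add: sum_distrib_left)
  also have "\<dots> = t * (\<Sum>j\<in>I. (nrm (G j))\<^sup>2)"
    using Parseval_span[OF U(1) G] by simp
  finally show ?thesis .
qed

text \<open>
  The hard half of Parseval's identity for an infinite orthonormal basis, simultaneously for finitely
  many vectors: the projection of \<open>w\<close> to the span of a finite \<open>G \<subseteq> E\<close> is the best approximation of \<open>w\<close>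
  there, so what is lost is at most the squared distance of \<open>w\<close> to that span.
\<close>

lemma total_orthonormal_approx:
  assumes on: "\<And>F. finite F \<Longrightarrow> F \<subseteq> E \<Longrightarrow> orthonormal F"
    and dense: "\<And>w \<delta>. \<delta> > 0 \<Longrightarrow> \<exists>u\<in>cspan E. nrm (w - u) < \<delta>"
    and "finite W" "\<epsilon> > 0"
  shows "\<exists>F. finite F \<and> F \<subseteq> E \<and> (\<forall>w\<in>W. (nrm w)\<^sup>2 \<le> (\<Sum>e\<in>F. (cmod (ip e w))\<^sup>2) + \<epsilon>)"
  using assms(3)
proof induction
  case empty
  show ?case by (rule exI[of _ "{}"]) simp
next
  case (insert w W)
  then obtain F where F: "finite F" "F \<subseteq> E" "\<And>w. w \<in> W \<Longrightarrow> (nrm w)\<^sup>2 \<le> (\<Sum>e\<in>F. (cmod (ip e w))\<^sup>2) + \<epsilon>"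
    by blast
  have span: "\<exists>G. finite G \<and> G \<subseteq> E \<and> u \<in> cspan G" if "u \<in> cspan E" for u
    using that
  proof (induction rule: complex_vector.span_induct_alt)
    case base show ?case by (rule exI[of _ "{}"]) (simp add: complex_vector.span_zero)
  next
    case (step c e u)
    then obtain G where G: "finite G" "G \<subseteq> E" "u \<in> cspan G" by blast
    have "c *\<^sub>C e + u \<in> cspan (insert e G)"
      using G(3) complex_vector.span_mono[of G "insert e G"]
      by (intro complex_vector.span_add complex_vector.span_scale) (auto intro: complex_vector.span_base)
    then show ?case using G step(1) by (intro exI[of _ "insert e G"]) auto
  qed
  obtain u where u: "u \<in> cspan E" "nrm (w - u) < sqrt \<epsilon>" using dense[of "sqrt \<epsilon>" w] \<open>\<epsilon> > 0\<close> by auto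
  obtain G where G: "finite G" "G \<subseteq> E" "u \<in> cspan G" using span[OF u(1)] by blast
  have oG: "orthonormal G" by (rule on[OF G(1,2)])
  define p where "p = (\<Sum>e\<in>G. ip e w *\<^sub>C e)"
  have p: "p \<in> cspan G" unfolding p_def by (rule sum_in_cspan[OF G(1)])
  have o: "ip x (w - p) = 0" if "x \<in> cspan G" for x
    using orthonormal_residual[OF oG that] unfolding p_def .
  have "(nrm (p + (w - p)))\<^sup>2 = (nrm p)\<^sup>2 + (nrm (w - p))\<^sup>2" by (rule nrm_add_sq_orth[OF o[OF p]])
  then have 1: "(nrm w)\<^sup>2 = (\<Sum>e\<in>G. (cmod (ip e w))\<^sup>2) + (nrm (w - p))\<^sup>2"
    using orthonormal_nrm_sum[OF oG, of "\<lambda>e. ip e w"] by (simp add: p_def)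
  have "p - u \<in> cspan G" using p G(3) by (rule complex_vector.span_diff)
  from nrm_add_sq_orth[OF o[OF this]] have "(nrm (w - p))\<^sup>2 \<le> (nrm (w - u))\<^sup>2" by simp
  also have "\<dots> \<le> (sqrt \<epsilon>)\<^sup>2" using u(2) by (intro power_mono) auto
  finally have 2: "(nrm w)\<^sup>2 \<le> (\<Sum>e\<in>G. (cmod (ip e w))\<^sup>2) + \<epsilon>" using 1 \<open>\<epsilon> > 0\<close> by simp
  have mono: "(\<Sum>e\<in>H. (cmod (ip e x))\<^sup>2) \<le> (\<Sum>e\<in>F \<union> G. (cmod (ip e x))\<^sup>2)" if "H \<subseteq> F \<union> G" for H x
    using that F(1) G(1) by (intro sum_mono2) auto
  have "(nrm x)\<^sup>2 \<le> (\<Sum>e\<in>F \<union> G. (cmod (ip e x))\<^sup>2) + \<epsilon>" if "x \<in> insert w W" for x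
    using that 2 F(3)[of x] mono[of F x] mono[of G x] by auto
  then show ?case using F(1,2) G(1,2) by (intro exI[of _ "F \<union> G"]) auto
qed

subsection \<open>The antidual as a completion\<close>

definition bound_by :: "('a \<Rightarrow> complex) \<Rightarrow> real \<Rightarrow> bool"
  where "bound_by F K \<longleftrightarrow> 0 \<le> K \<and> (\<forall>x. cmod (F x) \<le> K * nrm x)"

definition antidual :: "('a \<Rightarrow> complex) set"
  where "antidual = {F. antilinear F \<and> (\<exists>K. bound_by F K)}"

definition dnorm :: "('a \<Rightarrow> complex) \<Rightarrow> real"
  where "dnorm F = Inf {K. bound_by F K}"

lemma antidual_antilinear: "F \<in> antidual \<Longrightarrow> antilinear F"
  by (simp add: antidual_def)

lemma dnorm_le: "bound_by F K \<Longrightarrow> dnorm F \<le> K"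
  unfolding dnorm_def by (rule cInf_lower) (auto simp: bdd_below_def bound_by_def)

lemma antidualI: "antilinear F \<Longrightarrow> bound_by F K \<Longrightarrow> F \<in> antidual"
  by (auto simp: antidual_def)

lemma bound_by_dnorm:
  assumes "F \<in> antidual"
  shows "bound_by F (dnorm F)"
proof -
  have ne: "{K. bound_by F K} \<noteq> {}" using assms by (auto simp: antidual_def)
  have ge: "0 \<le> dnorm F" unfolding dnorm_def using ne by (rule cInf_greatest) (simp add: bound_by_def)
  have "cmod (F x) \<le> dnorm F * nrm x" for x
  proof (cases "x = 0")
    case True then show ?thesis using assms by (simp add: antidual_def antilinear_lemmas)
  next
    case False
    then have n: "nrm x > 0" by (simp add: order_less_le)
    have "cmod (F x) / nrm x \<le> dnorm F" unfolding dnorm_def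
      using ne by (rule cInf_greatest) (use n in \<open>auto simp: bound_by_def field_simps\<close>)
    then show ?thesis using n by (simp add: field_simps)
  qed
  then show ?thesis using ge by (simp add: bound_by_def)
qed

lemma dnorm_ge_0: "F \<in> antidual \<Longrightarrow> 0 \<le> dnorm F"
  using bound_by_dnorm by (simp add: bound_by_def)

lemma dnorm_bound: "F \<in> antidual \<Longrightarrow> cmod (F x) \<le> dnorm F * nrm x"
  using bound_by_dnorm by (simp add: bound_by_def)

lemma dnorm_eq_0: "F \<in> antidual \<Longrightarrow> dnorm F = 0 \<Longrightarrow> F = 0"
  using dnorm_bound[of F] by (auto simp: fun_eq_iff)

lemma bound_by_add: "bound_by F K \<Longrightarrow> bound_by G L \<Longrightarrow> bound_by (F + G) (K + L)"
  unfolding bound_by_def by (auto simp: distrib_right intro!: norm_triangle_le add_mono)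

lemma bound_by_diff: "bound_by F K \<Longrightarrow> bound_by G L \<Longrightarrow> bound_by (F - G) (K + L)"
  unfolding bound_by_def by (auto simp: distrib_right intro!: norm_triangle_le_diff add_mono)

lemma bound_by_scale: "bound_by F K \<Longrightarrow> bound_by (c *\<^sub>C F) (cmod c * K)"
  unfolding bound_by_def scaleC_fun_def scaleC_complex_def
  by (auto simp: norm_mult mult.assoc intro!: mult_left_mono)

lemma antidual_add: "F \<in> antidual \<Longrightarrow> G \<in> antidual \<Longrightarrow> F + G \<in> antidual"
  unfolding antidual_def by (blast intro: bound_by_add antilinear_add_fun)

lemma antidual_diff: "F \<in> antidual \<Longrightarrow> G \<in> antidual \<Longrightarrow> F - G \<in> antidual"
  unfolding antidual_def by (blast intro: bound_by_diff antilinear_diff_fun)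

lemma antidual_scale: "F \<in> antidual \<Longrightarrow> c *\<^sub>C F \<in> antidual"
  unfolding antidual_def by (blast intro: bound_by_scale antilinear_scale_fun)

lemma dnorm_triangle: "F \<in> antidual \<Longrightarrow> G \<in> antidual \<Longrightarrow> dnorm (F + G) \<le> dnorm F + dnorm G"
  by (intro dnorm_le bound_by_add bound_by_dnorm)

lemma dnorm_0 [simp]: "dnorm 0 = 0"
  using dnorm_le[of 0 0] dnorm_ge_0[of 0] antidualI[of 0 0]
  by (simp add: bound_by_def antilinear_def)

lemma dnorm_scale: "F \<in> antidual \<Longrightarrow> dnorm (c *\<^sub>C F) = cmod c * dnorm F"
proof -
  assume F: "F \<in> antidual"
  have le: "dnorm (c *\<^sub>C G) \<le> cmod c * dnorm G" if "G \<in> antidual" for c G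
    using that by (intro dnorm_le bound_by_scale bound_by_dnorm)
  show ?thesis
  proof (cases "c = 0")
    case False
    have "dnorm F = dnorm (inverse c *\<^sub>C c *\<^sub>C F)" using False by (simp add: scaleC_scaleC scaleC_one)
    also have "\<dots> \<le> cmod (inverse c) * dnorm (c *\<^sub>C F)" using F by (intro le antidual_scale)
    finally have "cmod c * dnorm F \<le> dnorm (c *\<^sub>C F)" using False by (simp add: norm_inverse norm_divide field_simps)
    then show ?thesis using le[OF F, of c] by simp
  qed simp
qed

lemma dnorm_minus_commute: "F \<in> antidual \<Longrightarrow> G \<in> antidual \<Longrightarrow> dnorm (F - G) = dnorm (G - F)"
proof -
  have "G - F = (-1) *\<^sub>C (F - G)" by (simp add: scaleC_fun_def scaleC_complex_def fun_eq_iff)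
  then show "F \<in> antidual \<Longrightarrow> G \<in> antidual \<Longrightarrow> dnorm (F - G) = dnorm (G - F)"
    using dnorm_scale[of "F - G" "-1"] by (simp add: antidual_diff)
qed

lemma dnorm_triangle3: "F \<in> antidual \<Longrightarrow> G \<in> antidual \<Longrightarrow> H \<in> antidual \<Longrightarrow> dnorm (F - H) \<le> dnorm (F - G) + dnorm (G - H)"
  using dnorm_triangle[of "F - G" "G - H"] by (simp add: antidual_diff)

lemma bound_by_emb: "bound_by (emb \<phi>) (nrm \<phi>)"
  using Cauchy_Schwarz by (auto simp: bound_by_def emb_def mult.commute)

lemma emb_antidual: "emb \<phi> \<in> antidual"
  using bound_by_emb antilinear_emb by (rule antidualI[rotated])

lemma dnorm_emb: "dnorm (emb \<phi>) = nrm \<phi>"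
proof (rule antisym)
  show "dnorm (emb \<phi>) \<le> nrm \<phi>" by (rule dnorm_le[OF bound_by_emb])
  have "(nrm \<phi>)\<^sup>2 \<le> dnorm (emb \<phi>) * nrm \<phi>"
    using dnorm_bound[OF emb_antidual, of \<phi> \<phi>] by (simp add: emb_def ip_self norm_power)
  then show "nrm \<phi> \<le> dnorm (emb \<phi>)"
    using dnorm_ge_0[OF emb_antidual] nrm_ge_0[of \<phi>]
    by (cases "nrm \<phi> = 0") (auto simp: power2_eq_square simp del: nrm_eq_0_iff)
qed

text \<open>
  If \<open>F\<close> almost attains its norm at a unit vector \<open>\<psi>\<close>, then this near-optimality forces \<open>F\<close> to be small
  on the orthogonal complement of \<open>\<psi>\<close>, so that \<open>F\<close> is close to a multiple of \<open>emb \<psi>\<close>.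
\<close>

lemma emb_dense:
  assumes F: "F \<in> antidual" and \<epsilon>: "\<epsilon> > 0"
  shows "\<exists>\<phi>. dnorm (F - emb \<phi>) < \<epsilon>"
proof (cases "dnorm F = 0")
  case True
  have "F - emb 0 = F" by (simp add: emb_def fun_eq_iff ip_right)
  then show ?thesis using True \<epsilon> by (intro exI[of _ 0]) simp
next
  case False
  define N where "N = dnorm F"
  have N: "N > 0" using False dnorm_ge_0[OF F] by (simp add: N_def)
  note Fl = antilinear_lemmas[OF antidual_antilinear[OF F], unfolded scaleC_complex_def]
  \<comment> \<open>a number below \<open>N\<close> with \<open>N\<^sup>2 - b\<^sup>2 < \<epsilon>\<^sup>2\<close>; as it is below the norm, it is no bound of \<open>F\<close>\<close>
  define b where "b = sqrt (max 0 (N\<^sup>2 - \<epsilon>\<^sup>2 / 2))"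
  have b: "0 \<le> b" "b\<^sup>2 \<ge> N\<^sup>2 - \<epsilon>\<^sup>2 / 2" "b < N"
    using N \<epsilon> by (auto simp: b_def intro!: real_less_lsqrt)
  have "\<not> bound_by F b" using dnorm_le[of F b] b by (auto simp: N_def)
  then obtain x where x: "cmod (F x) > b * nrm x" using b by (auto simp: bound_by_def not_le)
  have nx: "nrm x > 0" using x Fl by (cases "x = 0") (auto simp: order_less_le)
  define \<psi> where "\<psi> = complex_of_real (1 / nrm x) *\<^sub>C x"
  have n\<psi>: "nrm \<psi> = 1" using nx by (auto simp: \<psi>_def nrm_scale norm_divide)
  then have \<psi>\<psi>: "ip \<psi> \<psi> = 1" by (simp add: ip_self)
  have "F \<psi> = F x / nrm x" using nx by (simp add: \<psi>_def Fl)
  then have F\<psi>: "cmod (F \<psi>) > b" using x nx by (simp add: norm_divide field_simps)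
  have F\<psi>N: "cmod (F \<psi>) \<le> N" using dnorm_bound[OF F, of \<psi>] n\<psi> by (simp add: N_def)
  define d where "d = N\<^sup>2 - (cmod (F \<psi>))\<^sup>2"
  have d0: "0 \<le> d" using F\<psi>N by (simp add: d_def power_mono)
  have "b\<^sup>2 \<le> (cmod (F \<psi>))\<^sup>2" using F\<psi> b by (simp add: power_mono)
  then have d1: "d < \<epsilon>\<^sup>2" using b(2) zero_less_power[OF \<epsilon>, of 2] unfolding d_def by linarith
  have perp: "(cmod (F \<eta>))\<^sup>2 \<le> d * (nrm \<eta>)\<^sup>2" if "ip \<psi> \<eta> = 0" for \<eta>
  proof (cases "\<eta> = 0")
    case False
    then have n: "nrm \<eta> > 0" by (simp add: order_less_le)
    define S where "S = (cmod (F \<psi>))\<^sup>2 + (cmod (F \<eta>))\<^sup>2 / (nrm \<eta>)\<^sup>2"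
    define c where "c = F \<eta> / complex_of_real ((nrm \<eta>)\<^sup>2)"
    \<comment> \<open>the vector that represents \<open>F\<close> on the span of \<open>\<psi>\<close> and \<open>\<eta>\<close>\<close>
    define u where "u = F \<psi> *\<^sub>C \<psi> + c *\<^sub>C \<eta>"
    have "F u = F \<psi> * cnj (F \<psi>) + F \<eta> * cnj (F \<eta>) / complex_of_real ((nrm \<eta>)\<^sup>2)"
      by (simp add: u_def c_def Fl mult.commute)
    then have "F u = complex_of_real S"
      unfolding S_def complex_norm_square[symmetric] by simp
    moreover have "0 \<le> S" by (simp add: S_def)
    ultimately have 1: "cmod (F u) = S" by (simp only: norm_of_real abs_of_nonneg)
    have "(nrm u)\<^sup>2 = (nrm (F \<psi> *\<^sub>C \<psi>))\<^sup>2 + (nrm (c *\<^sub>C \<eta>))\<^sup>2"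
      unfolding u_def by (rule nrm_add_sq_orth) (simp add: ip_left ip_right that)
    also have "\<dots> = S" using n n\<psi>
      by (simp add: nrm_scale S_def c_def norm_divide norm_mult power2_eq_square)
    finally have 2: "(nrm u)\<^sup>2 = S" .
    have "S\<^sup>2 \<le> (N * nrm u)\<^sup>2"
      using dnorm_bound[OF F, of u] 1 by (intro power_mono) (auto simp: N_def S_def)
    then have "S * S \<le> N\<^sup>2 * S" unfolding power_mult_distrib 2 by (simp add: power2_eq_square)
    moreover have "0 \<le> S" by (simp add: S_def)
    ultimately have "S \<le> N\<^sup>2" by (cases "S = 0") auto
    then have "(cmod (F \<eta>))\<^sup>2 / (nrm \<eta>)\<^sup>2 \<le> d" by (simp add: S_def d_def)
    then show ?thesis using False by (simp add: field_simps)
  qed (simp add: Fl)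
  have "bound_by (F - emb (F \<psi> *\<^sub>C \<psi>)) (sqrt d)"
    unfolding bound_by_def
  proof (intro conjI allI)
    fix w
    define \<eta> where "\<eta> = w - ip \<psi> w *\<^sub>C \<psi>"
    have o: "ip \<psi> \<eta> = 0" by (simp add: \<eta>_def ip_right \<psi>\<psi>)
    have "(F - emb (F \<psi> *\<^sub>C \<psi>)) w = F \<eta>"
      using ip_commute[of w \<psi>] by (simp add: emb_def \<eta>_def Fl ip_right mult.commute)
    then have 1: "(cmod ((F - emb (F \<psi> *\<^sub>C \<psi>)) w))\<^sup>2 \<le> d * (nrm \<eta>)\<^sup>2" using perp[OF o] by simp
    have "ip (ip \<psi> w *\<^sub>C \<psi>) \<eta> = 0" by (simp add: ip_left o)
    from nrm_add_sq_orth[OF this] have "(nrm \<eta>)\<^sup>2 \<le> (nrm w)\<^sup>2" by (simp add: \<eta>_def)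
    then have "(cmod ((F - emb (F \<psi> *\<^sub>C \<psi>)) w))\<^sup>2 \<le> d * (nrm w)\<^sup>2"
      using 1 d0 by (meson mult_left_mono order_trans)
    then have "(cmod ((F - emb (F \<psi> *\<^sub>C \<psi>)) w))\<^sup>2 \<le> (sqrt d * nrm w)\<^sup>2"
      using d0 by (simp add: power_mult_distrib)
    then show "cmod ((F - emb (F \<psi> *\<^sub>C \<psi>)) w) \<le> sqrt d * nrm w"
      by (rule power2_le_imp_le) (simp add: d0)
  qed (simp add: d0)
  from dnorm_le[OF this] have "dnorm (F - emb (F \<psi> *\<^sub>C \<psi>)) \<le> sqrt d" .
  also have "sqrt d < \<epsilon>" using d1 \<epsilon> d0 by (intro real_less_lsqrt) auto
  finally show ?thesis by blast
qed

definition tends :: "(nat \<Rightarrow> 'a \<Rightarrow> complex) \<Rightarrow> ('a \<Rightarrow> complex) \<Rightarrow> bool"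
  where "tends f F \<longleftrightarrow> (\<lambda>n. dnorm (f n - F)) \<longlonglongrightarrow> 0"

definition approx :: "('a \<Rightarrow> complex) \<Rightarrow> nat \<Rightarrow> 'a"
  where "approx F n = (SOME \<phi>. dnorm (emb \<phi> - F) < inverse (real (Suc n)))"

lemma tends_approx:
  assumes "F \<in> antidual"
  shows "tends (\<lambda>n. emb (approx F n)) F"
proof -
  have "dnorm (emb (approx F n) - F) < inverse (real (Suc n))" for n
    unfolding approx_def using emb_dense[OF assms, of "inverse (real (Suc n))"]
    by (intro someI_ex[where P = "\<lambda>\<phi>. dnorm (emb \<phi> - F) < inverse (real (Suc n))"])
      (auto simp: dnorm_minus_commute assms emb_antidual)
  then show ?thesis unfolding tends_def
    by (intro tendsto_sandwich[OF _ _ tendsto_const LIMSEQ_inverse_real_of_nat])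
      (auto intro!: always_eventually less_imp_le[of "dnorm _"] dnorm_ge_0[OF antidual_diff[OF emb_antidual assms]] simp del: of_nat_Suc)
qed

lemma tends_pointwise:
  assumes "\<And>n. f n \<in> antidual" "F \<in> antidual" "tends f F"
  shows "(\<lambda>n. f n x) \<longlonglongrightarrow> F x"
proof -
  have "(\<lambda>n. dnorm (f n - F) * nrm x) \<longlonglongrightarrow> 0 * nrm x"
    using assms(3) unfolding tends_def by (intro tendsto_intros)
  then have "(\<lambda>n. dnorm (f n - F) * nrm x) \<longlonglongrightarrow> 0" by simp
  moreover have "norm (f n x - F x) \<le> dnorm (f n - F) * nrm x" for n
    using dnorm_bound[OF antidual_diff[OF assms(1,2)], of n x] by simp
  ultimately have "(\<lambda>n. f n x - F x) \<longlonglongrightarrow> 0"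
    by (rule tendsto_0_bound)
  then show ?thesis by (simp add: LIM_zero_iff)
qed

lemma tends_dnorm:
  assumes "\<And>n. f n \<in> antidual" "F \<in> antidual" "tends f F"
  shows "(\<lambda>n. dnorm (f n)) \<longlonglongrightarrow> dnorm F"
proof -
  have "\<bar>dnorm (f n) - dnorm F\<bar> \<le> dnorm (f n - F)" for n
    using dnorm_triangle[of "f n - F" F] dnorm_triangle[of "F - f n" "f n"] assms(1,2)
    by (auto simp: abs_le_iff antidual_diff dnorm_minus_commute[of F "f n"])
  then have "(\<lambda>n. dnorm (f n) - dnorm F) \<longlonglongrightarrow> 0"
    using tendsto_0_bound[OF assms(3)[unfolded tends_def], of "\<lambda>n. dnorm (f n) - dnorm F"] by simp
  then show ?thesis by (simp add: LIM_zero_iff)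
qed

lemma tends_unique:
  assumes "\<And>n. f n \<in> antidual" "F \<in> antidual" "G \<in> antidual" "tends f F" "tends f G"
  shows "F = G"
proof
  fix x
  show "F x = G x"
    using tends_pointwise[OF assms(1,2,4)] tends_pointwise[OF assms(1,3,5)] by (rule LIMSEQ_unique)
qed

text \<open>
  The pointwise limit inherits the norm bounds, since each of them is a closed condition at every
  single argument.
\<close>

lemma antidual_complete:
  assumes f: "\<And>n. f n \<in> antidual"
    and cauchy: "\<And>\<epsilon>. \<epsilon> > 0 \<Longrightarrow> \<exists>N. \<forall>m\<ge>N. \<forall>n\<ge>N. dnorm (f m - f n) < \<epsilon>"
  obtains F where "F \<in> antidual" "tends f F"
proof -
  have "Cauchy (\<lambda>n. f n x)" for x
  proof (rule CauchyI)
    fix e :: real assume e: "e > 0"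
    then have "0 < e / (nrm x + 1)" by (intro divide_pos_pos add_nonneg_pos) auto
    from cauchy[OF this] obtain N where N: "\<forall>m\<ge>N. \<forall>n\<ge>N. dnorm (f m - f n) < e / (nrm x + 1)" ..
    have "cmod (f m x - f n x) < e" if "m \<ge> N" "n \<ge> N" for m n
    proof -
      have "cmod (f m x - f n x) \<le> dnorm (f m - f n) * nrm x"
        using dnorm_bound[OF antidual_diff[OF f f], of m n x] by simp
      also have "\<dots> \<le> e / (nrm x + 1) * nrm x"
        using N that by (intro mult_right_mono) (auto intro: less_imp_le)
      also have "\<dots> < e" using e by (simp add: pos_divide_less_eq add_nonneg_pos distrib_left)
      finally show ?thesis .
    qed
    then show "\<exists>M. \<forall>m\<ge>M. \<forall>n\<ge>M. cmod (f m x - f n x) < e" by blast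
  qed
  define F where "F x = lim (\<lambda>n. f n x)" for x
  have F: "(\<lambda>n. f n x) \<longlonglongrightarrow> F x" for x
    unfolding F_def using \<open>Cauchy (\<lambda>n. f n x)\<close> by (simp add: Cauchy_convergent_iff convergent_LIMSEQ_iff)
  have lin: "antilinear F"
    unfolding antilinear_def
  proof (intro conjI allI)
    fix x y c
    note fl = antilinear_lemmas[OF antidual_antilinear[OF f]]
    show "F (x + y) = F x + F y"
      using LIMSEQ_unique[OF F[of "x + y"]] tendsto_add[OF F F] by (simp add: fl)
    show "F (c *\<^sub>C x) = cnj c *\<^sub>C F x"
      using LIMSEQ_unique[OF F[of "c *\<^sub>C x"]] tendsto_mult_left[OF F] by (simp add: fl scaleC_complex_def)
  qed
  have *: "bound_by (f n - F) \<epsilon>" if "\<epsilon> > 0" "\<forall>m\<ge>N. \<forall>n\<ge>N. dnorm (f m - f n) < \<epsilon>" "n \<ge> N" for \<epsilon> N n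
    unfolding bound_by_def
  proof (intro conjI allI)
    fix x
    have "cmod ((f n - f m) x) \<le> \<epsilon> * nrm x" if "m \<ge> N" for m
    proof -
      have "cmod ((f n - f m) x) \<le> dnorm (f n - f m) * nrm x"
        by (rule dnorm_bound[OF antidual_diff[OF f f]])
      also have "\<dots> \<le> \<epsilon> * nrm x"
        using \<open>\<forall>m\<ge>N. \<forall>n\<ge>N. dnorm (f m - f n) < \<epsilon>\<close> that \<open>n \<ge> N\<close>
        by (intro mult_right_mono) (auto intro: less_imp_le)
      finally show ?thesis .
    qed
    then have ev: "\<exists>M. \<forall>m\<ge>M. cmod ((f n - f m) x) \<le> \<epsilon> * nrm x" by blast
    have "(\<lambda>m. cmod ((f n - f m) x)) \<longlonglongrightarrow> cmod (f n x - F x)"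
      unfolding fun_diff_def by (intro tendsto_intros F)
    from LIMSEQ_le_const2[OF this ev] show "cmod ((f n - F) x) \<le> \<epsilon> * nrm x" by simp
  qed (use that in simp)
  obtain N where "\<forall>m\<ge>N. \<forall>n\<ge>N. dnorm (f m - f n) < 1" using cauchy[of 1] by auto
  then have "bound_by (f N - F) 1" using *[of 1 N N] by simp
  then have "f N - F \<in> antidual" using antidual_antilinear[OF f] lin by (intro antidualI antilinear_diff_fun)
  then have "f N - (f N - F) \<in> antidual" by (rule antidual_diff[OF f])
  then have Fd: "F \<in> antidual" by simp
  moreover have "tends f F"
    unfolding tends_def
  proof (rule LIMSEQ_I)
    fix r :: real assume r: "r > 0"
    then obtain N where N: "\<forall>m\<ge>N. \<forall>n\<ge>N. dnorm (f m - f n) < r / 2" using cauchy[of "r/2"] by auto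
    have "dnorm (f n - F) < r" if "n \<ge> N" for n
      using dnorm_le[OF *[OF _ N that]] r by simp
    then show "\<exists>no. \<forall>n\<ge>no. norm (dnorm (f n - F) - 0) < r"
      using dnorm_ge_0[OF antidual_diff[OF f Fd]] by auto
  qed
  ultimately show ?thesis using that by blast
qed

lemma tends_Cauchy:
  assumes f: "\<And>n. f n \<in> antidual" "F \<in> antidual" "tends f F" and \<epsilon>: "\<epsilon> > 0"
  shows "\<exists>N. \<forall>m\<ge>N. \<forall>n\<ge>N. dnorm (f m - f n) < \<epsilon>"
proof -
  obtain N where N: "\<forall>n\<ge>N. norm (dnorm (f n - F) - 0) < \<epsilon> / 2"
    using LIMSEQ_D[OF f(3)[unfolded tends_def], of "\<epsilon> / 2"] \<epsilon> by auto
  have "dnorm (f m - f n) < \<epsilon>" if "m \<ge> N" "n \<ge> N" for m n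
  proof -
    have "dnorm (f m - f n) \<le> dnorm (f m - F) + dnorm (F - f n)"
      by (rule dnorm_triangle3) (use f in auto)
    moreover have "dnorm (F - f n) = dnorm (f n - F)" by (rule dnorm_minus_commute) (use f in auto)
    moreover have "dnorm (f m - F) < \<epsilon> / 2" "dnorm (f n - F) < \<epsilon> / 2" using N that by auto
    ultimately show ?thesis by linarith
  qed
  then show ?thesis by blast
qed

lemma tends_add:
  assumes "\<And>n. f n \<in> antidual" "F \<in> antidual" "tends f F" "\<And>n. g n \<in> antidual" "G \<in> antidual" "tends g G"
  shows "tends (\<lambda>n. f n + g n) (F + G)"
  unfolding tends_def
proof (rule tendsto_0_bound)
  show "(\<lambda>n. dnorm (f n - F) + dnorm (g n - G)) \<longlonglongrightarrow> 0"
    using tendsto_add[OF assms(3,6)[unfolded tends_def]] by simp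
  fix n
  have "(f n + g n) - (F + G) = (f n - F) + (g n - G)" by (simp add: algebra_simps)
  then have "dnorm ((f n + g n) - (F + G)) \<le> dnorm (f n - F) + dnorm (g n - G)"
    using dnorm_triangle[OF antidual_diff[OF assms(1,2)] antidual_diff[OF assms(4,5)], of n n] by metis
  moreover have "0 \<le> dnorm ((f n + g n) - (F + G))"
    by (intro dnorm_ge_0 antidual_diff antidual_add assms)
  ultimately show "norm (dnorm ((f n + g n) - (F + G))) \<le> dnorm (f n - F) + dnorm (g n - G)" by simp
qed

lemma tends_scale:
  assumes "\<And>n. f n \<in> antidual" "F \<in> antidual" "tends f F"
  shows "tends (\<lambda>n. c *\<^sub>C f n) (c *\<^sub>C F)"
proof -
  have "dnorm (c *\<^sub>C f n - c *\<^sub>C F) = cmod c * dnorm (f n - F)" for n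
    using dnorm_scale[OF antidual_diff[OF assms(1,2)], of c n]
    by (simp only: complex_vector.scale_right_diff_distrib)
  then show ?thesis using tendsto_mult_left[OF assms(3)[unfolded tends_def], of "cmod c"]
    unfolding tends_def by simp
qed

text \<open>
  An isometry maps Cauchy sequences of the dense subspace to Cauchy sequences.
\<close>

lemma isometric_extension:
  assumes L: "\<And>\<phi>. L \<phi> \<in> antidual" and Ldiff: "\<And>x y. L (x - y) = L x - L y"
    and Lnorm: "\<And>\<phi>. dnorm (L \<phi>) = nrm \<phi>"
  obtains T where "\<And>F. F \<in> antidual \<Longrightarrow> T F \<in> antidual"
    "\<And>F \<phi>. F \<in> antidual \<Longrightarrow> tends (\<lambda>n. emb (\<phi> n)) F \<Longrightarrow> tends (\<lambda>n. L (\<phi> n)) (T F)"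
proof -
  have dL: "dnorm (L x - L y) = dnorm (emb x - emb y)" for x y
    by (simp add: Lnorm dnorm_emb flip: Ldiff emb_diff)
  have ex: "\<exists>G. G \<in> antidual \<and> tends (\<lambda>n. L (approx F n)) G" if F: "F \<in> antidual" for F
  proof -
    have cauchy: "\<exists>N. \<forall>m\<ge>N. \<forall>n\<ge>N. dnorm (L (approx F m) - L (approx F n)) < \<epsilon>" if "\<epsilon> > 0" for \<epsilon>
      unfolding dL by (rule tends_Cauchy[OF emb_antidual F tends_approx[OF F] that])
    obtain G where "G \<in> antidual" "tends (\<lambda>n. L (approx F n)) G"
      by (rule antidual_complete[of "\<lambda>n. L (approx F n)", OF L cauchy])
    then show ?thesis by (intro exI[of _ G] conjI)
  qed
  define T where "T F = (SOME G. G \<in> antidual \<and> tends (\<lambda>n. L (approx F n)) G)" for F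
  have T: "T F \<in> antidual" "tends (\<lambda>n. L (approx F n)) (T F)" if "F \<in> antidual" for F
    using someI_ex[OF ex[OF that]] unfolding T_def by auto
  show thesis
  proof (rule that)
    fix F and \<phi> :: "nat \<Rightarrow> 'a" assume F: "F \<in> antidual" and t: "tends (\<lambda>n. emb (\<phi> n)) F"
    show "tends (\<lambda>n. L (\<phi> n)) (T F)"
      unfolding tends_def
    proof (rule tendsto_0_bound)
      show "(\<lambda>n. dnorm (emb (\<phi> n) - F) + dnorm (emb (approx F n) - F) + dnorm (L (approx F n) - T F)) \<longlonglongrightarrow> 0"
        using tendsto_add[OF tendsto_add[OF t[unfolded tends_def] tends_approx[OF F, unfolded tends_def]]
          T(2)[OF F, unfolded tends_def]] by simp
      fix n
      have "dnorm (L (\<phi> n) - T F) \<le> dnorm (L (\<phi> n) - L (approx F n)) + dnorm (L (approx F n) - T F)"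
        by (rule dnorm_triangle3) (use L T(1)[OF F] in auto)
      moreover have "dnorm (emb (\<phi> n) - emb (approx F n)) \<le> dnorm (emb (\<phi> n) - F) + dnorm (F - emb (approx F n))"
        by (rule dnorm_triangle3) (use F emb_antidual in auto)
      moreover have "dnorm (F - emb (approx F n)) = dnorm (emb (approx F n) - F)"
        by (rule dnorm_minus_commute[OF F emb_antidual])
      moreover have "0 \<le> dnorm (L (\<phi> n) - T F)" by (intro dnorm_ge_0 antidual_diff L T(1) F)
      ultimately show "norm (dnorm (L (\<phi> n) - T F)) \<le>
          dnorm (emb (\<phi> n) - F) + dnorm (emb (approx F n) - F) + dnorm (L (approx F n) - T F)"
        unfolding dL by simp
    qed
  qed (rule T(1))
qed

lemma tends_const: "tends (\<lambda>n. F) F"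
  by (simp add: tends_def)

subsection \<open>The inner product of the antidual\<close>

text \<open>
  For \<open>F = emb \<phi>\<close> the inner product with \<open>G\<close> is \<open>G \<phi>\<close>; the general value is the limit of these.
\<close>

definition dip :: "('a \<Rightarrow> complex) \<Rightarrow> ('a \<Rightarrow> complex) \<Rightarrow> complex"
  where "dip F G = lim (\<lambda>n. G (approx F n))"

text \<open>
  As \<open>G\<close> is bounded, any other sequence that converges to \<open>F\<close> gives the same limit.
\<close>

lemma dip_limit:
  assumes F: "F \<in> antidual" and G: "G \<in> antidual" and t: "tends (\<lambda>n. emb (\<phi> n)) F"
  shows "(\<lambda>n. G (\<phi> n)) \<longlonglongrightarrow> dip F G"
proof -
  note Gl = antilinear_lemmas[OF antidual_antilinear[OF G]]
  have "Cauchy (\<lambda>n. G (approx F n))"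
  proof (rule CauchyI)
    fix e :: real assume e: "e > 0"
    have pos: "0 < e / (dnorm G + 1)" using e dnorm_ge_0[OF G] by simp
    obtain N where N: "\<forall>m\<ge>N. \<forall>n\<ge>N. dnorm (emb (approx F m) - emb (approx F n)) < e / (dnorm G + 1)"
      using tends_Cauchy[OF emb_antidual F tends_approx[OF F] pos] by auto
    have "cmod (G (approx F m) - G (approx F n)) < e" if "m \<ge> N" "n \<ge> N" for m n
    proof -
      have "nrm (approx F m - approx F n) < e / (dnorm G + 1)"
        using N that by (simp flip: emb_diff add: dnorm_emb)
      then have "dnorm G * nrm (approx F m - approx F n) \<le> dnorm G * (e / (dnorm G + 1))"
        using dnorm_ge_0[OF G] by (intro mult_left_mono) auto
      also have "\<dots> < e" using e dnorm_ge_0[OF G] by (simp add: divide_simps add_pos_nonneg)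
      finally show ?thesis using dnorm_bound[OF G, of "approx F m - approx F n"] by (simp add: Gl)
    qed
    then show "\<exists>M. \<forall>m\<ge>M. \<forall>n\<ge>M. cmod (G (approx F m) - G (approx F n)) < e" by blast
  qed
  then have lim: "(\<lambda>n. G (approx F n)) \<longlonglongrightarrow> dip F G"
    unfolding dip_def by (simp add: Cauchy_convergent_iff convergent_LIMSEQ_iff)
  have "(\<lambda>n. dnorm G * (dnorm (emb (\<phi> n) - F) + dnorm (emb (approx F n) - F))) \<longlonglongrightarrow> dnorm G * (0 + 0)"
    using t tends_approx[OF F] unfolding tends_def by (intro tendsto_intros)
  then have "(\<lambda>n. dnorm G * (dnorm (emb (\<phi> n) - F) + dnorm (emb (approx F n) - F))) \<longlonglongrightarrow> 0" by simp
  moreover have "cmod (G (\<phi> n) - G (approx F n)) \<le> dnorm G * (dnorm (emb (\<phi> n) - F) + dnorm (emb (approx F n) - F))" for n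
  proof -
    have "nrm (\<phi> n - approx F n) \<le> dnorm (emb (\<phi> n) - F) + dnorm (F - emb (approx F n))"
      using dnorm_triangle3[OF emb_antidual F emb_antidual] by (simp flip: dnorm_emb add: emb_diff)
    then have "nrm (\<phi> n - approx F n) \<le> dnorm (emb (\<phi> n) - F) + dnorm (emb (approx F n) - F)"
      using dnorm_minus_commute[OF F emb_antidual] by simp
    then have "dnorm G * nrm (\<phi> n - approx F n) \<le> dnorm G * (dnorm (emb (\<phi> n) - F) + dnorm (emb (approx F n) - F))"
      using dnorm_ge_0[OF G] by (intro mult_left_mono)
    then show ?thesis
      using dnorm_bound[OF G, of "\<phi> n - approx F n"] by (simp add: Gl)
  qed
  ultimately have "(\<lambda>n. G (\<phi> n) - G (approx F n)) \<longlonglongrightarrow> 0" by (rule tendsto_0_bound)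
  then show ?thesis using lim tendsto_add by fastforce
qed

lemma dip_add_right:
  assumes "F \<in> antidual" "G \<in> antidual" "H \<in> antidual"
  shows "dip F (G + H) = dip F G + dip F H"
proof (rule LIMSEQ_unique)
  note t = tends_approx[OF assms(1)]
  show "(\<lambda>n. (G + H) (approx F n)) \<longlonglongrightarrow> dip F (G + H)"
    using assms by (intro dip_limit antidual_add t)
  show "(\<lambda>n. (G + H) (approx F n)) \<longlonglongrightarrow> dip F G + dip F H"
    unfolding plus_fun_def using assms by (intro tendsto_add dip_limit t)
qed

lemma dip_scale_right:
  assumes "F \<in> antidual" "G \<in> antidual"
  shows "dip F (c *\<^sub>C G) = c * dip F G"
proof (rule LIMSEQ_unique)
  note t = tends_approx[OF assms(1)]
  show "(\<lambda>n. (c *\<^sub>C G) (approx F n)) \<longlonglongrightarrow> dip F (c *\<^sub>C G)"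
    using assms by (intro dip_limit antidual_scale t)
  show "(\<lambda>n. (c *\<^sub>C G) (approx F n)) \<longlonglongrightarrow> c * dip F G"
    unfolding scaleC_fun_def scaleC_complex_def using assms by (intro tendsto_mult_left dip_limit t)
qed

lemma dip_commute:
  assumes F: "F \<in> antidual" and G: "G \<in> antidual"
  shows "dip F G = cnj (dip G F)"
proof -
  let ?f = "approx F" and ?g = "approx G"
  have *: "(\<lambda>n. ip (approx F n) (approx G n)) \<longlonglongrightarrow> dip F G" if "F \<in> antidual" "G \<in> antidual" for F G
  proof -
    have "(\<lambda>n. dnorm (emb (approx G n) - G) * dnorm (emb (approx F n))) \<longlonglongrightarrow> 0 * dnorm F"
      using tends_approx[OF that(2)] tends_dnorm[OF emb_antidual that(1) tends_approx[OF that(1)]]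
      unfolding tends_def by (intro tendsto_intros)
    then have "(\<lambda>n. dnorm (emb (approx G n) - G) * dnorm (emb (approx F n))) \<longlonglongrightarrow> 0" by simp
    moreover have "cmod (ip (approx F n) (approx G n) - G (approx F n)) \<le> dnorm (emb (approx G n) - G) * dnorm (emb (approx F n))" for n
      using dnorm_bound[OF antidual_diff[OF emb_antidual that(2)], of "approx G n" "approx F n"]
      by (simp add: dnorm_emb emb_apply)
    ultimately have "(\<lambda>n. ip (approx F n) (approx G n) - G (approx F n)) \<longlonglongrightarrow> 0"
      by (rule tendsto_0_bound)
    from tendsto_add[OF this dip_limit[OF that tends_approx[OF that(1)]]] show ?thesis by simp
  qed
  have "(\<lambda>n. cnj (ip (approx G n) (approx F n))) \<longlonglongrightarrow> cnj (dip G F)"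
    using *[OF G F] by (rule tendsto_cnj)
  then have "(\<lambda>n. ip (approx F n) (approx G n)) \<longlonglongrightarrow> cnj (dip G F)" by (simp flip: ip_commute)
  with *[OF F G] show ?thesis by (rule LIMSEQ_unique)
qed

lemma dip_self:
  assumes F: "F \<in> antidual"
  shows "dip F F = complex_of_real ((dnorm F)\<^sup>2)"
proof -
  let ?f = "approx F"
  have "(\<lambda>n. dnorm (emb (?f n) - F) * dnorm (emb (?f n))) \<longlonglongrightarrow> 0 * dnorm F"
    using tends_approx[OF F] tends_dnorm[OF emb_antidual F tends_approx[OF F]]
    unfolding tends_def by (intro tendsto_intros)
  then have "(\<lambda>n. dnorm (emb (?f n) - F) * dnorm (emb (?f n))) \<longlonglongrightarrow> 0" by simp
  moreover have "cmod (complex_of_real ((nrm (?f n))\<^sup>2) - F (?f n)) \<le> dnorm (emb (?f n) - F) * dnorm (emb (?f n))" for n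
    using dnorm_bound[OF antidual_diff[OF emb_antidual F], of "?f n" "?f n"]
    by (simp add: dnorm_emb emb_apply ip_self)
  ultimately have "(\<lambda>n. complex_of_real ((nrm (?f n))\<^sup>2) - F (?f n)) \<longlonglongrightarrow> 0"
    by (rule tendsto_0_bound)
  from tendsto_add[OF this dip_limit[OF F F tends_approx[OF F]]]
  have "(\<lambda>n. complex_of_real ((nrm (?f n))\<^sup>2)) \<longlonglongrightarrow> dip F F" by simp
  moreover have "(\<lambda>n. complex_of_real ((nrm (?f n))\<^sup>2)) \<longlonglongrightarrow> complex_of_real ((dnorm F)\<^sup>2)"
    using tends_dnorm[OF emb_antidual F tends_approx[OF F]] by (intro tendsto_intros) (simp add: dnorm_emb)
  ultimately show ?thesis using LIMSEQ_unique by blast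
qed

end

section \<open>The inner product of the symmetric algebra\<close>

lemma sym_prod_Nil [simp]: "sym_prod [] = 1"
  by (simp add: sym_prod_def)

lemma sym_prod_Cons [simp]: "sym_prod (v # vs) = sym_incl v * sym_prod vs"
  by (simp add: sym_prod_def)

lemma sym_prod_mset: "sym_prod vs = prod_mset (image_mset sym_incl (mset vs))"
  by (metis mset_map prod_mset_prod_list sym_prod_def)

lemma annihilator_spec:
  "clinear (annihilator v) \<and>
   (\<forall>\<phi> \<psi>. annihilator v (\<phi> * \<psi>) = annihilator v \<phi> * \<psi> + \<phi> * annihilator v \<psi>) \<and>
   annihilator v 1 = 0 \<and> (\<forall>w. annihilator v (sym_incl w) = cinner v w *\<^sub>C 1)"
  unfolding annihilator_def by (rule theI'[OF annihilator_ex1])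

lemma clinear_annihilator: "clinear (annihilator v)"
  using annihilator_spec by blast

lemmas annihilator_linear = clinear_lemmas[OF clinear_annihilator]

lemma annihilator_one [simp]: "annihilator v 1 = 0"
  using annihilator_spec by blast

lemma annihilator_incl_mult:
  "annihilator v (sym_incl w * \<psi>) = cinner v w *\<^sub>C \<psi> + sym_incl w * annihilator v \<psi>"
  using annihilator_spec[of v] by (simp add: scaleC_mult_left)

lemma annihilator_add_vec: "annihilator (v + w) \<psi> = annihilator v \<psi> + annihilator w \<psi>"
proof (induction \<psi> rule: symalg_induct)
  case (prod vs)
  show ?case
    by (induction vs)
      (simp_all add: annihilator_incl_mult cinner_add_left scaleC_add_left distrib_left)
qed (simp_all add: annihilator_linear scaleC_add_right)

lemma annihilator_scale_vec: "annihilator (c *\<^sub>C v) \<psi> = cnj c *\<^sub>C annihilator v \<psi>"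
proof (induction \<psi> rule: symalg_induct)
  case (prod vs)
  show ?case
    by (induction vs)
      (simp_all add: annihilator_incl_mult cinner_scaleC_left scaleC_add_right scaleC_mult_right)
qed (simp_all add: annihilator_linear scaleC_add_right mult.commute)

lemma annihilator_0_vec [simp]: "annihilator 0 \<psi> = 0"
  using annihilator_scale_vec[of 0 0] by simp

lemma annihilator_sum_vec: "annihilator (\<Sum>i\<in>I. f i) \<psi> = (\<Sum>i\<in>I. annihilator (f i) \<psi>)"
  by (induction I rule: infinite_finite_induct) (simp_all add: annihilator_add_vec)

lemma annihilator_monomial:
  "annihilator v (prod_mset (image_mset sym_incl M)) =
    (\<Sum>x\<in>#M. cinner v x *\<^sub>C prod_mset (image_mset sym_incl (M - {#x#})))"
proof (induction M)
  case (add x M)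
  have "(\<Sum>y\<in>#M. cinner v y *\<^sub>C prod_mset (image_mset sym_incl (add_mset x M - {#y#}))) =
      (\<Sum>y\<in>#M. sym_incl x * (cinner v y *\<^sub>C prod_mset (image_mset sym_incl (M - {#y#}))))"
  proof (rule arg_cong[of _ _ sum_mset], rule image_mset_cong)
    fix y assume "y \<in># M"
    then have "add_mset x M - {#y#} = add_mset x (M - {#y#})"
      by (metis add_mset_remove_trivial insert_DiffM add_mset_commute)
    then show "cinner v y *\<^sub>C prod_mset (image_mset sym_incl (add_mset x M - {#y#})) =
        sym_incl x * (cinner v y *\<^sub>C prod_mset (image_mset sym_incl (M - {#y#})))"
      by (simp add: scaleC_mult_right)
  qed
  moreover have "(\<Sum>y\<in>#N. sym_incl x * f y) = sym_incl x * (\<Sum>y\<in>#N. f y)" for f :: "_ \<Rightarrow> 'a symalg" and N :: "'a multiset"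
    by (induction N) (auto simp: distrib_left)
  ultimately show ?case using add by (simp add: annihilator_incl_mult)
qed simp

lemma annihilator_sym_prod:
  assumes "\<And>b. b < length ys \<Longrightarrow> add_mset (ys ! b) (mset (zs b)) = mset ys"
  shows "annihilator v (sym_prod ys) = (\<Sum>b<length ys. cinner v (ys ! b) *\<^sub>C sym_prod (zs b))"
proof -
  let ?f = "\<lambda>x. cinner v x *\<^sub>C prod_mset (image_mset sym_incl (mset ys - {#x#}))"
  have "annihilator v (sym_prod ys) = sum_list (map ?f ys)"
    unfolding sym_prod_mset[of ys] annihilator_monomial by (simp flip: sum_mset_sum_list)
  also have "\<dots> = (\<Sum>b<length ys. ?f (ys ! b))"
    by (simp add: sum_list_sum_nth atLeast0LessThan)
  also have "\<dots> = (\<Sum>b<length ys. cinner v (ys ! b) *\<^sub>C sym_prod (zs b))"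
  proof (rule sum.cong)
    fix b assume "b \<in> {..<length ys}"
    then have "mset ys - {#ys ! b#} = mset (zs b)" using assms[of b] by (metis add_mset_remove_trivial lessThan_iff)
    then show "?f (ys ! b) = cinner v (ys ! b) *\<^sub>C sym_prod (zs b)" by (simp add: sym_prod_mset)
  qed simp
  finally show ?thesis .
qed

text \<open>
  The list without entry number \<open>b\<close>, whose place is taken by the last entry. In this form the entry
  disappears when a permutation of \<open>n + 1\<close> points is written as a transposition after a permutation
  of \<open>n\<close> points.
\<close>

definition swap_out :: "'a list \<Rightarrow> nat \<Rightarrow> 'a list"
  where "swap_out ys b = map (\<lambda>j. ys ! Transposition.transpose (length ys - 1) b j) [0..<length ys - 1]"

lemma mset_swap_out:
  assumes "b < length ys"
  shows "add_mset (ys ! b) (mset (swap_out ys b)) = mset ys"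
proof -
  obtain n where n: "length ys = Suc n" using assms by (cases "length ys") auto
  have p: "Transposition.transpose n b permutes {..<length ys}" using assms n by (intro permutes_swap_id) auto
  have "permute_list (Transposition.transpose n b) ys = swap_out ys b @ [ys ! b]"
    by (simp add: permute_list_def swap_out_def n)
  then show ?thesis using mset_permute_list[OF p] by simp
qed

text \<open>
  Laplace expansion. The vector \<open>v\<close> is moved to the last row, because the permutations of \<open>{..<n + 1}\<close>
  are enumerated by the image of the last point.
\<close>

lemma permanent_expand:
  "permanent (v # xs) ys = (\<Sum>b<length ys. cinner v (ys ! b) * permanent xs (swap_out ys b))"
proof (cases "Suc (length xs) = length ys")
  case True
  let ?n = "length xs"
  have zs: "length (swap_out ys b) = ?n" for b using True by (simp add: swap_out_def)
  let ?f = "\<lambda>\<pi>. \<Prod>k<Suc ?n. cinner ((xs @ [v]) ! k) (ys ! \<pi> k)"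
  have "permanent (v # xs) ys = permanent (xs @ [v]) ys"
    by (rule permanent_mset_left) simp
  also have "\<dots> = (\<Sum>\<pi> | \<pi> permutes (insert ?n {..<?n}). ?f \<pi>)"
    using True[symmetric] by (simp add: permanent_def lessThan_Suc del: prod.lessThan_Suc)
  also have "\<dots> = (\<Sum>b\<in>insert ?n {..<?n}. \<Sum>q | q permutes {..<?n}. ?f (Transposition.transpose ?n b \<circ> q))"
    by (rule sum_over_permutations_insert) auto
  also have "\<dots> = (\<Sum>b<length ys. cinner v (ys ! b) * permanent xs (swap_out ys b))"
  proof (rule sum.cong)
    fix b assume "b \<in> {..<length ys}"
    have "?f (Transposition.transpose ?n b \<circ> q) = cinner v (ys ! b) * (\<Prod>k<?n. cinner (xs ! k) (swap_out ys b ! q k))"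
      if q: "q permutes {..<?n}" for q
    proof -
      have "q ?n = ?n" using q by (simp add: permutes_not_in)
      moreover have "(\<Prod>k<?n. cinner ((xs @ [v]) ! k) (ys ! (Transposition.transpose ?n b \<circ> q) k)) =
          (\<Prod>k<?n. cinner (xs ! k) (swap_out ys b ! q k))"
      proof (rule prod.cong)
        fix k assume "k \<in> {..<?n}"
        moreover from this have "q k < ?n" using permutes_in_image[OF q, of k] by simp
        ultimately show "cinner ((xs @ [v]) ! k) (ys ! (Transposition.transpose ?n b \<circ> q) k) = cinner (xs ! k) (swap_out ys b ! q k)"
          using True[symmetric] by (simp add: nth_append swap_out_def)
      qed simp
      ultimately show ?thesis by (simp add: mult.commute)
    qed
    then show "(\<Sum>q | q permutes {..<?n}. ?f (Transposition.transpose ?n b \<circ> q)) = cinner v (ys ! b) * permanent xs (swap_out ys b)"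
      by (simp add: permanent_def zs sum_distrib_left del: prod.lessThan_Suc)
  qed (use True in auto)
  finally show ?thesis .
next
  case False
  then have "permanent xs (swap_out ys b) = 0" if "b < length ys" for b
    using that by (auto simp: permanent_def swap_out_def)
  then show ?thesis using False by (simp add: permanent_def)
qed

lemma sym_inner_spec:
  "(\<forall>\<psi>::'v::complex_hilbert symalg. clinear (sym_inner \<psi>)) \<and>
    (\<forall>\<phi>::'v symalg. antilinear (\<lambda>\<psi>. sym_inner \<psi> \<phi>)) \<and>
    (\<forall>(xs::'v list) ys. length xs \<noteq> length ys \<longrightarrow> sym_inner (sym_prod xs) (sym_prod ys) = 0) \<and>
    (\<forall>(xs::'v list) ys. length xs = length ys \<longrightarrow> sym_inner (sym_prod xs) (sym_prod ys) =
      (\<Sum>\<pi> | \<pi> permutes {..<length xs}. \<Prod>k<length xs. cinner (xs ! k) (ys ! \<pi> k)))"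
  unfolding sym_inner_def by (rule theI'[OF sym_inner_ex1])

lemma sym_inner_sym_prod: "sym_inner (sym_prod xs) (sym_prod ys) = permanent xs ys"
proof (cases "length xs = length ys")
  case True
  then have "sym_inner (sym_prod xs) (sym_prod ys) =
      (\<Sum>\<pi> | \<pi> permutes {..<length xs}. \<Prod>k<length xs. cinner (xs ! k) (ys ! \<pi> k))"
    using sym_inner_spec by blast
  then show ?thesis by (simp add: permanent_def True)
qed (use sym_inner_spec in \<open>auto simp: permanent_def\<close>)

lemma clinear_sym_inner: "clinear (sym_inner \<psi>)"
  using sym_inner_spec by blast

lemma antilinear_sym_inner: "antilinear (\<lambda>\<psi>. sym_inner \<psi> \<phi>)"
  using sym_inner_spec by blast

lemmas sym_inner_right = clinear_lemmas[OF clinear_sym_inner, unfolded scaleC_complex_def]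
lemmas sym_inner_left = antilinear_lemmas[OF antilinear_sym_inner, unfolded scaleC_complex_def]
lemmas sym_inner_sum_right = clinear_sum[OF clinear_sym_inner]
lemmas sym_inner_sum_left = antilinear_sum[OF antilinear_sym_inner]

lemma sym_inner_one_one [simp]: "sym_inner 1 1 = 1"
  using sym_inner_sym_prod[of "[]" "[]"] by (simp add: permanent_def)

lemma sym_inner_commute: "sym_inner \<phi> \<psi> = cnj (sym_inner \<psi> \<phi>)"
proof (induction \<phi> rule: symalg_induct)
  case (prod vs)
  show ?case
  proof (induction \<psi> rule: symalg_induct)
    case (prod ws)
    then show ?case unfolding sym_inner_sym_prod by (rule permanent_commute)
  qed (simp_all add: sym_inner_left sym_inner_right)
qed (simp_all add: sym_inner_left sym_inner_right)

text \<open>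
  Multiplication by \<open>v\<close> is adjoint to \<open>a(v)\<close>, since the Laplace expansion of a permanent along the row
  of \<open>v\<close> is the Leibniz expansion of \<open>a(v)\<close> on the other factor.
\<close>

lemma sym_inner_incl_mult: "sym_inner (sym_incl v * \<phi>) \<psi> = sym_inner \<phi> (annihilator v \<psi>)"
proof (induction \<phi> rule: symalg_induct)
  case (prod xs)
  show ?case
  proof (induction \<psi> rule: symalg_induct)
    case (prod ys)
    have "sym_inner (sym_incl v * sym_prod xs) (sym_prod ys) = permanent (v # xs) ys"
      by (simp flip: sym_inner_sym_prod)
    also have "\<dots> = sym_inner (sym_prod xs) (annihilator v (sym_prod ys))"
      by (simp add: permanent_expand annihilator_sym_prod[OF mset_swap_out] sym_inner_sum_right
          sym_inner_right sym_inner_sym_prod)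
    finally show ?case .
  qed (simp_all add: sym_inner_right annihilator_linear)
qed (simp_all add: sym_inner_left distrib_left scaleC_mult_right)

lemma sym_inner_annihilator: "sym_inner (annihilator v \<phi>) \<psi> = sym_inner \<phi> (sym_incl v * \<psi>)"
  by (metis sym_inner_commute sym_inner_incl_mult)

lemma sym_incl_0 [simp]: "sym_incl 0 = 0"
  by (rule clinear_lemmas(3)[OF clinear_sym_incl])

section \<open>Degrees and positivity\<close>

lemma sym_prod_in_sym_pow: "set vs \<subseteq> M \<Longrightarrow> sym_prod vs \<in> sym_pow (length vs) M"
  unfolding sym_pow_def by (rule complex_vector.span_base) blast

lemma sym_pow_add: "x \<in> sym_pow d M \<Longrightarrow> y \<in> sym_pow d M \<Longrightarrow> x + y \<in> sym_pow d M"
  unfolding sym_pow_def by (rule complex_vector.span_add)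

lemma sym_pow_scale: "x \<in> sym_pow d M \<Longrightarrow> c *\<^sub>C x \<in> sym_pow d M"
  unfolding sym_pow_def by (rule complex_vector.span_scale)

lemma sym_pow_zero [simp]: "0 \<in> sym_pow d M"
  unfolding sym_pow_def by (rule complex_vector.span_zero)

lemma sym_pow_diff: "x \<in> sym_pow d M \<Longrightarrow> y \<in> sym_pow d M \<Longrightarrow> x - y \<in> sym_pow d M"
  unfolding sym_pow_def by (rule complex_vector.span_diff)

lemma sym_pow_mono: "M \<subseteq> N \<Longrightarrow> sym_pow d M \<subseteq> sym_pow d N"
  unfolding sym_pow_def by (rule complex_vector.span_mono) auto

lemma sym_pow_induct [consumes 1, case_names prod zero add scale]:
  assumes "\<psi> \<in> sym_pow d M"
    and "\<And>vs. length vs = d \<Longrightarrow> set vs \<subseteq> M \<Longrightarrow> P (sym_prod vs)"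
    and "P 0" "\<And>x y. P x \<Longrightarrow> P y \<Longrightarrow> P (x + y)" "\<And>c x. P x \<Longrightarrow> P (c *\<^sub>C x)"
  shows "P \<psi>"
  using assms(1) unfolding sym_pow_def
  by (induction rule: complex_vector.span_induct_alt) (use assms in auto)

lemma sym_pow_0: "\<psi> \<in> sym_pow 0 M \<Longrightarrow> \<exists>c. \<psi> = c *\<^sub>C 1"
proof (induction rule: sym_pow_induct)
  case (prod vs) then show ?case by (auto intro!: exI[of _ 1] simp: scaleC_one)
next
  case zero show ?case by (rule exI[of _ 0]) simp
next
  case (add x y) then show ?case by (metis scaleC_add_left)
next
  case (scale c x) then show ?case by (metis scaleC_scaleC)
qed

lemma sym_pow_incl_mult:
  assumes "v \<in> cspan B" "\<psi> \<in> sym_pow d B"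
  shows "sym_incl v * \<psi> \<in> sym_pow (Suc d) B"
  using assms(1)
proof (induction rule: complex_vector.span_induct_alt)
  case base
  then show ?case by simp
next
  case (step c e w)
  have "sym_incl e * \<psi> \<in> sym_pow (Suc d) B" using assms(2)
  proof (induction rule: sym_pow_induct)
    case (prod vs)
    then show ?case using sym_prod_in_sym_pow[of "e # vs" B] step(1) by simp
  qed (simp_all add: distrib_left scaleC_mult_right sym_pow_add sym_pow_scale)
  then show ?case using step
    by (simp add: sym_incl_add sym_incl_scale distrib_right scaleC_mult_left sym_pow_add sym_pow_scale)
qed

text \<open>
  This makes the symmetric powers of a finite-dimensional space spans of finite sets.
\<close>

lemma sym_pow_cspan: "sym_pow d (cspan B) = sym_pow d B"
proof
  show "sym_pow d B \<subseteq> sym_pow d (cspan B)"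
    by (intro sym_pow_mono complex_vector.span_superset)
  have *: "sym_prod vs \<in> sym_pow (length vs) B" if "set vs \<subseteq> cspan B" for vs
    using that by (induction vs) (auto intro: sym_pow_incl_mult sym_prod_in_sym_pow[of "[]", simplified])
  have "\<psi> \<in> sym_pow d B" if "\<psi> \<in> sym_pow d (cspan B)" for \<psi>
    using that
  proof (induction rule: sym_pow_induct)
    case (prod vs) then show ?case using * by blast
  qed (simp_all add: sym_pow_add sym_pow_scale)
  then show "sym_pow d (cspan B) \<subseteq> sym_pow d B" by blast
qed

lemma annihilator_sym_pow:
  assumes "\<psi> \<in> sym_pow (Suc d) M"
  shows "annihilator w \<psi> \<in> sym_pow d M"
proof -
  have *: "annihilator w (sym_prod vs) \<in> sym_pow (length vs - 1) M" if "set vs \<subseteq> M" for vs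
    using that
  proof (induction vs)
    case (Cons v vs)
    then have P: "sym_prod vs \<in> sym_pow (length vs) M" by (intro sym_prod_in_sym_pow) auto
    have "sym_incl v * annihilator w (sym_prod vs) \<in> sym_pow (length vs) M"
    proof (cases vs)
      case (Cons v' vs')
      then show ?thesis using Cons.IH Cons.prems
          sym_pow_incl_mult[OF complex_vector.span_base, of v M "annihilator w (sym_prod vs)" "length vs - 1"] by simp
    qed simp
    then show ?case using P by (simp add: annihilator_incl_mult sym_pow_add sym_pow_scale)
  qed simp
  show ?thesis using assms
  proof (induction rule: sym_pow_induct)
    case (prod vs) then show ?case using *[of vs] by simp
  qed (simp_all add: annihilator_linear sym_pow_add sym_pow_scale)
qed

lemma annihilator_sym_pow_0: "\<psi> \<in> sym_pow 0 M \<Longrightarrow> annihilator w \<psi> = 0"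
  using sym_pow_0 by (fastforce simp: annihilator_linear)

lemma sym_pow_orthogonal:
  assumes "\<phi> \<in> sym_pow d M" "\<psi> \<in> sym_pow d' M'" "d \<noteq> d'"
  shows "sym_inner \<phi> \<psi> = 0"
  using assms(1)
proof (induction rule: sym_pow_induct)
  case (prod vs)
  show ?case using assms(2)
  proof (induction rule: sym_pow_induct)
    case (prod ws)
    then show ?case using \<open>length vs = d\<close> assms(3) by (simp only: sym_inner_sym_prod) (simp add: permanent_def)
  qed (simp_all add: sym_inner_right)
qed (simp_all add: sym_inner_left)

lemma symalg_finite_decomposition:
  "\<exists>S D f. finite S \<and> (\<forall>d. f d \<in> sym_pow d (cspan S)) \<and> (\<forall>d\<ge>D. f d = 0) \<and> \<psi> = (\<Sum>d<(D::nat). f d)"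
proof (induction \<psi> rule: symalg_induct)
  case (prod vs)
  let ?f = "\<lambda>d. if d = length vs then sym_prod vs else 0"
  have "sym_prod vs \<in> sym_pow (length vs) (cspan (set vs))"
    by (intro sym_prod_in_sym_pow complex_vector.span_superset)
  then show ?case
    by (intro exI[of _ "set vs"] exI[of _ "Suc (length vs)"] exI[of _ ?f]) auto
next
  case (add x y)
  obtain S D f where
    1: "finite S" "\<And>d. f d \<in> sym_pow d (cspan S)" "\<And>d. d \<ge> D \<Longrightarrow> f d = 0" "x = (\<Sum>d<(D::nat). f d)"
    using add(1) by blast
  obtain S' D' f' where
    2: "finite S'" "\<And>d. f' d \<in> sym_pow d (cspan S')" "\<And>d. d \<ge> D' \<Longrightarrow> f' d = 0" "y = (\<Sum>d<(D'::nat). f' d)"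
    using add(2) by blast
  have x: "x = (\<Sum>d<max D D'. f d)" unfolding 1(4) by (rule sum.mono_neutral_left) (auto simp: 1(3))
  have y: "y = (\<Sum>d<max D D'. f' d)" unfolding 2(4) by (rule sum.mono_neutral_left) (auto simp: 2(3))
  have "sym_pow d (cspan S) \<subseteq> sym_pow d (cspan (S \<union> S'))" "sym_pow d (cspan S') \<subseteq> sym_pow d (cspan (S \<union> S'))" for d
    by (auto intro!: sym_pow_mono complex_vector.span_mono)
  then have "f d + f' d \<in> sym_pow d (cspan (S \<union> S'))" for d
    using 1(2)[of d] 2(2)[of d] by (intro sym_pow_add) auto
  then show ?case using 1 2
    by (intro exI[of _ "S \<union> S'"] exI[of _ "max D D'"] exI[of _ "\<lambda>d. f d + f' d"])
      (simp add: x y sum.distrib)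
next
  case (scale c x)
  then obtain S D f where
    1: "finite S" "\<And>d. f d \<in> sym_pow d (cspan S)" "\<And>d. d \<ge> D \<Longrightarrow> f d = 0" "x = (\<Sum>d<(D::nat). f d)"
    by blast
  then show ?case
    by (intro exI[of _ S] exI[of _ D] exI[of _ "\<lambda>d. c *\<^sub>C f d"])
      (simp add: sym_pow_scale complex_vector.scale_sum_right)
qed

global_interpretation V: pre_hilbert "cinner :: 'v::complex_hilbert \<Rightarrow> 'v \<Rightarrow> complex"
  rewrites "pre_hilbert.nrm (cinner :: 'v \<Rightarrow> 'v \<Rightarrow> complex) = norm"
proof -
  show *: "pre_hilbert (cinner :: 'v \<Rightarrow> 'v \<Rightarrow> complex)"
  proof
    fix x y z :: 'v and c
    show "cinner x (y + z) = cinner x y + cinner x z" by (rule cinner_add_right)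
    show "cinner x (c *\<^sub>C y) = c * cinner x y" by (rule cinner_scaleC_right)
    show "cinner x y = cnj (cinner y x)" by (rule cinner_commute)
    show "0 \<le> Re (cinner x x)" using norm_ge_zero[of x] unfolding norm_eq_sqrt_cinner by simp
    show "x = 0" if "Re (cinner x x) = 0" using norm_eq_sqrt_cinner[of x] that by simp
  qed
  show "pre_hilbert.nrm (cinner :: 'v \<Rightarrow> 'v \<Rightarrow> complex) = norm"
    by (rule ext) (simp add: pre_hilbert.nrm_def[OF *] norm_eq_sqrt_cinner)
qed

text \<open>
  By the Leibniz rule every factor \<open>v\<close> of a product is replaced once by \<open>\<Sum>\<^sub>e \<langle>e|v\<rangle> e\<close>, which is \<open>v\<close> itself.
\<close>

lemma number_operator:
  assumes B: "V.orthonormal B" and "\<psi> \<in> sym_pow d (cspan B)"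
  shows "(\<Sum>e\<in>B. sym_incl e * annihilator e \<psi>) = of_nat d *\<^sub>C \<psi>"
proof -
  have *: "(\<Sum>e\<in>B. sym_incl e * annihilator e (sym_prod vs)) = of_nat (length vs) *\<^sub>C sym_prod vs"
    if "set vs \<subseteq> cspan B" for vs
    using that
  proof (induction vs)
    case (Cons v vs)
    have "sym_incl v = (\<Sum>e\<in>B. cinner e v *\<^sub>C sym_incl e)"
      using V.orthonormal_expand[OF B, of v] Cons.prems clinear_sum[OF clinear_sym_incl, of "\<lambda>e. cinner e v *\<^sub>C e" B]
      by (simp add: sym_incl_scale)
    then have 1: "(\<Sum>e\<in>B. sym_incl e * (cinner e v *\<^sub>C sym_prod vs)) = sym_incl v * sym_prod vs"
      by (simp add: scaleC_mult_right scaleC_mult_left sum_distrib_right)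
    have "(\<Sum>e\<in>B. sym_incl e * annihilator e (sym_prod (v # vs))) =
        (\<Sum>e\<in>B. sym_incl e * (cinner e v *\<^sub>C sym_prod vs)) +
        sym_incl v * (\<Sum>e\<in>B. sym_incl e * annihilator e (sym_prod vs))"
      by (simp add: annihilator_incl_mult distrib_left sum.distrib sum_distrib_left mult_ac)
    also have "\<dots> = of_nat (length (v # vs)) *\<^sub>C sym_prod (v # vs)"
      using Cons 1 by (simp add: scaleC_add_left scaleC_mult_right scaleC_one)
    finally show ?case .
  qed simp
  show ?thesis using assms(2)
  proof (induction rule: sym_pow_induct)
    case (prod vs) then show ?case using * by blast
  qed (simp_all add: annihilator_linear distrib_left sum.distrib scaleC_add_right scaleC_mult_right
      mult.commute flip: complex_vector.scale_sum_right)
qed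

text \<open>
  On the symmetric algebra of the span of \<open>B\<close>, the operator \<open>a(w)\<close> sees \<open>w\<close> only through inner products
  with elements of that span.
\<close>

lemma annihilator_expand:
  assumes B: "V.orthonormal B" and "\<psi> \<in> sym_pow d (cspan B)"
  shows "annihilator w \<psi> = (\<Sum>e\<in>B. cinner w e *\<^sub>C annihilator e \<psi>)"
proof -
  have *: "annihilator w (sym_prod vs) = (\<Sum>e\<in>B. cinner w e *\<^sub>C annihilator e (sym_prod vs))"
    if "set vs \<subseteq> cspan B" for vs
    using that
  proof (induction vs)
    case (Cons v vs)
    have "cinner w v = cinner w (\<Sum>e\<in>B. cinner e v *\<^sub>C e)"
      using V.orthonormal_expand[OF B, of v] Cons.prems by simp
    then have wv: "cinner w v = (\<Sum>e\<in>B. cinner w e * cinner e v)"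
      by (simp add: V.ip_sum_right V.ip_right mult.commute)
    show ?case using Cons
      by (simp add: annihilator_incl_mult wv scaleC_add_right sum.distrib complex_vector.scale_sum_left
          scaleC_mult_right sum_distrib_left)
  qed simp
  show ?thesis using assms(2)
  proof (induction rule: sym_pow_induct)
    case (prod vs) then show ?case using * by blast
  qed (simp_all add: annihilator_linear sum.distrib scaleC_add_right mult.commute complex_vector.scale_sum_right)
qed

text \<open>
  The number operator identity, paired with \<open>\<psi>\<close>.
\<close>

lemma sym_inner_number:
  assumes B: "V.orthonormal B" and \<psi>: "\<psi> \<in> sym_pow d (cspan B)"
  shows "real d * Re (sym_inner \<psi> \<psi>) = (\<Sum>e\<in>B. Re (sym_inner (annihilator e \<psi>) (annihilator e \<psi>)))"
proof -
  have "of_nat d * sym_inner \<psi> \<psi> = sym_inner (\<Sum>e\<in>B. sym_incl e * annihilator e \<psi>) \<psi>"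
    by (simp add: number_operator[OF assms] sym_inner_left)
  also have "\<dots> = (\<Sum>e\<in>B. sym_inner (annihilator e \<psi>) (annihilator e \<psi>))"
    by (simp add: sym_inner_sum_left sym_inner_incl_mult)
  finally have "Re (of_nat d * sym_inner \<psi> \<psi>) = (\<Sum>e\<in>B. Re (sym_inner (annihilator e \<psi>) (annihilator e \<psi>)))"
    by simp
  then show ?thesis by simp
qed

text \<open>
  Positivity descends to lower degree: \<open>d \<langle>\<psi>|\<psi>\<rangle>\<close> is a sum of the values \<open>\<langle>a(e)\<psi>|a(e)\<psi>\<rangle>\<close>, and if all \<open>a(e)\<psi>\<close>
  vanish then so does \<open>d \<psi> = \<Sum>\<^sub>e e a(e)\<psi>\<close>.
\<close>

lemma sym_pow_positive:
  assumes B: "V.orthonormal B" and "\<psi> \<in> sym_pow d (cspan B)"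
  shows "0 \<le> Re (sym_inner \<psi> \<psi>) \<and> (Re (sym_inner \<psi> \<psi>) = 0 \<longrightarrow> \<psi> = 0)"
  using assms(2)
proof (induction d arbitrary: \<psi>)
  case 0
  then obtain c where "\<psi> = c *\<^sub>C 1" using sym_pow_0 by blast
  moreover have "c * cnj c = complex_of_real ((cmod c)\<^sup>2)" by (rule complex_norm_square[symmetric])
  ultimately have "sym_inner \<psi> \<psi> = complex_of_real ((cmod c)\<^sup>2)"
    by (simp only: sym_inner_left sym_inner_right sym_inner_one_one mult_1_right)
  then show ?case using \<open>\<psi> = c *\<^sub>C 1\<close> by (simp only: Re_complex_of_real) simp
next
  case (Suc d)
  note IH = Suc.IH[OF annihilator_sym_pow[OF Suc.prems]]
  note num = sym_inner_number[OF B Suc.prems]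
  have "0 \<le> real (Suc d) * Re (sym_inner \<psi> \<psi>)" unfolding num using IH by (intro sum_nonneg) auto
  then have 1: "0 \<le> Re (sym_inner \<psi> \<psi>)" by (simp add: zero_le_mult_iff del: of_nat_Suc)
  have "\<psi> = 0" if "Re (sym_inner \<psi> \<psi>) = 0"
  proof -
    have "(\<Sum>e\<in>B. Re (sym_inner (annihilator e \<psi>) (annihilator e \<psi>))) = 0" using num that by simp
    then have "annihilator e \<psi> = 0" if "e \<in> B" for e
      using IH that V.orthonormal_finite[OF B] by (subst (asm) sum_nonneg_eq_0_iff) auto
    then have "of_nat (Suc d) *\<^sub>C \<psi> = 0" using number_operator[OF B Suc.prems] by simp
    then show ?thesis by (simp del: of_nat_Suc)
  qed
  with 1 show ?case by blast
qed

lemma symalg_decomposition: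
  obtains B D f where "V.orthonormal B" "\<And>d. f d \<in> sym_pow d (cspan B)" "\<psi> = (\<Sum>d<(D::nat). f d)"
proof -
  obtain S D f where 1: "finite S" "\<forall>d. f d \<in> sym_pow d (cspan S)" "\<psi> = (\<Sum>d<(D::nat). f d)"
    using symalg_finite_decomposition by blast
  obtain B where "V.orthonormal B" "cspan B = cspan S" using V.exists_orthonormal[OF 1(1)] .
  then show ?thesis using 1 by (intro that[of B f D]) simp_all
qed

lemma sym_inner_degrees:
  assumes "\<And>d. f d \<in> sym_pow d M" "\<And>d. g d \<in> sym_pow d M'"
  shows "sym_inner (\<Sum>d<(D::nat). f d) (\<Sum>d<D. g d) = (\<Sum>d<D. sym_inner (f d) (g d))"
proof -
  have "sym_inner (f d) (\<Sum>d<D. g d) = sym_inner (f d) (g d)" if "d < D" for d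
  proof -
    have "sym_inner (f d) (\<Sum>d<D. g d) = (\<Sum>d'<D. if d' = d then sym_inner (f d) (g d) else 0)"
      unfolding sym_inner_sum_right using sym_pow_orthogonal[OF assms] by (intro sum.cong) auto
    then show ?thesis using that by simp
  qed
  then show ?thesis by (simp add: sym_inner_sum_left)
qed

global_interpretation S: pre_hilbert "sym_inner :: 'v::complex_hilbert symalg \<Rightarrow> 'v symalg \<Rightarrow> complex"
  rewrites "pre_hilbert.nrm (sym_inner :: 'v symalg \<Rightarrow> 'v symalg \<Rightarrow> complex) = sym_norm"
    and "pre_hilbert.emb (sym_inner :: 'v symalg \<Rightarrow> 'v symalg \<Rightarrow> complex) = dual_embed"
proof -
  have pos: "0 \<le> Re (sym_inner \<psi> \<psi>) \<and> (Re (sym_inner \<psi> \<psi>) = 0 \<longrightarrow> \<psi> = 0)" for \<psi> :: "'v symalg"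
  proof -
    obtain B D f where B: "V.orthonormal B" and f: "\<And>d. f d \<in> sym_pow d (cspan B)" and \<psi>: "\<psi> = (\<Sum>d<(D::nat). f d)"
      using symalg_decomposition[of \<psi>] by blast
    have p: "0 \<le> Re (sym_inner (f d) (f d))" "Re (sym_inner (f d) (f d)) = 0 \<Longrightarrow> f d = 0" for d
      using sym_pow_positive[OF B f[of d]] by auto
    have s: "Re (sym_inner \<psi> \<psi>) = (\<Sum>d<D. Re (sym_inner (f d) (f d)))"
      unfolding \<psi> by (simp add: sym_inner_degrees[OF f f])
    have "\<psi> = 0" if "Re (sym_inner \<psi> \<psi>) = 0"
    proof -
      have "\<forall>d\<in>{..<D}. Re (sym_inner (f d) (f d)) = 0"
        using that p(1) unfolding s by (subst (asm) sum_nonneg_eq_0_iff) auto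
      then show ?thesis unfolding \<psi> using p(2) by (intro sum.neutral) auto
    qed
    then show ?thesis using p(1) s by (auto intro: sum_nonneg)
  qed
  show *: "pre_hilbert (sym_inner :: 'v symalg \<Rightarrow> 'v symalg \<Rightarrow> complex)"
  proof
    fix x y z :: "'v symalg" and c
    show "sym_inner x y = cnj (sym_inner y x)" by (rule sym_inner_commute)
    show "0 \<le> Re (sym_inner x x)" "Re (sym_inner x x) = 0 \<Longrightarrow> x = 0" using pos by auto
  qed (simp_all add: sym_inner_right)
  show "pre_hilbert.nrm (sym_inner :: 'v symalg \<Rightarrow> 'v symalg \<Rightarrow> complex) = sym_norm"
    by (rule ext) (simp add: pre_hilbert.nrm_def[OF *] sym_norm_def)
  show "pre_hilbert.emb (sym_inner :: 'v symalg \<Rightarrow> 'v symalg \<Rightarrow> complex) = dual_embed"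
    by (rule ext) (simp add: pre_hilbert.emb_def[OF *] dual_embed_def)
qed

lemma sym_norm_number:
  assumes B: "V.orthonormal B" and \<psi>: "\<psi> \<in> sym_pow d (cspan B)"
  shows "real d * (sym_norm \<psi>)\<^sup>2 = (\<Sum>e\<in>B. (sym_norm (annihilator e \<psi>))\<^sup>2)"
  using sym_inner_number[OF assms] by (simp add: S.nrm_sq)

lemma sym_norm_degrees:
  assumes "\<And>d. f d \<in> sym_pow d M"
  shows "(sym_norm (\<Sum>d<(D::nat). f d))\<^sup>2 = (\<Sum>d<D. (sym_norm (f d))\<^sup>2)"
  by (simp add: S.nrm_sq sym_inner_degrees[OF assms assms])

section \<open>Fock space as the antidual of the symmetric algebra\<close>

lemma fock_component:
  assumes "antilinear \<Phi>" "finite B"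
  shows "fock_component \<Phi> (cspan B) d \<in> sym_pow d (cspan B)"
    and "\<psi> \<in> sym_pow d (cspan B) \<Longrightarrow> \<Phi> \<psi> = sym_inner \<psi> (fock_component \<Phi> (cspan B) d)"
proof -
  let ?S = "{sym_prod vs | vs. length vs = d \<and> set vs \<subseteq> B}"
  have "?S = sym_prod ` {vs. set vs \<subseteq> B \<and> length vs = d}" by auto
  then have "finite ?S" using finite_lists_length_eq[OF assms(2)] by simp
  from theI'[OF S.Riesz_cspan[OF this assms(1)]]
  show "fock_component \<Phi> (cspan B) d \<in> sym_pow d (cspan B)"
    "\<psi> \<in> sym_pow d (cspan B) \<Longrightarrow> \<Phi> \<psi> = sym_inner \<psi> (fock_component \<Phi> (cspan B) d)"
    unfolding fock_component_def sym_pow_cspan unfolding sym_pow_def by auto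
qed

lemma ennreal_sqrt_suminf_le_iff:
  assumes "\<And>d. 0 \<le> a d" "0 \<le> K"
  shows "ennreal_sqrt (suminf (\<lambda>d. ennreal (a d))) \<le> ennreal K \<longleftrightarrow> (\<forall>D. (\<Sum>d<D. a d) \<le> K\<^sup>2)"
proof
  let ?s = "suminf (\<lambda>d. ennreal (a d))"
  assume *: "\<forall>D. (\<Sum>d<D. a d) \<le> K\<^sup>2"
  have "?s \<le> ennreal (K\<^sup>2)"
    by (rule suminf_le_const) (auto simp: assms * ennreal_leI)
  then have "?s \<noteq> \<infinity>" "enn2real ?s \<le> K\<^sup>2"
    using assms by (auto simp: enn2real_leI top_unique)
  then show "ennreal_sqrt ?s \<le> ennreal K"
    using assms by (auto simp: ennreal_sqrt_def intro!: ennreal_leI real_le_lsqrt)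
next
  let ?s = "suminf (\<lambda>d. ennreal (a d))"
  assume *: "ennreal_sqrt ?s \<le> ennreal K"
  then have fin: "?s \<noteq> \<infinity>" by (auto simp: ennreal_sqrt_def top_unique)
  then have "sqrt (enn2real ?s) \<le> K" using * assms by (simp add: ennreal_sqrt_def)
  then have "enn2real ?s \<le> K\<^sup>2" using power_mono[of "sqrt (enn2real ?s)" K 2] by simp
  moreover have "(\<Sum>d<D. a d) \<le> enn2real ?s" for D
  proof -
    have "ennreal (\<Sum>d<D. a d) \<le> ?s" using assms by (simp flip: sum_ennreal add: sum_le_suminf)
    also have "?s = ennreal (enn2real ?s)" using fin by (simp add: less_top)
    finally show ?thesis by simp
  qed
  ultimately show "\<forall>D. (\<Sum>d<D. a d) \<le> K\<^sup>2" by (meson order_trans)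
qed

lemma fock_norm_ext_le_components:
  assumes "0 \<le> K"
  shows "fock_norm_ext \<Phi> \<le> ennreal K \<longleftrightarrow>
    (\<forall>B. finite B \<longrightarrow> (\<forall>D. (\<Sum>d<D. (sym_norm (fock_component \<Phi> (cspan B) d))\<^sup>2) \<le> K\<^sup>2))"
  using assms by (auto simp: fock_norm_ext_def SUP_le_iff fin_dim_csubspace_def fock_norm_on_def ennreal_sqrt_suminf_le_iff)

text \<open>
  Over a finite-dimensional \<open>M\<close> the functional is the inner product with the sum of its components
  \<open>F\<^sub>d\<close>. Evaluating \<open>\<Phi>\<close> at a partial sum of the \<open>F\<^sub>d\<close> turns a bound of \<open>\<Phi>\<close> into one of the partial sums;
  conversely Cauchy-Schwarz applies, because every \<open>\<psi>\<close> lies in the symmetric algebra of some \<open>M\<close>.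
\<close>

lemma fock_norm_ext_le_iff:
  fixes \<Phi> :: "'v::complex_hilbert symalg \<Rightarrow> complex"
  assumes \<Phi>: "antilinear \<Phi>" and K: "0 \<le> K"
  shows "fock_norm_ext \<Phi> \<le> ennreal K \<longleftrightarrow> S.bound_by \<Phi> K"
proof -
  let ?a = "\<lambda>M d. (sym_norm (fock_component \<Phi> M d))\<^sup>2"
  show ?thesis unfolding fock_norm_ext_le_components[OF K]
  proof (intro iffI allI impI)
    fix B :: "'v set" and D :: nat assume b: "S.bound_by \<Phi> K" and B: "finite B"
    let ?F = "fock_component \<Phi> (cspan B)"
    note F = fock_component[OF \<Phi> B]
    define s where "s = (\<Sum>d<D. ?a (cspan B) d)"
    have s0: "0 \<le> s" by (simp add: s_def sum_nonneg)
    have "\<Phi> (\<Sum>d<D. ?F d) = (\<Sum>d<D. complex_of_real (?a (cspan B) d))"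
      unfolding antilinear_sum[OF \<Phi>] by (intro sum.cong refl) (simp only: F(2)[OF F(1)] S.ip_self)
    also have "\<dots> = complex_of_real s" by (simp add: s_def)
    finally have "cmod (\<Phi> (\<Sum>d<D. ?F d)) = s" using s0 by (simp only: norm_of_real abs_of_nonneg)
    moreover have "(sym_norm (\<Sum>d<D. ?F d))\<^sup>2 = s"
      unfolding s_def by (rule sym_norm_degrees[OF F(1)])
    ultimately have "s \<le> K * sqrt s"
      using b real_sqrt_unique[of "sym_norm (\<Sum>d<D. ?F d)" s] unfolding S.bound_by_def by fastforce
    then have "s\<^sup>2 \<le> K\<^sup>2 * s" using s0 power_mono[of s "K * sqrt s" 2] by (simp add: power_mult_distrib)
    then have "s \<le> K\<^sup>2" using s0 by (cases "s = 0") (auto simp: power2_eq_square)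
    then show "(\<Sum>d<D. ?a (cspan B) d) \<le> K\<^sup>2" by (simp add: s_def)
  next
    assume a: "\<forall>B. finite B \<longrightarrow> (\<forall>D. (\<Sum>d<D. ?a (cspan B) d) \<le> K\<^sup>2)"
    show "S.bound_by \<Phi> K" unfolding S.bound_by_def
    proof (intro conjI allI K)
      fix \<psi> :: "'v symalg"
      obtain B D f where B: "V.orthonormal B" and f: "\<And>d. f d \<in> sym_pow d (cspan B)" and \<psi>: "\<psi> = (\<Sum>d<(D::nat). f d)"
        using symalg_decomposition[of \<psi>] by blast
      have fin: "finite B" by (rule V.orthonormal_finite[OF B])
      let ?F = "fock_component \<Phi> (cspan B)"
      note F = fock_component[OF \<Phi> fin]
      have "(sym_norm (\<Sum>d<D. ?F d))\<^sup>2 \<le> K\<^sup>2"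
        using a fin by (simp add: sym_norm_degrees[OF F(1)])
      then have n: "sym_norm (\<Sum>d<D. ?F d) \<le> K" using K by (rule power2_le_imp_le)
      have "\<Phi> \<psi> = (\<Sum>d<D. sym_inner (f d) (?F d))"
        unfolding \<psi> antilinear_sum[OF \<Phi>] by (intro sum.cong refl F(2) f)
      also have "\<dots> = sym_inner \<psi> (\<Sum>d<D. ?F d)"
        unfolding \<psi> by (rule sym_inner_degrees[OF f F(1), symmetric])
      finally have "cmod (\<Phi> \<psi>) \<le> sym_norm \<psi> * sym_norm (\<Sum>d<D. ?F d)"
        by (simp only: S.Cauchy_Schwarz)
      also have "\<dots> \<le> sym_norm \<psi> * K" using n by (intro mult_left_mono) auto
      finally show "cmod (\<Phi> \<psi>) \<le> K * sym_norm \<psi>" by (simp add: mult.commute)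
    qed
  qed
qed

lemma fock_space_eq_antidual: "fock_space = S.antidual"
proof -
  have "fock_norm_ext \<Phi> < \<infinity> \<longleftrightarrow> (\<exists>K. S.bound_by \<Phi> K)" if "antilinear \<Phi>" for \<Phi> :: "'v::complex_hilbert symalg \<Rightarrow> complex"
  proof
    assume "fock_norm_ext \<Phi> < \<infinity>"
    then have "fock_norm_ext \<Phi> \<le> ennreal (enn2real (fock_norm_ext \<Phi>))" by (simp add: less_top)
    then show "\<exists>K. S.bound_by \<Phi> K" using fock_norm_ext_le_iff[OF that] enn2real_nonneg by blast
  next
    assume "\<exists>K. S.bound_by \<Phi> K"
    then obtain K where K: "S.bound_by \<Phi> K" by blast
    then have "0 \<le> K" by (simp add: S.bound_by_def)
    with K have "fock_norm_ext \<Phi> \<le> ennreal K" using fock_norm_ext_le_iff[OF that] by blast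
    then show "fock_norm_ext \<Phi> < \<infinity>" using order_le_less_trans[OF _ ennreal_less_top] by simp
  qed
  then show ?thesis by (auto simp: fock_space_def S.antidual_def)
qed

lemma fock_norm_eq_dnorm:
  assumes "\<Phi> \<in> fock_space"
  shows "fock_norm \<Phi> = S.dnorm \<Phi>"
proof -
  have \<Phi>: "antilinear \<Phi>" "\<Phi> \<in> S.antidual" "fock_norm_ext \<Phi> < \<infinity>"
    using assms fock_space_eq_antidual by (auto simp: fock_space_def)
  have e: "fock_norm_ext \<Phi> = ennreal (fock_norm \<Phi>)" using \<Phi>(3) by (simp add: fock_norm_def less_top)
  have n: "0 \<le> fock_norm \<Phi>" by (simp add: fock_norm_def)
  have "S.bound_by \<Phi> (fock_norm \<Phi>)" using fock_norm_ext_le_iff[OF \<Phi>(1) n] e by simp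
  then have "S.dnorm \<Phi> \<le> fock_norm \<Phi>" by (rule S.dnorm_le)
  moreover have "fock_norm_ext \<Phi> \<le> ennreal (S.dnorm \<Phi>)"
    using fock_norm_ext_le_iff[OF \<Phi>(1) S.dnorm_ge_0[OF \<Phi>(2)]] S.bound_by_dnorm[OF \<Phi>(2)] by simp
  then have "fock_norm \<Phi> \<le> S.dnorm \<Phi>" unfolding e using S.dnorm_ge_0[OF \<Phi>(2)] by simp
  ultimately show ?thesis by simp
qed

lemma scaleC_apply: "(c *\<^sub>C f) x = c * (f x :: complex)"
  by (simp add: scaleC_fun_def scaleC_complex_def)

section \<open>Dilations\<close>

text \<open>
  The second quantization of multiplication by \<open>r\<close> on \<open>V\<close>, which is multiplication by \<open>r\<^sup>d\<close> in degree \<open>d\<close>.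
\<close>

definition dilation :: "real \<Rightarrow> 'v::complex_vector symalg \<Rightarrow> 'v symalg"
  where "dilation r = (THE F. calgebra_hom F \<and> (\<forall>v. F (sym_incl v) = complex_of_real r *\<^sub>C sym_incl v))"

lemma dilation_spec:
  "calgebra_hom (dilation r :: 'v::complex_vector symalg \<Rightarrow> _) \<and>
   (\<forall>v::'v. dilation r (sym_incl v) = complex_of_real r *\<^sub>C sym_incl v)"
proof -
  have "clinear (\<lambda>v::'v. complex_of_real r *\<^sub>C sym_incl v)"
    by (simp add: clinear_def sym_incl_add sym_incl_scale scaleC_add_right mult.commute)
  from theI'[OF symalg_universal[OF this]] show ?thesis unfolding dilation_def .
qed

lemma clinear_dilation: "clinear (dilation r :: 'a::complex_vector symalg \<Rightarrow> _)"
  using dilation_spec[where 'v = 'a] by (simp add: calgebra_hom_def)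

lemmas dilation_linear = clinear_lemmas[OF clinear_dilation]

lemma dilation_one [simp]: "dilation r (1 :: 'v::complex_vector symalg) = 1"
  using dilation_spec[where 'v = 'v] by (simp add: calgebra_hom_def)

lemma dilation_incl_mult:
  fixes v :: "'v::complex_vector"
  shows "dilation r (sym_incl v * \<psi>) = complex_of_real r *\<^sub>C (sym_incl v * dilation r \<psi>)"
  using dilation_spec[where 'v = 'v] by (simp add: calgebra_hom_def scaleC_mult_left)

lemma dilation_dilation: "dilation r (dilation s \<psi>) = dilation (r * s) \<psi>"
proof (induction \<psi> rule: symalg_induct)
  case (prod vs)
  show ?case by (induction vs) (simp_all add: dilation_incl_mult dilation_linear mult.commute)
qed (simp_all add: dilation_linear)

lemma dilation_1 [simp]: "dilation 1 \<psi> = \<psi>"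
proof (induction \<psi> rule: symalg_induct)
  case (prod vs)
  show ?case by (induction vs) (simp_all add: dilation_incl_mult)
qed (simp_all add: dilation_linear)

lemma annihilator_dilation: "annihilator v (dilation r \<psi>) = complex_of_real r *\<^sub>C dilation r (annihilator v \<psi>)"
proof (induction \<psi> rule: symalg_induct)
  case (prod vs)
  show ?case
    by (induction vs)
      (simp_all add: dilation_incl_mult dilation_linear annihilator_incl_mult annihilator_linear
        scaleC_add_right scaleC_mult_right mult_ac)
qed (simp_all add: dilation_linear annihilator_linear scaleC_add_right mult.commute)

lemma dilation_sym_pow: "\<psi> \<in> sym_pow d M \<Longrightarrow> dilation r \<psi> = complex_of_real (r ^ d) *\<^sub>C \<psi>"
proof (induction rule: sym_pow_induct)
  case (prod vs)
  have "dilation r (sym_prod vs) = complex_of_real (r ^ length vs) *\<^sub>C sym_prod vs"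
    by (induction vs) (simp_all add: dilation_incl_mult scaleC_mult_right)
  then show ?case using prod by simp
qed (simp_all add: dilation_linear scaleC_add_right mult.commute)

lemma sym_inner_dilation:
  fixes \<phi> \<psi> :: "'v::complex_hilbert symalg"
  shows "sym_inner (dilation r \<phi>) \<psi> = sym_inner \<phi> (dilation r \<psi>)"
proof (induction \<phi> arbitrary: \<psi> rule: symalg_induct)
  case (prod vs)
  show ?case
  proof (induction vs arbitrary: \<psi>)
    case Nil
    show ?case
    proof (induction \<psi> rule: symalg_induct)
      case (prod ws)
      show ?case
      proof (cases ws)
        case (Cons w us)
        have "sym_inner (1::'v symalg) (sym_incl w * \<chi>') = 0" for \<chi>'
          using sym_inner_annihilator[of w 1 \<chi>'] by (simp add: sym_inner_left)
        then show ?thesis using Cons by (simp add: dilation_incl_mult sym_inner_right)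
      qed simp
    qed (simp_all add: dilation_linear sym_inner_right)
  next
    case (Cons v vs)
    then show ?case
      by (simp add: dilation_incl_mult sym_inner_left sym_inner_incl_mult annihilator_dilation sym_inner_right)
  qed
qed (simp_all add: dilation_linear sym_inner_left)

text \<open>
  Expand \<open>a(v)\<close> in an orthonormal basis, apply Cauchy-Schwarz, and use that the squares of the
  \<open>a(e)\<psi>\<close> sum up to \<open>d \<parallel>\<psi>\<parallel>\<^sup>2\<close>.
\<close>

lemma annihilator_bound:
  assumes B: "V.orthonormal B" and \<psi>: "\<psi> \<in> sym_pow d (cspan B)"
  shows "(sym_norm (annihilator v \<psi>))\<^sup>2 \<le> real d * (norm v)\<^sup>2 * (sym_norm \<psi>)\<^sup>2"
proof -
  have "sym_norm (annihilator v \<psi>) \<le> (\<Sum>e\<in>B. sym_norm (cinner v e *\<^sub>C annihilator e \<psi>))"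
    unfolding annihilator_expand[OF B \<psi>, of v] by (rule S.nrm_sum_le)
  also have "\<dots> = (\<Sum>e\<in>B. cmod (cinner v e) * sym_norm (annihilator e \<psi>))"
    by (simp add: S.nrm_scale)
  finally have "(sym_norm (annihilator v \<psi>))\<^sup>2 \<le> (\<Sum>e\<in>B. cmod (cinner v e) * sym_norm (annihilator e \<psi>))\<^sup>2"
    by (intro power_mono) auto
  also have "\<dots> \<le> (\<Sum>e\<in>B. (cmod (cinner v e))\<^sup>2) * (\<Sum>e\<in>B. (sym_norm (annihilator e \<psi>))\<^sup>2)"
    by (rule Cauchy_Schwarz_ineq_sum)
  also have "\<dots> \<le> (norm v)\<^sup>2 * (real d * (sym_norm \<psi>)\<^sup>2)"
  proof (rule mult_mono)
    have "cmod (cinner v e) = cmod (cinner e v)" for e by (metis complex_mod_cnj cinner_commute)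
    then show "(\<Sum>e\<in>B. (cmod (cinner v e))\<^sup>2) \<le> (norm v)\<^sup>2" using V.Bessel[OF B, of v] by simp
  qed (use sym_norm_number[OF B \<psi>] in \<open>simp_all add: sum_nonneg\<close>)
  finally show ?thesis by (simp add: mult_ac)
qed

lemma dilation_contraction:
  assumes "0 \<le> s" "s \<le> 1"
  shows "sym_norm (dilation s \<psi>) \<le> sym_norm \<psi>"
proof (rule power2_le_imp_le)
  obtain B D f where B: "V.orthonormal B" and f: "\<And>d. f d \<in> sym_pow d (cspan B)" and \<psi>: "\<psi> = (\<Sum>d<(D::nat). f d)"
    using symalg_decomposition[of \<psi>] by blast
  have f': "complex_of_real (s ^ d) *\<^sub>C f d \<in> sym_pow d (cspan B)" for d by (intro sym_pow_scale f)
  have "dilation s \<psi> = (\<Sum>d<D. complex_of_real (s ^ d) *\<^sub>C f d)"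
    unfolding \<psi> clinear_sum[OF clinear_dilation] by (intro sum.cong refl dilation_sym_pow[OF f])
  then have "(sym_norm (dilation s \<psi>))\<^sup>2 = (\<Sum>d<D. (sym_norm (complex_of_real (s ^ d) *\<^sub>C f d))\<^sup>2)"
    using sym_norm_degrees[OF f'] by simp
  also have "\<dots> \<le> (\<Sum>d<D. (sym_norm (f d))\<^sup>2)"
  proof (intro sum_mono power_mono)
    fix d
    have "s ^ d * sym_norm (f d) \<le> 1 * sym_norm (f d)"
      using assms by (intro mult_right_mono power_le_one) auto
    then show "sym_norm (complex_of_real (s ^ d) *\<^sub>C f d) \<le> sym_norm (f d)"
      using assms by (simp only: S.nrm_scale norm_of_real) simp
  qed simp
  also have "\<dots> = (sym_norm \<psi>)\<^sup>2" unfolding \<psi> by (rule sym_norm_degrees[OF f, symmetric])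
  finally show "(sym_norm (dilation s \<psi>))\<^sup>2 \<le> (sym_norm \<psi>)\<^sup>2" .
qed simp

text \<open>
  Each of the \<open>d + 1\<close> copies of \<open>q\<^sup>d\<close> is below one of the first \<open>d + 1\<close> terms of the geometric series.
\<close>

lemma linear_times_power_le:
  fixes q :: real
  assumes "0 \<le> q" "q < 1"
  shows "real (Suc d) * q ^ d \<le> 1 / (1 - q)"
proof -
  have "real (Suc d) * q ^ d = (\<Sum>k<Suc d. q ^ d)" by simp
  also have "\<dots> \<le> (\<Sum>k<Suc d. q ^ k)" using assms by (intro sum_mono power_decreasing) auto
  also have "\<dots> = (1 - q ^ Suc d) / (1 - q)" using assms by (simp only: sum_gp_strict) auto
  also have "\<dots> \<le> 1 / (1 - q)" using assms by (intro divide_right_mono) auto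
  finally show ?thesis .
qed

text \<open>
  In degree \<open>d\<close> the annihilator grows like \<open>\<surd>d\<close>, which the factor \<open>s\<^bsup>d-1\<^esup>\<close> of the dilation outweighs.
\<close>

lemma dilated_annihilator_bound:
  assumes s: "0 < s" "s < 1"
  shows "sym_norm (dilation s (annihilator v \<psi>)) \<le> sqrt (1 / (1 - s\<^sup>2)) * norm v * sym_norm \<psi>"
proof (rule power2_le_imp_le)
  have q: "0 \<le> s\<^sup>2" "s\<^sup>2 < 1" using s by (auto simp: abs_square_less_1)
  then have K: "0 \<le> 1 / (1 - s\<^sup>2)" by simp
  obtain B D f where B: "V.orthonormal B" and f: "\<And>d. f d \<in> sym_pow d (cspan B)" and \<psi>: "\<psi> = (\<Sum>d<(D::nat). f d)"
    using symalg_decomposition[of \<psi>] by blast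
  define g where "g d = complex_of_real (s ^ d) *\<^sub>C annihilator v (f (Suc d))" for d
  have ann: "annihilator v (f (Suc d)) \<in> sym_pow d (cspan B)" for d by (rule annihilator_sym_pow[OF f])
  have g: "g d \<in> sym_pow d (cspan B)" for d unfolding g_def by (rule sym_pow_scale[OF ann])
  have "(sym_norm (dilation s (annihilator v \<psi>)))\<^sup>2 \<le> 1 / (1 - s\<^sup>2) * (norm v)\<^sup>2 * (sym_norm \<psi>)\<^sup>2"
  proof (cases D)
    case 0
    then show ?thesis by (simp add: \<psi> annihilator_linear dilation_linear)
  next
    case (Suc D')
    have "annihilator v \<psi> = (\<Sum>d<D'. annihilator v (f (Suc d)))"
      unfolding \<psi> Suc sum.lessThan_Suc_shift
      by (simp add: annihilator_linear annihilator_sym_pow_0[OF f] clinear_sum[OF clinear_annihilator])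
    then have "dilation s (annihilator v \<psi>) = (\<Sum>d<D'. g d)"
      unfolding g_def by (simp only: clinear_sum[OF clinear_dilation] dilation_sym_pow[OF ann])
    then have "(sym_norm (dilation s (annihilator v \<psi>)))\<^sup>2 = (\<Sum>d<D'. (sym_norm (g d))\<^sup>2)"
      using sym_norm_degrees[OF g] by simp
    also have "\<dots> \<le> (\<Sum>d<D'. 1 / (1 - s\<^sup>2) * (norm v)\<^sup>2 * (sym_norm (f (Suc d)))\<^sup>2)"
    proof (rule sum_mono)
      fix d
      have "(sym_norm (g d))\<^sup>2 = (s\<^sup>2) ^ d * (sym_norm (annihilator v (f (Suc d))))\<^sup>2"
        using s by (simp only: g_def S.nrm_scale norm_of_real power_mult_distrib)
          (simp add: power_mult[symmetric] mult.commute)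
      also have "\<dots> \<le> (s\<^sup>2) ^ d * (real (Suc d) * (norm v)\<^sup>2 * (sym_norm (f (Suc d)))\<^sup>2)"
        by (intro mult_left_mono annihilator_bound[OF B f]) simp
      also have "\<dots> = real (Suc d) * (s\<^sup>2) ^ d * ((norm v)\<^sup>2 * (sym_norm (f (Suc d)))\<^sup>2)" by (simp only: mult_ac)
      also have "\<dots> \<le> 1 / (1 - s\<^sup>2) * ((norm v)\<^sup>2 * (sym_norm (f (Suc d)))\<^sup>2)"
        by (intro mult_right_mono linear_times_power_le q) simp
      finally show "(sym_norm (g d))\<^sup>2 \<le> 1 / (1 - s\<^sup>2) * (norm v)\<^sup>2 * (sym_norm (f (Suc d)))\<^sup>2"
        by (simp only: mult.assoc)
    qed
    also have "\<dots> = 1 / (1 - s\<^sup>2) * (norm v)\<^sup>2 * (\<Sum>d<D'. (sym_norm (f (Suc d)))\<^sup>2)"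
      by (simp only: sum_distrib_left)
    also have "\<dots> \<le> 1 / (1 - s\<^sup>2) * (norm v)\<^sup>2 * (\<Sum>d<D. (sym_norm (f d))\<^sup>2)"
      unfolding Suc sum.lessThan_Suc_shift using K by (intro mult_left_mono) auto
    also have "(\<Sum>d<D. (sym_norm (f d))\<^sup>2) = (sym_norm \<psi>)\<^sup>2"
      unfolding \<psi> by (rule sym_norm_degrees[OF f, symmetric])
    finally show ?thesis .
  qed
  also have "\<dots> = (sqrt (1 / (1 - s\<^sup>2)) * norm v * sym_norm \<psi>)\<^sup>2"
    unfolding power_mult_distrib using K by (simp only: real_sqrt_pow2)
  finally show "(sym_norm (dilation s (annihilator v \<psi>)))\<^sup>2 \<le> (sqrt (1 / (1 - s\<^sup>2)) * norm v * sym_norm \<psi>)\<^sup>2" .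
  show "0 \<le> sqrt (1 / (1 - s\<^sup>2)) * norm v * sym_norm \<psi>" using K by simp
qed

text \<open>
  Follows by duality, as the dilation is self-adjoint and commutes with annihilators up to the
  factor \<open>s\<close>.
\<close>

lemma dilated_creator_bound:
  assumes s: "0 < s" "s < 1"
  shows "sym_norm (dilation s (sym_incl v * \<psi>)) \<le> sqrt (1 / (1 - s\<^sup>2)) * norm v * sym_norm \<psi>"
proof -
  let ?\<xi> = "dilation s (sym_incl v * \<psi>)"
  let ?n = "sym_norm ?\<xi>" and ?C = "sqrt (1 / (1 - s\<^sup>2)) * norm v"
  have q: "s\<^sup>2 < 1" using s by (simp add: abs_square_less_1)
  have "complex_of_real (?n\<^sup>2) = complex_of_real s * sym_inner \<psi> (dilation s (annihilator v ?\<xi>))"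
    unfolding S.ip_self[symmetric]
    by (subst sym_inner_dilation) (simp add: sym_inner_incl_mult annihilator_dilation sym_inner_right)
  then have "?n\<^sup>2 = s * cmod (sym_inner \<psi> (dilation s (annihilator v ?\<xi>)))"
    using s by (metis abs_of_nonneg norm_mult norm_of_real zero_le_power2 less_imp_le)
  also have "\<dots> \<le> 1 * cmod (sym_inner \<psi> (dilation s (annihilator v ?\<xi>)))"
    using s by (intro mult_right_mono) auto
  also have "\<dots> \<le> sym_norm \<psi> * sym_norm (dilation s (annihilator v ?\<xi>))"
    using S.Cauchy_Schwarz by simp
  also have "\<dots> \<le> sym_norm \<psi> * (?C * ?n)"
    by (intro mult_left_mono dilated_annihilator_bound s) simp
  finally have *: "?n * ?n \<le> (?C * sym_norm \<psi>) * ?n" by (simp add: power2_eq_square mult_ac)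
  show ?thesis
  proof (cases "?n = 0")
    case True
    have "0 \<le> ?C * sym_norm \<psi>" using q by simp
    then show ?thesis unfolding True .
  next
    case False
    then have "0 < ?n" using S.nrm_ge_0 order_less_le by metis
    then show ?thesis using * by (rule mult_right_le_imp_le[rotated])
  qed
qed

section \<open>Creators and annihilators on dilatable functionals\<close>

lemma antilinear_symalg_unique:
  fixes F G :: "'v::complex_vector symalg \<Rightarrow> complex"
  assumes "antilinear F" "antilinear G" "\<And>vs. F (sym_prod vs) = G (sym_prod vs)"
  shows "F = G"
proof
  fix \<phi> show "F \<phi> = G \<phi>"
    by (induction \<phi> rule: symalg_induct) (use assms in \<open>auto simp: antilinear_lemmas\<close>)
qed

lemma antilinear_dual_creator: "antilinear \<Phi> \<Longrightarrow> antilinear (dual_creator v \<Phi>)"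
  by (simp add: antilinear_def dual_creator_def annihilator_linear)

lemma antilinear_dual_annihilator: "antilinear \<Phi> \<Longrightarrow> antilinear (dual_annihilator v \<Phi>)"
  by (simp add: antilinear_def dual_annihilator_def creator_def distrib_left scaleC_mult_right)

lemma antilinear_dilation: "antilinear \<Phi> \<Longrightarrow> antilinear (\<Phi> \<circ> dilation r)"
  by (simp add: antilinear_def dilation_linear)

lemma dual_creator_embed: "dual_creator v (dual_embed \<phi>) = dual_embed (sym_incl v * \<phi>)"
  by (simp add: dual_creator_def dual_embed_def sym_inner_annihilator)

lemma dual_annihilator_embed: "dual_annihilator v (dual_embed \<phi>) = dual_embed (annihilator v \<phi>)"
  by (simp add: dual_annihilator_def dual_embed_def creator_def sym_inner_incl_mult)

lemma dual_creator_add: "dual_creator v (\<Phi> + \<Psi>) = dual_creator v \<Phi> + dual_creator v \<Psi>"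
  by (simp add: dual_creator_def fun_eq_iff)

lemma dual_creator_diff: "dual_creator v (\<Phi> - \<Psi>) = dual_creator v \<Phi> - dual_creator v \<Psi>"
  by (simp add: dual_creator_def fun_eq_iff)

lemma dual_creator_scale: "dual_creator v (c *\<^sub>C \<Phi>) = c *\<^sub>C dual_creator v \<Phi>"
  by (simp add: dual_creator_def fun_eq_iff scaleC_fun_def)

lemma dual_annihilator_add: "dual_annihilator v (\<Phi> + \<Psi>) = dual_annihilator v \<Phi> + dual_annihilator v \<Psi>"
  by (simp add: dual_annihilator_def fun_eq_iff)

lemma dual_annihilator_diff: "dual_annihilator v (\<Phi> - \<Psi>) = dual_annihilator v \<Phi> - dual_annihilator v \<Psi>"
  by (simp add: dual_annihilator_def fun_eq_iff)

lemma dual_annihilator_scale: "dual_annihilator v (c *\<^sub>C \<Phi>) = c *\<^sub>C dual_annihilator v \<Phi>"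
  by (simp add: dual_annihilator_def fun_eq_iff scaleC_fun_def)

lemma dual_creator_add_vec:
  "antilinear \<Phi> \<Longrightarrow> dual_creator (v + w) \<Phi> = dual_creator v \<Phi> + dual_creator w \<Phi>"
  by (simp add: dual_creator_def fun_eq_iff annihilator_add_vec antilinear_lemmas)

lemma dual_creator_scale_vec:
  "antilinear \<Phi> \<Longrightarrow> dual_creator (c *\<^sub>C v) \<Phi> = c *\<^sub>C dual_creator v \<Phi>"
  by (simp add: dual_creator_def fun_eq_iff annihilator_scale_vec antilinear_lemmas scaleC_fun_def)

lemma dual_annihilator_add_vec:
  "antilinear \<Phi> \<Longrightarrow> dual_annihilator (v + w) \<Phi> = dual_annihilator v \<Phi> + dual_annihilator w \<Phi>"
  by (simp add: dual_annihilator_def creator_def fun_eq_iff sym_incl_add distrib_right antilinear_lemmas)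

lemma dual_annihilator_scale_vec:
  "antilinear \<Phi> \<Longrightarrow> dual_annihilator (c *\<^sub>C v) \<Phi> = cnj c *\<^sub>C dual_annihilator v \<Phi>"
  by (simp add: dual_annihilator_def creator_def fun_eq_iff sym_incl_scale scaleC_mult_left antilinear_lemmas scaleC_fun_def)

lemma dual_creator_commute: "dual_creator v (dual_creator w \<Phi>) = dual_creator w (dual_creator v \<Phi>)"
proof -
  have "annihilator w (annihilator v \<psi>) = annihilator v (annihilator w \<psi>)" for \<psi>
  proof (induction \<psi> rule: symalg_induct)
    case (prod vs)
    show ?case by (induction vs) (simp_all add: annihilator_incl_mult annihilator_linear add_ac)
  qed (simp_all add: annihilator_linear)
  then show ?thesis by (simp add: dual_creator_def)
qed

lemma dual_annihilator_commute: "dual_annihilator v (dual_annihilator w \<Phi>) = dual_annihilator w (dual_annihilator v \<Phi>)"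
  by (simp add: dual_annihilator_def creator_def mult.left_commute)

lemma dual_CCR:
  assumes "antilinear \<Phi>"
  shows "dual_annihilator v (dual_creator w \<Phi>) = dual_creator w (dual_annihilator v \<Phi>) + cinner v w *\<^sub>C \<Phi>"
proof
  fix \<psi>
  have "cnj (cinner w v) = cinner v w" by (metis cinner_commute)
  then show "dual_annihilator v (dual_creator w \<Phi>) \<psi> = (dual_creator w (dual_annihilator v \<Phi>) + cinner v w *\<^sub>C \<Phi>) \<psi>"
    by (simp add: dual_annihilator_def dual_creator_def creator_def annihilator_incl_mult
      antilinear_lemmas[OF assms] scaleC_fun_def add.commute)
qed

text \<open>
  On these functionals the unbounded ladder operators can be treated like bounded ones. The number
  \<open>r\<close> is not fixed, because every application of a ladder operator uses up a part of it.
\<close>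

definition dilatable :: "('v::complex_hilbert symalg \<Rightarrow> complex) \<Rightarrow> bool"
  where "dilatable \<Phi> \<longleftrightarrow> antilinear \<Phi> \<and> (\<exists>r>1. \<exists>L. S.bound_by (\<Phi> \<circ> dilation r) L)"

lemma dilation_inverse: "r > 1 \<Longrightarrow> dilation r (dilation (1 / r) \<psi>) = \<psi>"
  by (simp add: dilation_dilation)

lemma bound_by_dilation:
  fixes \<Phi> :: "'v::complex_hilbert symalg \<Rightarrow> complex"
  assumes "S.bound_by (\<Phi> \<circ> dilation r) L" "1 \<le> r'" "r' \<le> r"
  shows "S.bound_by (\<Phi> \<circ> dilation r') L"
  unfolding S.bound_by_def
proof (intro conjI allI)
  show L: "0 \<le> L" using assms by (simp add: S.bound_by_def)
  fix \<psi> :: "'v symalg"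
  have "dilation r' \<psi> = dilation r (dilation (r' / r) \<psi>)" using assms by (simp add: dilation_dilation)
  then have "cmod ((\<Phi> \<circ> dilation r') \<psi>) = cmod ((\<Phi> \<circ> dilation r) (dilation (r' / r) \<psi>))" by simp
  also have "\<dots> \<le> L * sym_norm (dilation (r' / r) \<psi>)" using assms(1) unfolding S.bound_by_def by blast
  also have "\<dots> \<le> L * sym_norm \<psi>"
    using assms L by (intro mult_left_mono dilation_contraction) auto
  finally show "cmod ((\<Phi> \<circ> dilation r') \<psi>) \<le> L * sym_norm \<psi>" .
qed

lemma bound_by_undilated:
  assumes "r > 1" "S.bound_by (\<Phi> \<circ> dilation r) L"
  shows "S.bound_by \<Phi> L"
  using bound_by_dilation[OF assms(2), of 1] assms(1) by (simp add: o_def)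

lemma dilatable_antilinear: "dilatable \<Phi> \<Longrightarrow> antilinear \<Phi>"
  by (simp add: dilatable_def)

lemma dilatable_antidual: "dilatable \<Phi> \<Longrightarrow> \<Phi> \<in> S.antidual"
  unfolding dilatable_def using bound_by_undilated S.antidualI by blast

text \<open>
  The constant of the bounds for dilated ladder operators, at \<open>s = 1 / r\<close>.
\<close>

definition ladder_const :: "real \<Rightarrow> real"
  where "ladder_const r = sqrt (1 / (1 - (1 / r)\<^sup>2))"

text \<open>
  Write \<open>\<Phi>\<close> as \<open>(\<Phi> \<circ> dilation r) \<circ> dilation (1 / r)\<close>: the inner dilation makes the ladder operator bounded.
\<close>

lemma ladder_bound:
  assumes r: "r > 1" and L: "S.bound_by (\<Phi> \<circ> dilation r) L"
  shows "S.bound_by (dual_creator v \<Phi>) (ladder_const r * norm v * L)"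
    and "S.bound_by (dual_annihilator v \<Phi>) (ladder_const r * norm v * L)"
proof -
  have s: "0 < 1 / r" "1 / r < 1" using r by auto
  have L0: "0 \<le> L" and Lb: "\<And>\<psi>. cmod (\<Phi> (dilation r \<psi>)) \<le> L * sym_norm \<psi>"
    using L by (auto simp: S.bound_by_def)
  have "(1 / r)\<^sup>2 < 1" using s unfolding abs_square_less_1 by simp
  then have K0: "0 \<le> ladder_const r * norm v * L" using L0 by (simp add: ladder_const_def)
  have *: "cmod (\<Phi> \<theta>) \<le> ladder_const r * norm v * L * sym_norm \<psi>"
    if "sym_norm (dilation (1 / r) \<theta>) \<le> ladder_const r * norm v * sym_norm \<psi>" for \<theta> \<psi>
  proof -
    have "cmod (\<Phi> \<theta>) \<le> L * sym_norm (dilation (1 / r) \<theta>)"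
      using Lb[of "dilation (1 / r) \<theta>"] by (simp add: dilation_inverse[OF r])
    also have "\<dots> \<le> L * (ladder_const r * norm v * sym_norm \<psi>)"
      using that L0 by (rule mult_left_mono)
    finally show ?thesis by (simp add: mult_ac)
  qed
  show "S.bound_by (dual_creator v \<Phi>) (ladder_const r * norm v * L)"
    unfolding S.bound_by_def dual_creator_def
    using K0 dilated_annihilator_bound[OF s] * by (auto simp: ladder_const_def)
  show "S.bound_by (dual_annihilator v \<Phi>) (ladder_const r * norm v * L)"
    unfolding S.bound_by_def dual_annihilator_def creator_def
    using K0 dilated_creator_bound[OF s] * by (auto simp: ladder_const_def)
qed

text \<open>
  A dilation by \<open>r\<close> is spent in two halves: one dilation by \<open>\<surd>r\<close> makes the ladder operator bounded, and
  the other one remains.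
\<close>

lemma dilatable_ladder:
  assumes "dilatable \<Phi>"
  shows "dilatable (dual_creator v \<Phi>)" "dilatable (dual_annihilator v \<Phi>)"
proof -
  have \<Phi>: "antilinear \<Phi>" by (rule dilatable_antilinear[OF assms])
  obtain r L where r: "r > 1" and L: "S.bound_by (\<Phi> \<circ> dilation r) L"
    using assms by (auto simp: dilatable_def)
  define s where "s = sqrt r"
  have s: "s > 1" "s * s = r" using r by (auto simp: s_def)
  have "(\<Phi> \<circ> dilation s) \<circ> dilation s = \<Phi> \<circ> dilation r"
    by (simp add: fun_eq_iff dilation_dilation s(2))
  then have b: "S.bound_by ((\<Phi> \<circ> dilation s) \<circ> dilation s) L" using L by simp
  have "dual_creator v \<Phi> \<circ> dilation s = complex_of_real s *\<^sub>C dual_creator v (\<Phi> \<circ> dilation s)"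
    by (simp add: fun_eq_iff dual_creator_def annihilator_dilation antilinear_lemmas[OF \<Phi>] scaleC_fun_def)
  then have "\<exists>L. S.bound_by (dual_creator v \<Phi> \<circ> dilation s) L"
    using S.bound_by_scale[OF ladder_bound(1)[OF s(1) b]] by metis
  then show "dilatable (dual_creator v \<Phi>)"
    unfolding dilatable_def using antilinear_dual_creator[OF \<Phi>] s(1) by blast
  have "dual_annihilator v \<Phi> \<circ> dilation s = complex_of_real (1 / s) *\<^sub>C dual_annihilator v (\<Phi> \<circ> dilation s)"
    using s by (simp add: fun_eq_iff dual_annihilator_def creator_def dilation_incl_mult antilinear_lemmas[OF \<Phi>] scaleC_apply scaleC_complex_def)
  then have "\<exists>L. S.bound_by (dual_annihilator v \<Phi> \<circ> dilation s) L"
    using S.bound_by_scale[OF ladder_bound(2)[OF s(1) b]] by metis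
  then show "dilatable (dual_annihilator v \<Phi>)"
    unfolding dilatable_def using antilinear_dual_annihilator[OF \<Phi>] s(1) by blast
qed

lemma dilatable_add:
  assumes "dilatable \<Phi>" "dilatable \<Psi>"
  shows "dilatable (\<Phi> + \<Psi>)"
proof -
  obtain r L r' L' where r: "r > 1" "S.bound_by (\<Phi> \<circ> dilation r) L" "r' > 1" "S.bound_by (\<Psi> \<circ> dilation r') L'"
    using assms unfolding dilatable_def by blast
  have "S.bound_by (\<Phi> \<circ> dilation (min r r')) L" "S.bound_by (\<Psi> \<circ> dilation (min r r')) L'"
    using r by (auto intro!: bound_by_dilation[OF r(2)] bound_by_dilation[OF r(4)])
  from S.bound_by_add[OF this] have "S.bound_by ((\<Phi> + \<Psi>) \<circ> dilation (min r r')) (L + L')"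
    by (simp add: plus_fun_def o_def)
  moreover have "min r r' > 1" using r by simp
  ultimately show ?thesis using assms antilinear_add_fun unfolding dilatable_def by blast
qed

lemma dilatable_scale:
  assumes "dilatable \<Phi>"
  shows "dilatable (c *\<^sub>C \<Phi>)"
proof -
  obtain r L where r: "r > 1" "S.bound_by (\<Phi> \<circ> dilation r) L"
    using assms unfolding dilatable_def by blast
  from S.bound_by_scale[OF this(2)] have "S.bound_by ((c *\<^sub>C \<Phi>) \<circ> dilation r) (cmod c * L)"
    by (simp add: scaleC_fun_def o_def)
  then show ?thesis using assms antilinear_scale_fun r(1) unfolding dilatable_def by blast
qed

text \<open>
  Approximating the dilated functional and undoing the dilation gives a convergence for which the
  ladder operators are continuous.
\<close>

lemma dilatable_approx:
  assumes "dilatable \<Phi>"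
  obtains \<phi> where "S.tends (\<lambda>n. dual_embed (\<phi> n)) \<Phi>"
    "\<And>v. S.tends (\<lambda>n. dual_embed (sym_incl v * \<phi> n)) (dual_creator v \<Phi>)"
    "\<And>v. S.tends (\<lambda>n. dual_embed (annihilator v (\<phi> n))) (dual_annihilator v \<Phi>)"
proof -
  have \<Phi>: "antilinear \<Phi>" by (rule dilatable_antilinear[OF assms])
  obtain r L where r: "r > 1" and L: "S.bound_by (\<Phi> \<circ> dilation r) L"
    using assms by (auto simp: dilatable_def)
  let ?\<Phi>r = "\<Phi> \<circ> dilation r"
  have \<Phi>r: "?\<Phi>r \<in> S.antidual" using L by (rule S.antidualI[OF antilinear_dilation[OF \<Phi>]])
  define \<phi> where "\<phi> n = dilation (1 / r) (S.approx ?\<Phi>r n)" for n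
  define \<epsilon> where "\<epsilon> n = S.dnorm (dual_embed (S.approx ?\<Phi>r n) - ?\<Phi>r)" for n
  have \<epsilon>: "\<epsilon> \<longlonglongrightarrow> 0" using S.tends_approx[OF \<Phi>r] unfolding S.tends_def \<epsilon>_def .
  have eq: "(dual_embed (\<phi> n) - \<Phi>) \<circ> dilation r = dual_embed (S.approx ?\<Phi>r n) - ?\<Phi>r" for n
    by (simp add: fun_eq_iff dual_embed_def \<phi>_def sym_inner_dilation dilation_inverse[OF r])
  have b: "S.bound_by ((dual_embed (\<phi> n) - \<Phi>) \<circ> dilation r) (\<epsilon> n)" for n
    unfolding eq \<epsilon>_def by (intro S.bound_by_dnorm S.antidual_diff S.emb_antidual \<Phi>r)
  have *: "S.tends F G" if "\<And>n. F n \<in> S.antidual" "G \<in> S.antidual" "\<And>n. S.bound_by (F n - G) (K * \<epsilon> n)" for F G K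
    unfolding S.tends_def
  proof (rule tendsto_0_bound)
    show "(\<lambda>n. K * \<epsilon> n) \<longlonglongrightarrow> 0" using tendsto_mult_left[OF \<epsilon>, of K] by simp
    show "norm (S.dnorm (F n - G)) \<le> K * \<epsilon> n" for n
      using S.dnorm_le[OF that(3)] S.dnorm_ge_0[OF S.antidual_diff[OF that(1,2)]] by simp
  qed
  show ?thesis
  proof (rule that)
    show "S.tends (\<lambda>n. dual_embed (\<phi> n)) \<Phi>"
      by (rule *[of _ _ 1]) (use bound_by_undilated[OF r b] in \<open>auto intro: S.emb_antidual dilatable_antidual assms\<close>)
    show "S.tends (\<lambda>n. dual_embed (sym_incl v * \<phi> n)) (dual_creator v \<Phi>)" for v
      by (rule *[of _ _ "ladder_const r * norm v"])
        (use ladder_bound(1)[OF r b] in \<open>auto intro: S.emb_antidual dilatable_antidual dilatable_ladder assms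
          simp: dual_creator_diff dual_creator_embed\<close>)
    show "S.tends (\<lambda>n. dual_embed (annihilator v (\<phi> n))) (dual_annihilator v \<Phi>)" for v
      by (rule *[of _ _ "ladder_const r * norm v"])
        (use ladder_bound(2)[OF r b] in \<open>auto intro: S.emb_antidual dilatable_antidual dilatable_ladder assms
          simp: dual_annihilator_diff dual_annihilator_embed\<close>)
  qed
qed

text \<open>
  Along an approximating sequence of \<open>\<Phi>\<close> both sides are limits of \<open>\<Psi> (v \<phi>\<^sub>n)\<close>.
\<close>

lemma dip_creator:
  assumes \<Phi>: "dilatable \<Phi>" and \<Psi>: "dilatable \<Psi>"
  shows "S.dip (dual_creator v \<Phi>) \<Psi> = S.dip \<Phi> (dual_annihilator v \<Psi>)"
proof -
  obtain \<phi> where \<phi>: "S.tends (\<lambda>n. dual_embed (\<phi> n)) \<Phi>"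
    "S.tends (\<lambda>n. dual_embed (sym_incl v * \<phi> n)) (dual_creator v \<Phi>)"
    using dilatable_approx[OF \<Phi>] by metis
  note d = dilatable_antidual[OF \<Phi>] dilatable_antidual[OF \<Psi>]
    dilatable_antidual[OF dilatable_ladder(1)[OF \<Phi>]] dilatable_antidual[OF dilatable_ladder(2)[OF \<Psi>]]
  have "(\<lambda>n. \<Psi> (sym_incl v * \<phi> n)) \<longlonglongrightarrow> S.dip (dual_creator v \<Phi>) \<Psi>"
    by (rule S.dip_limit[OF d(3,2) \<phi>(2)])
  moreover have "(\<lambda>n. \<Psi> (sym_incl v * \<phi> n)) \<longlonglongrightarrow> S.dip \<Phi> (dual_annihilator v \<Psi>)"
    using S.dip_limit[OF d(1,4) \<phi>(1)] by (simp add: dual_annihilator_def creator_def)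
  ultimately show ?thesis by (rule LIMSEQ_unique)
qed

lemma dip_annihilator:
  assumes "dilatable \<Phi>" "dilatable \<Psi>"
  shows "S.dip (dual_annihilator v \<Phi>) \<Psi> = S.dip \<Phi> (dual_creator v \<Psi>)"
  using dip_creator[OF assms(2,1), of v] assms
  by (metis S.dip_commute dilatable_antidual dilatable_ladder)

section \<open>The product of the dual and the Gaussian\<close>

lemma sym_coproduct_spec:
  "calgebra_hom (sym_coproduct :: 'v::complex_vector symalg \<Rightarrow> _) \<and>
   (\<forall>v::'v. sym_coproduct (sym_incl v) = sym_incl v \<otimes>\<^sub>T 1 + 1 \<otimes>\<^sub>T sym_incl v)"
  unfolding sym_coproduct_def by (rule theI'[OF sym_coproduct_ex1])

lemma sym_coproduct_simps:
  fixes x y :: "'v::complex_vector symalg"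
  shows "sym_coproduct (x + y) = sym_coproduct x + sym_coproduct y"
  "sym_coproduct (c *\<^sub>C x) = c *\<^sub>C sym_coproduct x"
  "sym_coproduct (1 :: 'v symalg) = 1 \<otimes>\<^sub>T 1"
  "sym_coproduct (sym_incl v * x) = (sym_incl v \<otimes>\<^sub>T 1 + 1 \<otimes>\<^sub>T sym_incl v) * sym_coproduct x"
  using sym_coproduct_spec[where 'v = 'v] by (simp_all add: calgebra_hom_def clinear_def tensor_one)

lemma dual_tensor_spec:
  assumes "antilinear \<Phi>" "antilinear \<Psi>"
  shows "antilinear (dual_tensor \<Phi> \<Psi>)" "dual_tensor \<Phi> \<Psi> (\<xi> \<otimes>\<^sub>T \<eta>) = \<Phi> \<xi> * \<Psi> \<eta>"
  using theI'[OF dual_tensor_ex1[OF assms]] unfolding dual_tensor_def by auto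

lemma antilinear_dual_times:
  assumes "antilinear \<Phi>" "antilinear \<Psi>"
  shows "antilinear (dual_times \<Phi> \<Psi>)"
  using antilinear_lemmas[OF dual_tensor_spec(1)[OF assms]]
  by (simp add: antilinear_def dual_times_def sym_coproduct_simps)

lemma dual_times_one:
  assumes "antilinear \<Phi>" "antilinear \<Psi>"
  shows "dual_times \<Phi> \<Psi> 1 = \<Phi> 1 * \<Psi> 1"
  by (simp add: dual_times_def sym_coproduct_simps dual_tensor_spec(2)[OF assms])

text \<open>
  As \<open>\<Delta>(v) = v \<otimes> 1 + 1 \<otimes> v\<close>, annihilators are derivations of the product of the dual. Together with
  the value at \<open>1\<close> this determines the product, so that all its properties below are proved by
  induction on the number of factors of the argument, for all functionals at once.
\<close>

lemma dual_times_incl_mult: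
  assumes "antilinear \<Phi>" "antilinear \<Psi>"
  shows "dual_times \<Phi> \<Psi> (sym_incl v * \<theta>) =
    dual_times (dual_annihilator v \<Phi>) \<Psi> \<theta> + dual_times \<Phi> (dual_annihilator v \<Psi>) \<theta>"
proof -
  note T = dual_tensor_spec[OF assms]
    dual_tensor_spec[OF antilinear_dual_annihilator[OF assms(1), of v] assms(2)]
    dual_tensor_spec[OF assms(1) antilinear_dual_annihilator[OF assms(2), of v]]
  have *: "dual_tensor \<Phi> \<Psi> ((sym_incl v \<otimes>\<^sub>T 1 + 1 \<otimes>\<^sub>T sym_incl v) * x) =
      dual_tensor (dual_annihilator v \<Phi>) \<Psi> x + dual_tensor \<Phi> (dual_annihilator v \<Psi>) x" for x
  proof (induction x rule: tensor_induct)
    case (pure a b)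
    show ?case
      by (simp add: distrib_right tensor_mult antilinear_lemmas[OF T(1)] T(2,4,6))
        (simp add: dual_annihilator_def creator_def)
  qed (simp_all add: distrib_left scaleC_mult_right antilinear_lemmas[OF T(1)] antilinear_lemmas[OF T(3)]
      antilinear_lemmas[OF T(5)] scaleC_complex_def)
  show ?thesis by (simp add: dual_times_def sym_coproduct_simps *)
qed

lemma dual_times_zero_left:
  fixes \<Psi> :: "'v::complex_hilbert symalg \<Rightarrow> complex"
  assumes "antilinear \<Psi>"
  shows "dual_times 0 \<Psi> = 0"
proof (rule antilinear_symalg_unique)
  have z: "antilinear (0 :: 'v symalg \<Rightarrow> complex)" by (simp add: antilinear_def)
  then show "antilinear (dual_times 0 \<Psi>)" using assms by (rule antilinear_dual_times)
  show "dual_times 0 \<Psi> (sym_prod vs) = 0 (sym_prod vs)" for vs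
    using assms
  proof (induction vs arbitrary: \<Psi>)
    case (Cons v vs)
    have "dual_annihilator v 0 = 0" by (simp add: dual_annihilator_def fun_eq_iff)
    then show ?case
      unfolding sym_prod_Cons dual_times_incl_mult[OF z Cons.prems] \<open>dual_annihilator v 0 = 0\<close>
        Cons.IH[OF Cons.prems] Cons.IH[OF antilinear_dual_annihilator[OF Cons.prems, of v]] by simp
  qed (simp add: dual_times_one z)
qed (simp add: antilinear_def)

lemma dual_times_scale_left:
  fixes \<Phi> :: "'v::complex_hilbert symalg \<Rightarrow> complex"
  assumes "antilinear \<Phi>" "antilinear \<Psi>"
  shows "dual_times (c *\<^sub>C \<Phi>) \<Psi> = c *\<^sub>C dual_times \<Phi> \<Psi>"
proof (rule antilinear_symalg_unique)
  show "antilinear (dual_times (c *\<^sub>C \<Phi>) \<Psi>)" "antilinear (c *\<^sub>C dual_times \<Phi> \<Psi>)"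
    using assms by (auto intro!: antilinear_dual_times antilinear_scale_fun)
  show "dual_times (c *\<^sub>C \<Phi>) \<Psi> (sym_prod vs) = (c *\<^sub>C dual_times \<Phi> \<Psi>) (sym_prod vs)" for vs
    using assms
  proof (induction vs arbitrary: \<Phi> \<Psi>)
    case Nil
    then show ?case by (simp only: sym_prod_Nil dual_times_one antilinear_scale_fun) (simp only: scaleC_apply dual_times_one mult_ac)
  next
    case (Cons v vs)
    note a = antilinear_dual_annihilator[OF Cons.prems(1), of v] antilinear_dual_annihilator[OF Cons.prems(2), of v]
    show ?case
      unfolding sym_prod_Cons dual_times_incl_mult[OF antilinear_scale_fun[OF Cons.prems(1)] Cons.prems(2)]
        dual_annihilator_scale Cons.IH[OF a(1) Cons.prems(2)] Cons.IH[OF Cons.prems(1) a(2)]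
      by (simp add: scaleC_apply dual_times_incl_mult[OF Cons.prems] distrib_left)
  qed
qed

lemma dual_times_add_right:
  fixes \<Phi> :: "'v::complex_hilbert symalg \<Rightarrow> complex"
  assumes "antilinear \<Phi>" "antilinear \<Psi>" "antilinear \<Theta>"
  shows "dual_times \<Phi> (\<Psi> + \<Theta>) = dual_times \<Phi> \<Psi> + dual_times \<Phi> \<Theta>"
proof (rule antilinear_symalg_unique)
  show "antilinear (dual_times \<Phi> (\<Psi> + \<Theta>))" "antilinear (dual_times \<Phi> \<Psi> + dual_times \<Phi> \<Theta>)"
    using assms by (auto intro!: antilinear_dual_times antilinear_add_fun)
  show "dual_times \<Phi> (\<Psi> + \<Theta>) (sym_prod vs) = (dual_times \<Phi> \<Psi> + dual_times \<Phi> \<Theta>) (sym_prod vs)" for vs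
    using assms
  proof (induction vs arbitrary: \<Phi> \<Psi> \<Theta>)
    case Nil
    then show ?case by (simp only: sym_prod_Nil dual_times_one antilinear_add_fun) (simp only: plus_fun_apply dual_times_one distrib_left)
  next
    case (Cons v vs)
    note a = Cons.prems[THEN antilinear_dual_annihilator, of v]
    show ?case
      unfolding sym_prod_Cons dual_times_incl_mult[OF Cons.prems(1) antilinear_add_fun[OF Cons.prems(2,3)]]
        dual_annihilator_add Cons.IH[OF a(1) Cons.prems(2,3)] Cons.IH[OF Cons.prems(1) a(2,3)]
      by (simp add: dual_times_incl_mult[OF Cons.prems(1,2)] dual_times_incl_mult[OF Cons.prems(1,3)])
  qed
qed

lemma dual_times_scale_right:
  fixes \<Phi> :: "'v::complex_hilbert symalg \<Rightarrow> complex"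
  assumes "antilinear \<Phi>" "antilinear \<Psi>"
  shows "dual_times \<Phi> (c *\<^sub>C \<Psi>) = c *\<^sub>C dual_times \<Phi> \<Psi>"
proof (rule antilinear_symalg_unique)
  show "antilinear (dual_times \<Phi> (c *\<^sub>C \<Psi>))" "antilinear (c *\<^sub>C dual_times \<Phi> \<Psi>)"
    using assms by (auto intro!: antilinear_dual_times antilinear_scale_fun)
  show "dual_times \<Phi> (c *\<^sub>C \<Psi>) (sym_prod vs) = (c *\<^sub>C dual_times \<Phi> \<Psi>) (sym_prod vs)" for vs
    using assms
  proof (induction vs arbitrary: \<Phi> \<Psi>)
    case Nil
    then show ?case by (simp only: sym_prod_Nil dual_times_one antilinear_scale_fun) (simp only: scaleC_apply dual_times_one mult_ac)
  next
    case (Cons v vs)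
    note a = antilinear_dual_annihilator[OF Cons.prems(1), of v] antilinear_dual_annihilator[OF Cons.prems(2), of v]
    show ?case
      unfolding sym_prod_Cons dual_times_incl_mult[OF Cons.prems(1) antilinear_scale_fun[OF Cons.prems(2)]]
        dual_annihilator_scale Cons.IH[OF a(1) Cons.prems(2)] Cons.IH[OF Cons.prems(1) a(2)]
      by (simp add: scaleC_apply dual_times_incl_mult[OF Cons.prems] distrib_left)
  qed
qed

lemma antilinear_dual_embed: "antilinear (dual_embed \<phi>)"
  by (rule S.antilinear_emb)

lemma dual_times_one_left:
  assumes "antilinear \<Psi>"
  shows "dual_times (dual_embed 1) \<Psi> = \<Psi>"
proof (rule antilinear_symalg_unique)
  show "antilinear (dual_times (dual_embed 1) \<Psi>)" using assms by (intro antilinear_dual_times antilinear_dual_embed)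
  show "dual_times (dual_embed 1) \<Psi> (sym_prod vs) = \<Psi> (sym_prod vs)" for vs
    using assms
  proof (induction vs arbitrary: \<Psi>)
    case Nil
    then show ?case by (simp add: dual_times_one antilinear_dual_embed) (simp add: dual_embed_def)
  next
    case (Cons v vs)
    have "dual_annihilator v (dual_embed 1) = 0"
      by (simp add: dual_annihilator_embed) (simp add: dual_embed_def fun_eq_iff sym_inner_right)
    then show ?case using Cons antilinear_dual_annihilator[OF Cons.prems, of v]
      by (simp add: dual_times_incl_mult antilinear_dual_embed dual_times_zero_left)
        (simp add: dual_annihilator_def creator_def)
  qed
qed fact

lemma dual_times_incl:
  assumes "antilinear \<Psi>"
  shows "dual_times (dual_embed (sym_incl w)) \<Psi> = dual_creator w \<Psi>"
proof (rule antilinear_symalg_unique)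
  show "antilinear (dual_times (dual_embed (sym_incl w)) \<Psi>)" "antilinear (dual_creator w \<Psi>)"
    using assms by (auto intro!: antilinear_dual_times antilinear_dual_embed antilinear_dual_creator)
  show "dual_times (dual_embed (sym_incl w)) \<Psi> (sym_prod vs) = dual_creator w \<Psi> (sym_prod vs)" for vs
    using assms
  proof (induction vs arbitrary: \<Psi>)
    case Nil
    have "dual_embed (sym_incl w) 1 = 0"
      using sym_inner_annihilator[of w 1 1] by (simp add: dual_embed_def sym_inner_left)
    then show ?case using Nil
      by (simp add: dual_times_one antilinear_dual_embed dual_creator_def antilinear_lemmas)
  next
    case (Cons v vs)
    have "annihilator v (sym_incl w) = cinner v w *\<^sub>C 1"
      using annihilator_incl_mult[of v w 1] by simp
    then have "dual_annihilator v (dual_embed (sym_incl w)) = cinner v w *\<^sub>C dual_embed 1"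
      by (simp add: dual_annihilator_embed S.emb_scale)
    then show ?case using Cons.IH[OF antilinear_dual_annihilator[OF Cons.prems, of v]] Cons.prems
      using fun_cong[OF dual_CCR[OF Cons.prems, of v w], of "sym_prod vs"]
      by (simp add: dual_times_incl_mult antilinear_dual_embed dual_times_scale_left dual_times_one_left)
        (simp add: dual_annihilator_def creator_def)
  qed
qed

text \<open>
  In the induction step an annihilator is moved past the creator; the commutator matches the term
  that the Leibniz rule produces on the other side.
\<close>

lemma dual_times_creator:
  assumes "antilinear \<Phi>" "antilinear \<Psi>"
  shows "dual_times \<Phi> (dual_creator w \<Psi>) = dual_creator w (dual_times \<Phi> \<Psi>)"
proof (rule antilinear_symalg_unique)
  show "antilinear (dual_times \<Phi> (dual_creator w \<Psi>))" "antilinear (dual_creator w (dual_times \<Phi> \<Psi>))"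
    using assms by (auto intro!: antilinear_dual_times antilinear_dual_creator)
  show "dual_times \<Phi> (dual_creator w \<Psi>) (sym_prod vs) = dual_creator w (dual_times \<Phi> \<Psi>) (sym_prod vs)" for vs
    using assms
  proof (induction vs arbitrary: \<Phi> \<Psi>)
    case Nil
    then show ?case
      by (simp add: dual_times_one antilinear_dual_creator)
        (simp add: dual_creator_def antilinear_lemmas antilinear_dual_times)
  next
    case (Cons v vs)
    note a = antilinear_dual_annihilator[OF Cons.prems(1), of v] antilinear_dual_annihilator[OF Cons.prems(2), of v]
    have "dual_times \<Phi> (dual_creator w \<Psi>) (sym_prod (v # vs)) =
        dual_times (dual_annihilator v \<Phi>) (dual_creator w \<Psi>) (sym_prod vs) +
        dual_times \<Phi> (dual_creator w (dual_annihilator v \<Psi>) + cinner v w *\<^sub>C \<Psi>) (sym_prod vs)"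
      using Cons.prems by (simp add: dual_times_incl_mult antilinear_dual_creator dual_CCR)
    also have "\<dots> = dual_times (dual_annihilator v \<Phi>) \<Psi> (annihilator w (sym_prod vs)) +
        dual_times \<Phi> (dual_annihilator v \<Psi>) (annihilator w (sym_prod vs)) + cinner v w * dual_times \<Phi> \<Psi> (sym_prod vs)"
      using Cons.IH[OF a(1) Cons.prems(2)] Cons.IH[OF Cons.prems(1) a(2)] Cons.prems a
      by (simp add: dual_times_add_right dual_times_scale_right antilinear_dual_creator antilinear_scale_fun)
        (simp add: dual_creator_def scaleC_apply)
    also have "\<dots> = dual_annihilator v (dual_creator w (dual_times \<Phi> \<Psi>)) (sym_prod vs)"
      unfolding dual_CCR[OF antilinear_dual_times[OF Cons.prems]]
      using Cons.prems by (simp add: dual_creator_def dual_annihilator_def creator_def dual_times_incl_mult scaleC_apply)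
    finally show ?case by (simp add: dual_annihilator_def creator_def)
  qed
qed

text \<open>
  The symmetry of \<open>Z\<close> is what makes \<open>\<langle>y|Zx\<rangle>\<close> a function of the multiset \<open>{x, y}\<close>.
\<close>

lemma zeta_ex1:
  fixes Z :: "'v::complex_hilbert \<Rightarrow> 'v"
  assumes Z: "antilinear Z" and sym: "\<And>x y. cinner y (Z x) = cinner x (Z y)"
  shows "\<exists>!\<zeta>. antilinear \<zeta> \<and> (\<forall>d. d \<noteq> 2 \<longrightarrow> (\<forall>\<psi>\<in>sym_pow d UNIV. \<zeta> \<psi> = 0)) \<and>
    (\<forall>x y. \<zeta> (sym_incl x * sym_incl y) = cinner y (Z x))"
proof (rule ex_ex1I)
  define l :: "'v multiset \<Rightarrow> 'v list" where "l m = (SOME xs. mset xs = m)" for m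
  have l: "mset (l m) = m" for m unfolding l_def using ex_mset[of m] by (rule someI_ex)
  define h where "h m = (if size m = 2 then cnj (cinner (l m ! 1) (Z (l m ! 0))) else 0)" for m
  have h2: "h {#x, y#} = cnj (cinner y (Z x))" for x y
  proof -
    have "length (l {#x, y#}) = 2" using arg_cong[OF l[of "{#x, y#}"], of size] by simp
    then obtain a b where ab: "l {#x, y#} = [a, b]" by (auto simp: length_Suc_conv numeral_2_eq_2)
    then have "{#a, b#} = {#x, y#}" using l[of "{#x, y#}"] by simp
    then have "a = x \<and> b = y \<or> a = y \<and> b = x" by (auto simp: add_eq_conv_diff)
    then show ?thesis using sym by (auto simp: h_def ab)
  qed
  have h0: "h m = 0" if "size m \<noteq> 2" for m using that by (simp add: h_def)
  have "\<exists>F. clinear F \<and> (\<forall>p. F (abs_symalg p) = lin_ext h p)"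
  proof (rule symalg_linear_lift)
    fix x y :: 'v and m c
    have "h (add_mset (x + y) m) = h (add_mset x m) + h (add_mset y m) \<and>
        h (add_mset (c *\<^sub>C x) m) = c *\<^sub>C h (add_mset x m)"
    proof (cases "size m = 1")
      case True
      then obtain z where "m = {#z#}" using size_1_singleton_mset by blast
      then show ?thesis
        by (simp add: h2 antilinear_lemmas[OF Z] cinner_add_right cinner_scaleC_right scaleC_complex_def)
    qed (simp add: h0 scaleC_complex_def)
    then show "h (add_mset (x + y) m) = h (add_mset x m) + h (add_mset y m)"
      "h (add_mset (c *\<^sub>C x) m) = c *\<^sub>C h (add_mset x m)" by auto
  qed
  then obtain F where F: "clinear F" "\<And>p. F (abs_symalg p) = lin_ext h p" by blast
  have Fp: "F (sym_prod vs) = h (mset vs)" for vs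
    using F(2)[of "Poly_Mapping.single (mset vs) 1"] by (simp add: abs_symalg_single sym_prod_mset)
  have "F \<psi> = 0" if "d \<noteq> 2" "\<psi> \<in> sym_pow d UNIV" for d \<psi>
    using that(2) by (induction rule: sym_pow_induct) (use that(1) in \<open>auto simp: Fp h0 clinear_lemmas[OF F(1)]\<close>)
  moreover have "F (sym_incl x * sym_incl y) = cnj (cinner y (Z x))" for x y
    using Fp[of "[x, y]"] by (simp add: h2)
  moreover have "antilinear (\<lambda>\<psi>. cnj (F \<psi>))"
    by (simp add: antilinear_def clinear_lemmas[OF F(1)] scaleC_complex_def)
  ultimately show "\<exists>\<zeta>. antilinear \<zeta> \<and> (\<forall>d. d \<noteq> 2 \<longrightarrow> (\<forall>\<psi>\<in>sym_pow d UNIV. \<zeta> \<psi> = 0)) \<and>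
      (\<forall>x y. \<zeta> (sym_incl x * sym_incl y) = cinner y (Z x))"
    by (intro exI[of _ "\<lambda>\<psi>. cnj (F \<psi>)"]) auto
next
  fix \<zeta> \<zeta>' :: "'v symalg \<Rightarrow> complex"
  assume *: "antilinear \<zeta> \<and> (\<forall>d. d \<noteq> 2 \<longrightarrow> (\<forall>\<psi>\<in>sym_pow d UNIV. \<zeta> \<psi> = 0)) \<and>
      (\<forall>x y. \<zeta> (sym_incl x * sym_incl y) = cinner y (Z x))"
    "antilinear \<zeta>' \<and> (\<forall>d. d \<noteq> 2 \<longrightarrow> (\<forall>\<psi>\<in>sym_pow d UNIV. \<zeta>' \<psi> = 0)) \<and>
      (\<forall>x y. \<zeta>' (sym_incl x * sym_incl y) = cinner y (Z x))"
  show "\<zeta> = \<zeta>'"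
  proof (rule antilinear_symalg_unique)
    fix vs :: "'v list"
    show "\<zeta> (sym_prod vs) = \<zeta>' (sym_prod vs)"
    proof (cases "length vs = 2")
      case True
      then obtain x y where "vs = [x, y]" by (auto simp: length_Suc_conv numeral_2_eq_2)
      then show ?thesis using * by simp
    next
      case False
      then show ?thesis using * sym_prod_in_sym_pow[of vs UNIV] by simp
    qed
  qed (use * in auto)
qed

locale symmetric_kernel =
  fixes g :: "'v::complex_hilbert \<Rightarrow> 'v"
  assumes Z_antilinear: "antilinear (Z_op g)"
    and Z_symmetric: "cinner y (Z_op g x) = cinner x (Z_op g y)"
begin

lemma zeta_spec:
  "antilinear (zeta g)" "d \<noteq> 2 \<Longrightarrow> \<psi> \<in> sym_pow d UNIV \<Longrightarrow> zeta g \<psi> = 0"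
  "zeta g (sym_incl x * sym_incl y) = cinner y (Z_op g x)"
  using theI'[OF zeta_ex1[OF Z_antilinear Z_symmetric]] unfolding zeta_def by auto

lemma zeta_one: "zeta g 1 = 0"
  using zeta_spec(2)[of 0 1] sym_prod_in_sym_pow[of "[]" UNIV] by simp

lemma annihilator_zeta: "dual_annihilator v (zeta g) = dual_embed (sym_incl (Z_op g v))"
proof (rule antilinear_symalg_unique)
  show "antilinear (dual_annihilator v (zeta g))" by (intro antilinear_dual_annihilator zeta_spec)
  show "antilinear (dual_embed (sym_incl (Z_op g v)))" by (rule antilinear_dual_embed)
  fix vs :: "'v list"
  have incl: "sym_incl (Z_op g v) = sym_prod [Z_op g v]" by simp
  show "dual_annihilator v (zeta g) (sym_prod vs) = dual_embed (sym_incl (Z_op g v)) (sym_prod vs)"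
  proof (cases "length vs = 1")
    case True
    then obtain w where w: "vs = [w]" by (auto simp: length_Suc_conv)
    have "sym_inner (sym_incl w * 1) (sym_incl (Z_op g v) * 1) = cinner w (Z_op g v)"
      unfolding sym_inner_incl_mult annihilator_incl_mult by (simp add: sym_inner_right)
    then show ?thesis by (simp add: w dual_annihilator_def creator_def dual_embed_def zeta_spec(3))
  next
    case False
    have "sym_prod (v # vs) \<in> sym_pow (length (v # vs)) UNIV" by (rule sym_prod_in_sym_pow) simp
    then have "zeta g (sym_prod (v # vs)) = 0" using False by (intro zeta_spec(2)) auto
    moreover have "sym_inner (sym_prod vs) (sym_prod [Z_op g v]) = 0"
      unfolding sym_inner_sym_prod using False by (simp add: permanent_def)
    ultimately show ?thesis by (simp add: dual_annihilator_def creator_def dual_embed_def)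
  qed
qed

lemma antilinear_zeta_power: "antilinear (dual_power (zeta g) n)"
  by (induction n) (simp_all add: antilinear_dual_embed antilinear_dual_times zeta_spec)

text \<open>
  The power rule for the derivation \<open>a(v)\<close>, where \<open>a(v)\<zeta> = Zv\<close>.
\<close>

lemma annihilator_zeta_power:
  "dual_annihilator v (dual_power (zeta g) (Suc n)) =
    of_nat (Suc n) *\<^sub>C dual_creator (Z_op g v) (dual_power (zeta g) n)"
proof (induction n)
  case (Suc n)
  let ?p = "dual_power (zeta g)"
  have "dual_annihilator v (dual_times (zeta g) (?p (Suc n))) =
      dual_times (dual_annihilator v (zeta g)) (?p (Suc n)) + dual_times (zeta g) (dual_annihilator v (?p (Suc n)))"
    by (rule ext, simp only: dual_annihilator_def creator_def dual_times_incl_mult[OF zeta_spec(1) antilinear_zeta_power]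
        plus_fun_apply)
  also have "dual_times (dual_annihilator v (zeta g)) (?p (Suc n)) = dual_creator (Z_op g v) (?p (Suc n))"
    unfolding annihilator_zeta by (rule dual_times_incl[OF antilinear_zeta_power])
  also have "dual_times (zeta g) (dual_annihilator v (?p (Suc n))) =
      of_nat (Suc n) *\<^sub>C dual_creator (Z_op g v) (?p (Suc n))"
    unfolding Suc dual_times_scale_right[OF zeta_spec(1) antilinear_dual_creator[OF antilinear_zeta_power]]
      dual_times_creator[OF zeta_spec(1) antilinear_zeta_power] by simp
  also have "dual_creator (Z_op g v) (?p (Suc n)) + of_nat (Suc n) *\<^sub>C dual_creator (Z_op g v) (?p (Suc n)) =
      of_nat (Suc (Suc n)) *\<^sub>C dual_creator (Z_op g v) (?p (Suc n))"
    by (simp only: of_nat_Suc[of "Suc n"] scaleC_add_left scaleC_one)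
  finally show ?case by (simp only: dual_power.simps)
next
  case 0
  have "dual_annihilator v (dual_times (zeta g) (dual_embed 1)) =
      dual_times (dual_annihilator v (zeta g)) (dual_embed 1) + dual_times (zeta g) (dual_annihilator v (dual_embed 1))"
    by (rule ext, simp only: dual_annihilator_def creator_def dual_times_incl_mult[OF zeta_spec(1) antilinear_dual_embed]
        plus_fun_apply)
  moreover have "dual_annihilator v (dual_embed 1) = 0 *\<^sub>C dual_embed 1"
    by (simp only: dual_annihilator_embed annihilator_one) (simp add: dual_embed_def fun_eq_iff sym_inner_right)
  ultimately show ?case
    by (simp only: annihilator_zeta dual_times_incl[OF antilinear_dual_embed] dual_power.simps
        dual_times_scale_right[OF zeta_spec(1) antilinear_dual_embed]) simp
qed

lemma zeta_power_one: "dual_power (zeta g) n 1 = (if n = 0 then 1 else 0)"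
proof (cases n)
  case 0 then show ?thesis by (simp add: dual_embed_def)
next
  case (Suc m)
  then show ?thesis by (simp add: dual_times_one[OF zeta_spec(1) antilinear_zeta_power] zeta_one)
qed

text \<open>
  Hence the exponential series has only finitely many nonzero terms at every argument.
\<close>

lemma zeta_power_degree: "\<psi> \<in> sym_pow d UNIV \<Longrightarrow> d \<noteq> 2 * n \<Longrightarrow> dual_power (zeta g) n \<psi> = 0"
proof (induction n arbitrary: d \<psi>)
  case 0
  have "1 \<in> sym_pow 0 (UNIV :: 'v set)" using sym_prod_in_sym_pow[of "[]" UNIV] by simp
  then show ?case using 0 sym_pow_orthogonal[of \<psi> d UNIV 1 0 UNIV] by (simp add: dual_embed_def)
next
  case (Suc n)
  note lin = antilinear_lemmas[OF antilinear_zeta_power]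
  show ?case using Suc.prems(1)
  proof (induction rule: sym_pow_induct)
    case (prod vs)
    show ?case
    proof (cases vs)
      case Nil
      then show ?thesis using zeta_power_one[of "Suc n"] by simp
    next
      case (Cons v ws)
      have "dual_power (zeta g) (Suc n) (sym_prod vs) = dual_annihilator v (dual_power (zeta g) (Suc n)) (sym_prod ws)"
        by (simp add: Cons dual_annihilator_def creator_def)
      also have "\<dots> = of_nat (Suc n) * dual_power (zeta g) n (annihilator (Z_op g v) (sym_prod ws))"
        unfolding annihilator_zeta_power scaleC_apply by (simp add: dual_creator_def)
      also have "dual_power (zeta g) n (annihilator (Z_op g v) (sym_prod ws)) = 0"
      proof (cases ws)
        case Nil then show ?thesis by (simp add: lin)
      next
        case (Cons w us)
        have "sym_prod ws \<in> sym_pow (Suc (length us)) UNIV"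
          using sym_prod_in_sym_pow[of ws UNIV] Cons by simp
        then have "annihilator (Z_op g v) (sym_prod ws) \<in> sym_pow (length us) UNIV" by (rule annihilator_sym_pow)
        moreover have "length us \<noteq> 2 * n" using Suc.prems(2) prod(1) \<open>vs = v # ws\<close> Cons by simp
        ultimately show ?thesis by (rule Suc.IH)
      qed
      finally show ?thesis by simp
    qed
  qed (simp_all add: lin[of "Suc n"] del: dual_power.simps)
qed

lemma exp_Z_sums: "(\<lambda>n. dual_power (zeta g) n \<psi> / fact n) sums exp_Z g \<psi>"
proof -
  obtain B D f where f: "\<And>d. f d \<in> sym_pow d (cspan B)" and \<psi>: "\<psi> = (\<Sum>d<(D::nat). f d)"
    using symalg_decomposition[of \<psi>] by blast
  have "dual_power (zeta g) n \<psi> = 0" if "D \<le> n" for n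
    unfolding \<psi> antilinear_sum[OF antilinear_zeta_power]
  proof (intro sum.neutral ballI)
    fix d assume "d \<in> {..<D}"
    then have "d \<noteq> 2 * n" using that by auto
    then show "dual_power (zeta g) n (f d) = 0" using f[of d] sym_pow_mono[of "cspan B" UNIV d]
      by (intro zeta_power_degree[of _ d]) auto
  qed
  then have "(\<lambda>n. dual_power (zeta g) n \<psi> / fact n) sums (\<Sum>n<D. dual_power (zeta g) n \<psi> / fact n)"
    by (intro sums_finite) auto
  then show ?thesis unfolding exp_Z_def by (simp add: sums_iff)
qed

lemma antilinear_exp_Z: "antilinear (exp_Z g)"
  unfolding antilinear_def
proof (intro conjI allI)
  note lin = antilinear_lemmas[OF antilinear_zeta_power]
  fix x y c
  show "exp_Z g (x + y) = exp_Z g x + exp_Z g y"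
    using sums_add[OF exp_Z_sums[of x] exp_Z_sums[of y]] exp_Z_sums[of "x + y"]
    by (simp add: lin add_divide_distrib sums_unique2)
  show "exp_Z g (c *\<^sub>C x) = cnj c *\<^sub>C exp_Z g x"
    using sums_mult[OF exp_Z_sums[of x], of "cnj c"] exp_Z_sums[of "c *\<^sub>C x"]
    by (simp add: lin scaleC_complex_def sums_unique2)
qed

lemma exp_Z_one: "exp_Z g 1 = 1"
proof -
  have "(\<lambda>n. dual_power (zeta g) n 1 / fact n) = (\<lambda>n. if n = 0 then 1 else 0)"
    by (auto simp: zeta_power_one)
  then show ?thesis using exp_Z_sums[of 1] sums_single[of 0 "\<lambda>n. 1 :: complex"] by (simp add: sums_unique2)
qed

text \<open>
  The differential equation of the Gaussian. It turns a value in degree \<open>d\<close> into one in degree \<open>d - 2\<close>,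
  so together with \<open>e\<^sup>Z(1) = 1\<close> it determines \<open>e\<^sup>Z\<close> among the antilinear functionals.
\<close>

lemma annihilator_exp_Z: "dual_annihilator v (exp_Z g) = dual_creator (Z_op g v) (exp_Z g)"
proof
  fix \<psi>
  let ?p = "dual_power (zeta g)"
  have 0: "?p 0 (sym_incl v * \<psi>) = 0" by (simp add: dual_embed_def sym_inner_incl_mult sym_inner_right)
  have S: "?p (Suc n) (sym_incl v * \<psi>) / fact (Suc n) = ?p n (annihilator (Z_op g v) \<psi>) / fact n" for n
  proof -
    have "?p (Suc n) (sym_incl v * \<psi>) = of_nat (Suc n) * ?p n (annihilator (Z_op g v) \<psi>)"
      using fun_cong[OF annihilator_zeta_power, of v n \<psi>]
      by (simp only: dual_annihilator_def creator_def scaleC_apply dual_creator_def)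
    then show ?thesis by (simp add: field_simps del: dual_power.simps of_nat_Suc)
  qed
  have "(\<lambda>n. ?p (Suc n) (sym_incl v * \<psi>) / fact (Suc n)) sums exp_Z g (annihilator (Z_op g v) \<psi>)"
    unfolding S by (rule exp_Z_sums)
  then have "(\<lambda>n. ?p n (sym_incl v * \<psi>) / fact n) sums exp_Z g (annihilator (Z_op g v) \<psi>)"
    using sums_Suc[of "\<lambda>n. ?p n (sym_incl v * \<psi>) / fact n"] unfolding 0 by simp
  then show "dual_annihilator v (exp_Z g) \<psi> = dual_creator (Z_op g v) (exp_Z g) \<psi>"
    using exp_Z_sums[of "sym_incl v * \<psi>"]
    by (simp only: dual_annihilator_def creator_def dual_creator_def) (rule sums_unique2)
qed

end

section \<open>The Gaussian estimate\<close>

lemma sym_norm_incl_mult: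
  "(sym_norm (sym_incl w * \<psi>))\<^sup>2 = (norm w)\<^sup>2 * (sym_norm \<psi>)\<^sup>2 + (sym_norm (annihilator w \<psi>))\<^sup>2"
proof -
  have "sym_inner (sym_incl w * \<psi>) (sym_incl w * \<psi>) =
      cinner w w * sym_inner \<psi> \<psi> + sym_inner (annihilator w \<psi>) (annihilator w \<psi>)"
    by (simp add: sym_inner_incl_mult annihilator_incl_mult sym_inner_right sym_inner_annihilator)
  then have "complex_of_real ((sym_norm (sym_incl w * \<psi>))\<^sup>2) =
      complex_of_real ((norm w)\<^sup>2 * (sym_norm \<psi>)\<^sup>2 + (sym_norm (annihilator w \<psi>))\<^sup>2)"
    by (simp only: S.ip_self V.ip_self of_real_add of_real_mult)
  then show ?thesis by (simp only: of_real_eq_iff)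
qed

text \<open>
  The solution of \<open>(d + 2) \<beta>\<^bsub>d+2\<^esub> = (h + t d) \<beta>\<^sub>d\<close> in the even degrees \<open>d = 2 n\<close> with \<open>\<beta>\<^sub>0 = 1\<close>.
\<close>

definition gaussian_coeff :: "real \<Rightarrow> real \<Rightarrow> nat \<Rightarrow> real"
  where "gaussian_coeff h t n = (\<Prod>k<n. (h + 2 * t * real k) / (2 * real k + 2))"

lemma gaussian_coeff_nonneg: "0 \<le> h \<Longrightarrow> 0 \<le> t \<Longrightarrow> 0 \<le> gaussian_coeff h t n"
  unfolding gaussian_coeff_def by (intro prod_nonneg) auto

text \<open>
  The quotients of consecutive terms tend to \<open>t\<close>, hence are eventually below \<open>(1 + t) / 2 < 1\<close>.
\<close>

lemma summable_gaussian_coeff: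
  assumes h: "0 \<le> h" and t: "0 \<le> t" "t < 1"
  shows "summable (gaussian_coeff h t)"
proof (rule summable_ratio_test)
  show "(1 + t) / 2 < 1" using t by simp
  fix n assume n: "n \<ge> nat \<lceil>h / (1 - t)\<rceil>"
  then have "h / (1 - t) \<le> real n" by linarith
  then have "h \<le> (1 - t) * real n" using t by (simp add: field_simps)
  then have "h + 2 * t * real n \<le> (1 + t) * (real n + 1)" using t by (simp add: algebra_simps)
  then have "(h + 2 * t * real n) / (2 * real n + 2) \<le> (1 + t) / 2" by (simp add: field_simps)
  then have "gaussian_coeff h t n * ((h + 2 * t * real n) / (2 * real n + 2)) \<le> gaussian_coeff h t n * ((1 + t) / 2)"
    using gaussian_coeff_nonneg[OF h t(1)] by (rule mult_left_mono)
  then show "norm (gaussian_coeff h t (Suc n)) \<le> (1 + t) / 2 * norm (gaussian_coeff h t n)"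
    using gaussian_coeff_nonneg[OF h t(1)] gaussian_coeff_nonneg[OF h t(1), of "Suc n"]
    by (simp add: mult.commute) (simp add: gaussian_coeff_def mult.commute)
qed

text \<open>
  Let \<open>F\<^sub>d \<in> S\<^sup>d M\<close> be the components of \<open>\<Phi>\<close> over \<open>M = cspan B\<close>, and let \<open>P\<close> be the projection to \<open>M\<close>. The
  differential equation says \<open>a(e) F\<^bsub>d+2\<^esub> = P(Ze) F\<^sub>d\<close>. Summing squares over \<open>e \<in> B\<close>, the left-hand side
  is \<open>(d + 2) \<parallel>F\<^bsub>d+2\<^esub>\<parallel>\<^sup>2\<close> by the number operator. On the right,
  \<open>\<parallel>P(Ze) F\<^sub>d\<parallel>\<^sup>2 = \<parallel>P(Ze)\<parallel>\<^sup>2 \<parallel>F\<^sub>d\<parallel>\<^sup>2 + \<parallel>a(Ze) F\<^sub>d\<parallel>\<^sup>2\<close>. The first summands are controlled by the Hilbert-Schmidt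
  bound \<open>h\<close>. In the second ones, \<open>Z\<close> acts as a contraction on the tuple of the \<open>a(f) F\<^sub>d\<close>, whose squares
  sum up to \<open>d \<parallel>F\<^sub>d\<parallel>\<^sup>2\<close>.
\<close>

lemma gaussian_recursion:
  fixes \<Phi> :: "'v::complex_hilbert symalg \<Rightarrow> complex"
  assumes \<Phi>: "antilinear \<Phi>" and rec: "\<And>v \<psi>. \<Phi> (sym_incl v * \<psi>) = \<Phi> (annihilator (Z v) \<psi>)"
    and Z: "antilinear Z" and sym: "\<And>x y. cinner y (Z x) = cinner x (Z y)"
    and Zt: "\<And>v. (norm (Z v))\<^sup>2 \<le> t * (norm v)\<^sup>2" and Zh: "(\<Sum>e\<in>B. (norm (Z e))\<^sup>2) \<le> h"
    and B: "V.orthonormal B"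
  defines "\<beta> \<equiv> \<lambda>d. (sym_norm (fock_component \<Phi> (cspan B) d))\<^sup>2"
  shows "real (d + 2) * \<beta> (d + 2) \<le> (h + t * real d) * \<beta> d" and "\<beta> 1 = 0" and "\<beta> 0 \<le> (cmod (\<Phi> 1))\<^sup>2"
proof -
  let ?M = "cspan B"
  let ?F = "fock_component \<Phi> ?M"
  have fin: "finite B" by (rule V.orthonormal_finite[OF B])
  note F = fock_component[OF \<Phi> fin]
  \<comment> \<open>the orthogonal projection to \<open>M\<close>; it brings \<open>Ze\<close>, which need not lie in \<open>M\<close>, back to \<open>M\<close>\<close>
  define P where "P w = (\<Sum>f\<in>B. cinner f w *\<^sub>C f)" for w
  have P: "P w \<in> ?M" for w unfolding P_def by (rule V.sum_in_cspan[OF fin])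
  have annP: "annihilator (P w) \<psi> = annihilator w \<psi>" if "\<psi> \<in> sym_pow d ?M" for w \<psi> d
  proof -
    have "cnj (cinner f w) = cinner w f" for f by (rule cinner_commute[symmetric])
    then show ?thesis
      unfolding annihilator_expand[OF B that, of w] P_def by (simp add: annihilator_sum_vec annihilator_scale_vec)
  qed
  have nP: "(norm (P w))\<^sup>2 \<le> (norm w)\<^sup>2" for w
    unfolding P_def V.orthonormal_nrm_sum[OF B] by (rule V.Bessel[OF B])
  have up: "sym_incl e * \<psi> \<in> sym_pow (Suc d) ?M" if "e \<in> ?M" "\<psi> \<in> sym_pow d ?M" for e \<psi> d
    using sym_pow_incl_mult[of e ?M] that by (simp add: complex_vector.span_span)
  have Bm: "e \<in> ?M" if "e \<in> B" for e using that by (rule complex_vector.span_base)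
  have zero: "\<delta> = 0" if "\<delta> \<in> sym_pow d ?M" "\<And>\<psi>. \<psi> \<in> sym_pow d ?M \<Longrightarrow> sym_inner \<psi> \<delta> = 0" for \<delta> d
    using S.ip_definite[of \<delta>] that by simp
  have annF: "annihilator e (?F (Suc (Suc d))) = sym_incl (P (Z e)) * ?F d" if e: "e \<in> B" for e d
  proof -
    let ?\<delta> = "annihilator e (?F (Suc (Suc d))) - sym_incl (P (Z e)) * ?F d"
    have "?\<delta> \<in> sym_pow (Suc d) ?M"
      by (intro sym_pow_diff annihilator_sym_pow up P F(1))
    moreover have "sym_inner \<psi> ?\<delta> = 0" if \<psi>: "\<psi> \<in> sym_pow (Suc d) ?M" for \<psi>
    proof -
      have "sym_inner \<psi> (annihilator e (?F (Suc (Suc d)))) = \<Phi> (sym_incl e * \<psi>)"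
        using F(2)[OF up[OF Bm[OF e] \<psi>]] by (simp add: sym_inner_incl_mult)
      also have "\<dots> = \<Phi> (annihilator (P (Z e)) \<psi>)" by (simp add: rec annP[OF \<psi>])
      also have "\<dots> = sym_inner \<psi> (sym_incl (P (Z e)) * ?F d)"
        using F(2)[OF annihilator_sym_pow[OF \<psi>]] by (simp add: sym_inner_annihilator)
      finally show ?thesis by (simp add: sym_inner_right)
    qed
    ultimately have "?\<delta> = 0" by (rule zero)
    then show ?thesis by simp
  qed
  have "annihilator e (?F 1) = 0" if e: "e \<in> B" for e
  proof (rule zero)
    show "annihilator e (?F 1) \<in> sym_pow 0 ?M" using annihilator_sym_pow[of "?F 1" 0] F(1)[of 1] by simp
    fix \<psi> assume \<psi>: "\<psi> \<in> sym_pow 0 ?M"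
    have "sym_inner \<psi> (annihilator e (?F 1)) = \<Phi> (sym_incl e * \<psi>)"
      using F(2)[OF up[OF Bm[OF e] \<psi>]] by (simp add: sym_inner_incl_mult)
    then show "sym_inner \<psi> (annihilator e (?F 1)) = 0"
      by (simp add: rec annihilator_sym_pow_0[OF \<psi>] antilinear_lemmas[OF \<Phi>])
  qed
  then show "\<beta> 1 = 0" using sym_norm_number[OF B F(1), of 1] by (simp add: \<beta>_def)
  show "\<beta> 0 \<le> (cmod (\<Phi> 1))\<^sup>2"
  proof -
    obtain c where c: "?F 0 = c *\<^sub>C 1" using sym_pow_0[OF F(1)] by blast
    have "1 \<in> sym_pow 0 ?M" using sym_prod_in_sym_pow[of "[]" ?M] by simp
    from F(2)[OF this] have "\<Phi> 1 = c" by (simp add: c sym_inner_right)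
    then show ?thesis by (simp add: \<beta>_def c S.nrm_scale) (simp add: sym_norm_def)
  qed
  show "real (d + 2) * \<beta> (d + 2) \<le> (h + t * real d) * \<beta> d"
  proof -
    let ?G = "?F d"
    have "real (d + 2) * \<beta> (d + 2) = (\<Sum>e\<in>B. (sym_norm (sym_incl (P (Z e)) * ?G))\<^sup>2)"
      using sym_norm_number[OF B F(1), of "d + 2"] annF by (simp add: \<beta>_def)
    also have "\<dots> = (\<Sum>e\<in>B. (norm (P (Z e)))\<^sup>2) * \<beta> d + (\<Sum>e\<in>B. (sym_norm (annihilator (Z e) ?G))\<^sup>2)"
      by (simp add: sym_norm_incl_mult annP[OF F(1)] sum.distrib sum_distrib_right \<beta>_def)
    also have "\<dots> \<le> h * \<beta> d + t * (\<Sum>f\<in>B. (sym_norm (annihilator f ?G))\<^sup>2)"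
    proof (rule add_mono)
      have "(\<Sum>e\<in>B. (norm (P (Z e)))\<^sup>2) \<le> (\<Sum>e\<in>B. (norm (Z e))\<^sup>2)" by (intro sum_mono nP)
      then show "(\<Sum>e\<in>B. (norm (P (Z e)))\<^sup>2) * \<beta> d \<le> h * \<beta> d"
        using Zh by (intro mult_right_mono) (auto simp: \<beta>_def)
      have "(\<Sum>e\<in>B. (cmod (\<Sum>f\<in>B. cinner (Z e) f * c f))\<^sup>2) \<le> t * (\<Sum>f\<in>B. (cmod (c f))\<^sup>2)" for c
      proof -
        define x where "x = (\<Sum>f\<in>B. c f *\<^sub>C f)"
        have "(\<Sum>f\<in>B. cinner (Z e) f * c f) = cnj (cinner e (Z x))" for e
        proof -
          have "cinner (Z e) f = cnj (cinner e (Z f))" for f by (metis cinner_commute sym)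
          then show ?thesis
            by (simp add: x_def antilinear_sum[OF Z] antilinear_lemmas[OF Z] V.ip_sum_right V.ip_right mult.commute)
        qed
        then have "(\<Sum>e\<in>B. (cmod (\<Sum>f\<in>B. cinner (Z e) f * c f))\<^sup>2) = (\<Sum>e\<in>B. (cmod (cinner e (Z x)))\<^sup>2)" by simp
        also have "\<dots> \<le> (norm (Z x))\<^sup>2" by (rule V.Bessel[OF B])
        also have "\<dots> \<le> t * (norm x)\<^sup>2" by (rule Zt)
        also have "(norm x)\<^sup>2 = (\<Sum>f\<in>B. (cmod (c f))\<^sup>2)" unfolding x_def by (rule V.orthonormal_nrm_sum[OF B])
        finally show ?thesis .
      qed
      from S.contraction_vector_valued[OF fin this, of "\<lambda>f. annihilator f ?G"]
      show "(\<Sum>e\<in>B. (sym_norm (annihilator (Z e) ?G))\<^sup>2) \<le> t * (\<Sum>f\<in>B. (sym_norm (annihilator f ?G))\<^sup>2)"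
        by (simp flip: annihilator_expand[OF B F(1)])
    qed
    also have "(\<Sum>f\<in>B. (sym_norm (annihilator f ?G))\<^sup>2) = real d * \<beta> d"
      unfolding \<beta>_def by (rule sym_norm_number[OF B F(1), symmetric])
    finally show ?thesis by (simp add: algebra_simps)
  qed
qed

text \<open>
  The bound that results from the recursion depends on \<open>h\<close>, \<open>t\<close> and \<open>\<Phi>(1)\<close> only, hence is uniform in
  the finite-dimensional subspace.
\<close>

lemma gaussian_bounded:
  fixes \<Phi> :: "'v::complex_hilbert symalg \<Rightarrow> complex"
  assumes \<Phi>: "antilinear \<Phi>" and rec: "\<And>v \<psi>. \<Phi> (sym_incl v * \<psi>) = \<Phi> (annihilator (Z v) \<psi>)"
    and Z: "antilinear Z" and sym: "\<And>x y. cinner y (Z x) = cinner x (Z y)"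
    and Zt: "\<And>v. (norm (Z v))\<^sup>2 \<le> t * (norm v)\<^sup>2" and t: "0 \<le> t" "t < 1"
    and Zh: "\<And>B. V.orthonormal B \<Longrightarrow> (\<Sum>e\<in>B. (norm (Z e))\<^sup>2) \<le> h"
  shows "\<exists>K. S.bound_by \<Phi> K"
proof -
  have h: "0 \<le> h" using Zh[of "{}"] by (simp add: V.orthonormal_def)
  let ?\<gamma> = "gaussian_coeff h t"
  let ?c = "(cmod (\<Phi> 1))\<^sup>2"
  define K where "K = sqrt (?c * suminf ?\<gamma>)"
  note g0 = gaussian_coeff_nonneg[OF h t(1)] and gs = summable_gaussian_coeff[OF h t]
  have K2: "K\<^sup>2 = ?c * suminf ?\<gamma>" unfolding K_def using g0 gs by (simp add: suminf_nonneg)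
  have K0: "0 \<le> K" unfolding K_def using g0 gs by (simp add: suminf_nonneg)
  have "(\<Sum>d<D. (sym_norm (fock_component \<Phi> (cspan A) d))\<^sup>2) \<le> K\<^sup>2" if "finite A" for A D
  proof -
    obtain B where B: "V.orthonormal B" "cspan B = cspan A" using V.exists_orthonormal[OF \<open>finite A\<close>] .
    define \<beta> where "\<beta> d = (sym_norm (fock_component \<Phi> (cspan B) d))\<^sup>2" for d
    have \<beta>0: "0 \<le> \<beta> d" for d by (simp add: \<beta>_def)
    note gr = gaussian_recursion[OF \<Phi> rec Z sym Zt Zh[OF B(1)] B(1), folded \<beta>_def]
    have odd: "\<beta> (2 * n + 1) = 0" for n
    proof (induction n)
      case (Suc n)
      have "real (2 * n + 1 + 2) * \<beta> (2 * n + 1 + 2) \<le> 0" using gr(1)[of "2 * n + 1"] Suc by simp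
      then show ?case using \<beta>0[of "2 * n + 3"] by (simp add: mult_le_0_iff numeral_3_eq_3)
    qed (use gr(2) in simp)
    have even: "\<beta> (2 * n) \<le> ?c * ?\<gamma> n" for n
    proof (induction n)
      case 0 show ?case using gr(3) by (simp add: gaussian_coeff_def)
    next
      case (Suc n)
      let ?q = "(h + 2 * t * real n) / (2 * real n + 2)"
      have q: "0 \<le> ?q" using h t by simp
      have "(2 * real n + 2) * \<beta> (2 * n + 2) \<le> (h + 2 * t * real n) * \<beta> (2 * n)"
        using gr(1)[of "2 * n"] by (simp add: algebra_simps)
      then have "\<beta> (2 * n + 2) \<le> ?q * \<beta> (2 * n)" by (simp add: field_simps)
      also have "\<dots> \<le> ?q * (?c * ?\<gamma> n)" using Suc q by (rule mult_left_mono)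
      also have "\<dots> = ?c * ?\<gamma> (Suc n)" by (simp add: gaussian_coeff_def)
      finally show ?case by simp
    qed
    have "(\<Sum>d<D. \<beta> d) \<le> (\<Sum>d<2 * D. \<beta> d)" by (rule sum_mono2) (auto simp: \<beta>0)
    also have "\<dots> = (\<Sum>n<D. \<beta> (2 * n))" by (induction D) (use odd in auto)
    also have "\<dots> \<le> (\<Sum>n<D. ?c * ?\<gamma> n)" by (intro sum_mono even)
    also have "\<dots> = ?c * (\<Sum>n<D. ?\<gamma> n)" by (simp add: sum_distrib_left)
    also have "\<dots> \<le> ?c * suminf ?\<gamma>" using gs g0 by (intro mult_left_mono sum_le_suminf) auto
    finally show ?thesis unfolding K2 \<beta>_def B(2) .
  qed
  then have "fock_norm_ext \<Phi> \<le> ennreal K" unfolding fock_norm_ext_le_components[OF K0] by blast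
  then show ?thesis using fock_norm_ext_le_iff[OF \<Phi> K0] by blast
qed

text \<open>
  Dilating the functional by \<open>r\<close> replaces \<open>Z\<close> by \<open>r\<^sup>2 Z\<close>, and \<open>t\<close> by \<open>r\<^sup>4 t\<close>.
\<close>

lemma gaussian_dilatable:
  fixes \<Phi> :: "'v::complex_hilbert symalg \<Rightarrow> complex"
  assumes \<Phi>: "antilinear \<Phi>" and rec: "\<And>v \<psi>. \<Phi> (sym_incl v * \<psi>) = \<Phi> (annihilator (Z v) \<psi>)"
    and Z: "antilinear Z" and sym: "\<And>x y. cinner y (Z x) = cinner x (Z y)"
    and Zt: "\<And>v. (norm (Z v))\<^sup>2 \<le> t * (norm v)\<^sup>2" and t: "0 \<le> t" "t < 1"
    and Zh: "\<And>B. V.orthonormal B \<Longrightarrow> (\<Sum>e\<in>B. (norm (Z e))\<^sup>2) \<le> h"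
  shows "dilatable \<Phi>"
proof -
  \<comment> \<open>\<open>r\<^sup>4 t = (2 - t) t = 1 - (1 - t)\<^sup>2 < 1\<close>\<close>
  define r where "r = sqrt (sqrt (2 - t))"
  have r: "r > 1" "(r\<^sup>2)\<^sup>2 = 2 - t" using t by (auto simp: r_def)
  define Z' where "Z' v = complex_of_real (r\<^sup>2) *\<^sub>C Z v" for v
  have nZ': "(norm (Z' v))\<^sup>2 = (2 - t) * (norm (Z v))\<^sup>2" for v
    by (simp only: Z'_def V.nrm_scale norm_of_real power_mult_distrib power2_abs r(2))
  have "\<exists>K. S.bound_by (\<Phi> \<circ> dilation r) K"
  proof (rule gaussian_bounded)
    show "antilinear (\<Phi> \<circ> dilation r)" by (rule antilinear_dilation[OF \<Phi>])
    show "(\<Phi> \<circ> dilation r) (sym_incl v * \<psi>) = (\<Phi> \<circ> dilation r) (annihilator (Z' v) \<psi>)" for v \<psi>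
      by (simp add: dilation_incl_mult rec annihilator_dilation annihilator_scale_vec dilation_linear Z'_def
          antilinear_lemmas[OF \<Phi>] power2_eq_square scaleC_complex_def)
    show "antilinear Z'" unfolding antilinear_def Z'_def
      by (simp add: antilinear_lemmas[OF Z] scaleC_add_right mult.commute)
    show "cinner y (Z' x) = cinner x (Z' y)" for x y by (simp add: Z'_def cinner_scaleC_right sym)
    show "(norm (Z' v))\<^sup>2 \<le> ((2 - t) * t) * (norm v)\<^sup>2" for v
      using mult_left_mono[OF Zt[of v], of "2 - t"] t by (simp add: nZ' mult.assoc)
    show "0 \<le> (2 - t) * t" using t by simp
    have "0 < (1 - t)\<^sup>2" using t by simp
    then show "(2 - t) * t < 1" by (simp add: power2_eq_square algebra_simps)
    show "(\<Sum>e\<in>B. (norm (Z' e))\<^sup>2) \<le> (2 - t) * h" if "V.orthonormal B" for B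
      using mult_left_mono[OF Zh[OF that], of "2 - t"] t by (simp add: nZ' sum_distrib_left)
  qed
  then show ?thesis unfolding dilatable_def using \<Phi> r(1) by blast
qed

section \<open>Symplectic transformations\<close>

lemma scaleC_Re_Im: "c *\<^sub>C x = Re c *\<^sub>R x + Im c *\<^sub>R (\<i> *\<^sub>C (x :: 'a::complex_hilbert))"
proof -
  have "c *\<^sub>C x = (complex_of_real (Re c) + complex_of_real (Im c) * \<i>) *\<^sub>C x"
    by (metis complex_eq mult.commute)
  then show ?thesis by (simp only: scaleR_scaleC scaleC_add_left scaleC_scaleC)
qed

lemma clinear_if_linear:
  fixes f :: "'a::complex_hilbert \<Rightarrow> 'b::complex_hilbert"
  assumes "linear f" "\<And>x. f (\<i> *\<^sub>C x) = \<i> *\<^sub>C f x"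
  shows "clinear f"
  unfolding clinear_def
proof (intro conjI allI)
  show "f (x + y) = f x + f y" for x y using assms(1) by (rule linear_add)
  show "f (c *\<^sub>C x) = c *\<^sub>C f x" for c x
    by (subst (1 2) scaleC_Re_Im) (simp add: linear_add[OF assms(1)] linear_scale[OF assms(1)] assms(2))
qed

lemma antilinear_if_linear:
  fixes f :: "'a::complex_hilbert \<Rightarrow> 'b::complex_hilbert"
  assumes "linear f" "\<And>x. f (\<i> *\<^sub>C x) = - (\<i> *\<^sub>C f x)"
  shows "antilinear f"
  unfolding antilinear_def
proof (intro conjI allI)
  show "f (x + y) = f x + f y" for x y using assms(1) by (rule linear_add)
  show "f (c *\<^sub>C x) = cnj c *\<^sub>C f x" for c x
    by (subst (1 2) scaleC_Re_Im) (simp add: linear_add[OF assms(1)] linear_scale[OF assms(1)] assms(2))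
qed

lemma scaleR_scaleC_commute: "c *\<^sub>C r *\<^sub>R x = r *\<^sub>R c *\<^sub>C (x :: 'a::complex_hilbert)"
  by (simp add: scaleR_scaleC mult.commute)

lemma i_scaleC_i [simp]: "\<i> *\<^sub>C \<i> *\<^sub>C x = - (x :: 'a::complex_vector)"
  by (simp add: complex_vector.scale_minus_left)

lemma Re_cinner: "Re (cinner x y) = Im (cinner x (\<i> *\<^sub>C y))"
  by (simp add: cinner_scaleC_right)

locale symplectic =
  fixes g :: "'v::complex_hilbert \<Rightarrow> 'v"
  assumes Sp: "g \<in> Sp"
begin

lemma linear_g: "linear g" and bij_g: "bij g"
  and omega_g: "Im (cinner (g x) (g y)) = Im (cinner x y)"
  using Sp by (auto simp: Sp_def)

lemma g_inv [simp]: "g (inv g x) = x" "inv g (g x) = x" "inv (inv g) = g"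
  using bij_g by (simp_all add: bij_is_surj surj_f_inv_f bij_is_inj inv_inv_eq)

lemma inv_symplectic: "symplectic (inv g)"
proof
  have "inv g (x + y) = inv g x + inv g y" for x y
    by (metis g_inv(1,2) linear_add[OF linear_g])
  moreover have "inv g (r *\<^sub>R x) = r *\<^sub>R inv g x" for r x
    by (metis g_inv(1,2) linear_scale[OF linear_g])
  ultimately have "linear (inv g)" by (intro linearI)
  then show "inv g \<in> Sp" using bij_g omega_g[of "inv g _" "inv g _"]
    by (simp add: Sp_def bij_imp_bij_inv)
qed

lemmas g_simps = linear_add[OF linear_g] linear_scale[OF linear_g] linear_neg[OF linear_g]

lemma clinear_C: "clinear (C_part g)"
proof (rule clinear_if_linear)
  show "linear (C_part g)"
    by (rule linearI) (simp_all add: C_part_def g_simps scaleC_add_right scaleR_scaleC_commute algebra_simps)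
  show "C_part g (\<i> *\<^sub>C x) = \<i> *\<^sub>C C_part g x" for x
    by (simp add: C_part_def g_simps scaleR_scaleC_commute complex_vector.scale_right_diff_distrib)
qed

lemma antilinear_A: "antilinear (A_part g)"
proof (rule antilinear_if_linear)
  show "linear (A_part g)"
    by (rule linearI) (simp_all add: A_part_def g_simps scaleC_add_right scaleR_scaleC_commute algebra_simps)
  show "A_part g (\<i> *\<^sub>C x) = - (\<i> *\<^sub>C A_part g x)" for x
    by (simp add: A_part_def g_simps scaleR_scaleC_commute scaleC_add_right algebra_simps)
qed

lemmas C_simps = clinear_lemmas[OF clinear_C]
lemmas A_simps = antilinear_lemmas[OF antilinear_A]

lemma g_eq: "g x = C_part g x + A_part g x"
  by (simp add: C_part_def A_part_def flip: scaleR_add_right)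

lemma omega_i:
  "Im (cinner (g x) (g (\<i> *\<^sub>C y))) = Re (cinner x y)"
  "Im (cinner (g (\<i> *\<^sub>C x)) (g y)) = - Re (cinner x y)"
  "Im (cinner (g (\<i> *\<^sub>C x)) (g (\<i> *\<^sub>C y))) = Im (cinner x y)"
  by (simp_all add: omega_g cinner_scaleC_right cinner_scaleC_left)

lemmas expand_inner = C_part_def A_part_def scaleR_scaleC V.ip_left V.ip_right

text \<open>
  Expanding the left-hand side in terms of \<open>g\<close> leaves only imaginary parts of inner products, which
  \<open>g\<close> preserves. This and the next identity are the commutation relations of the operators \<open>c\<^sub>g\<close>, \<open>a\<^sub>g\<close>.
\<close>

lemma CA_inner: "cinner (C_part g v) (C_part g w) - cinner (A_part g w) (A_part g v) = cinner v w"
proof -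
  have "cinner (A_part g w) (A_part g v) = cnj (cinner (A_part g v) (A_part g w))" by (rule cinner_commute)
  then show ?thesis
    by (simp add: expand_inner complex_eq_iff omega_g omega_i algebra_simps)
qed

lemma CA_symmetric: "cinner (A_part g x) (C_part g y) = cinner (A_part g y) (C_part g x)"
proof -
  note c = cinner_commute[of "g y" "g x"] cinner_commute[of "g y" "g (\<i> *\<^sub>C x)"]
    cinner_commute[of "g (\<i> *\<^sub>C y)" "g x"] cinner_commute[of "g (\<i> *\<^sub>C y)" "g (\<i> *\<^sub>C x)"]
  show ?thesis
    by (simp add: expand_inner c complex_eq_iff omega_g omega_i algebra_simps)
qed

lemma omega_adjoint: "Im (cinner (g x) y) = Im (cinner x (inv g y))"
  using omega_g[of x "inv g y"] by simp

lemma Re_adjoint: "Re (cinner (g x) y) = Im (cinner x (inv g (\<i> *\<^sub>C y)))"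
  by (simp add: Re_cinner omega_adjoint)

text \<open>
  The symplectic form passes from \<open>g\<close> to its inverse, and the real part of an inner product is a
  value of the symplectic form as well.
\<close>

lemma C_adjoint: "cinner (C_part g x) y = cinner x (C_part (inv g) y)"
  by (simp add: expand_inner complex_eq_iff omega_adjoint Re_adjoint)

lemma A_adjoint: "cinner (A_part g x) y = - cinner (A_part (inv g) y) x"
proof -
  note c = cinner_commute[of "inv g _" x]
  show ?thesis
    by (simp add: expand_inner c complex_eq_iff omega_adjoint Re_adjoint diff_divide_distrib)
qed

lemma C_norm: "(norm (C_part g x))\<^sup>2 = (norm x)\<^sup>2 + (norm (A_part g x))\<^sup>2"
proof -
  have "complex_of_real ((norm (C_part g x))\<^sup>2) = complex_of_real ((norm x)\<^sup>2 + (norm (A_part g x))\<^sup>2)"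
    using CA_inner[of x x] by (simp only: V.ip_self of_real_add) (simp add: algebra_simps)
  then show ?thesis by (simp only: of_real_eq_iff)
qed

text \<open>
  The complex-linear and the antilinear part of \<open>g \<circ> g\<^sup>-\<^sup>1 = id\<close>, separated by comparing the values at
  \<open>v\<close> and \<open>\<i> v\<close>.
\<close>

lemma inverse_parts:
  "C_part g (C_part (inv g) v) + A_part g (A_part (inv g) v) = v"
  "C_part g (A_part (inv g) v) + A_part g (C_part (inv g) v) = 0"
proof -
  interpret I: symplectic "inv g" by (rule inv_symplectic)
  define F where "F v = C_part g (C_part (inv g) v) + A_part g (A_part (inv g) v)" for v
  define G where "G v = C_part g (A_part (inv g) v) + A_part g (C_part (inv g) v)" for v
  have FG: "F v + G v = v" for v
  proof -
    have "v = g (inv g v)" by simp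
    also have "\<dots> = g (C_part (inv g) v + A_part (inv g) v)" using I.g_eq[of v] by simp
    also have "\<dots> = F v + G v" by (simp add: g_eq C_simps A_simps F_def G_def algebra_simps)
    finally show ?thesis ..
  qed
  have "F (\<i> *\<^sub>C v) + G (\<i> *\<^sub>C v) = \<i> *\<^sub>C (F v - G v)"
    by (simp add: F_def G_def C_simps A_simps I.C_simps I.A_simps scaleC_add_right complex_vector.scale_right_diff_distrib
      complex_vector.scale_minus_left complex_vector.scale_minus_right)
  then have "\<i> *\<^sub>C v = \<i> *\<^sub>C (F v - G v)" by (simp add: FG)
  then have "F v - G v = v" by simp
  with FG[of v] have "2 *\<^sub>R G v = 0" by (simp add: scaleR_2) (metis add_diff_cancel_left' add_diff_eq diff_add_cancel diff_self)
  then have "G v = 0" by simp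
  then show "C_part g (C_part (inv g) v) + A_part g (A_part (inv g) v) = v"
    "C_part g (A_part (inv g) v) + A_part g (C_part (inv g) v) = 0"
    using FG[of v] by (simp_all add: F_def G_def)
qed

end

text \<open>
  The squared Hilbert-Schmidt norm is at most \<open>h\<close>, expressed without choosing a basis.
\<close>

definition hs_bound :: "('v::complex_hilbert \<Rightarrow> 'v) \<Rightarrow> real \<Rightarrow> bool"
  where "hs_bound f h \<longleftrightarrow> (\<forall>B. V.orthonormal B \<longrightarrow> (\<Sum>e\<in>B. (norm (f e))\<^sup>2) \<le> h)"

text \<open>
  The sum of all \<open>|\<langle>e|f' b\<rangle>|\<^sup>2\<close> for \<open>e \<in> E\<close> and \<open>b \<in> B\<close> can be taken in either order.
\<close>

lemma hs_bound_transpose: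
  fixes f f' :: "'v::complex_hilbert \<Rightarrow> 'v"
  assumes E: "orthonormal_basis E" and adj: "\<And>x y. cmod (cinner x (f' y)) = cmod (cinner y (f x))"
    and f: "\<And>F. finite F \<Longrightarrow> F \<subseteq> E \<Longrightarrow> (\<Sum>e\<in>F. (norm (f e))\<^sup>2) \<le> h"
  shows "hs_bound f' h"
  unfolding hs_bound_def
proof (intro allI impI)
  fix B :: "'v set" assume B: "V.orthonormal B"
  then have fin: "finite B" by (rule V.orthonormal_finite)
  show "(\<Sum>e\<in>B. (norm (f' e))\<^sup>2) \<le> h"
  proof (rule field_le_epsilon)
    fix \<epsilon> :: real assume \<epsilon>: "\<epsilon> > 0"
    \<comment> \<open>the total error \<open>card B * \<delta>\<close> stays below \<open>\<epsilon>\<close>, also for empty \<open>B\<close>\<close>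
    define \<delta> where "\<delta> = \<epsilon> / (real (card B) + 1)"
    have \<delta>: "\<delta> > 0" using \<epsilon> by (simp add: \<delta>_def)
    have on: "V.orthonormal F" if "finite F" "F \<subseteq> E" for F
      using E that unfolding orthonormal_basis_def V.orthonormal_def by blast
    have dense: "\<exists>u\<in>cspan E. norm (w - u) < r" if "r > 0" for w r
    proof -
      have "w \<in> closure (cspan E)" using E by (simp add: orthonormal_basis_def)
      then show ?thesis using that unfolding closure_approachable by (metis dist_norm norm_minus_commute)
    qed
    obtain F where F: "finite F" "F \<subseteq> E"
      "\<forall>w\<in>f' ` B. (norm w)\<^sup>2 \<le> (\<Sum>e\<in>F. (cmod (cinner e w))\<^sup>2) + \<delta>"
      using V.total_orthonormal_approx[OF on dense finite_imageI[OF fin] \<delta>] by blast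
    have "(\<Sum>b\<in>B. (norm (f' b))\<^sup>2) \<le> (\<Sum>b\<in>B. (\<Sum>e\<in>F. (cmod (cinner e (f' b)))\<^sup>2) + \<delta>)"
      using F(3) by (intro sum_mono) auto
    also have "\<dots> = (\<Sum>e\<in>F. \<Sum>b\<in>B. (cmod (cinner b (f e)))\<^sup>2) + real (card B) * \<delta>"
      by (simp add: adj sum.distrib sum.swap[of _ F B])
    also have "(\<Sum>e\<in>F. \<Sum>b\<in>B. (cmod (cinner b (f e)))\<^sup>2) \<le> (\<Sum>e\<in>F. (norm (f e))\<^sup>2)"
      by (intro sum_mono V.Bessel[OF B])
    also have "\<dots> \<le> h" by (rule f[OF F(1,2)])
    also have "real (card B) * \<delta> \<le> \<epsilon>" using \<epsilon> by (simp add: \<delta>_def field_simps)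
    finally show "(\<Sum>b\<in>B. (norm (f' b))\<^sup>2) \<le> h + \<epsilon>" by simp
  qed
qed

lemma hs_bound_unit:
  assumes "hs_bound f h" "linear f"
  shows "(norm (f x))\<^sup>2 \<le> h * (norm x)\<^sup>2"
proof (cases "x = 0")
  case False
  define e where "e = (1 / norm x) *\<^sub>R x"
  have "norm e = 1" using False by (simp add: e_def)
  then have "V.orthonormal {e}" by (simp add: V.orthonormal_def V.ip_self)
  then have "(norm (f e))\<^sup>2 \<le> h" using assms(1) unfolding hs_bound_def by fastforce
  moreover have "f e = (1 / norm x) *\<^sub>R f x" unfolding e_def by (rule linear_scale[OF assms(2)])
  ultimately show ?thesis using False by (simp add: power_mult_distrib power_divide field_simps)
qed (simp add: linear_0[OF assms(2)])

text \<open>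
  The bound is imposed on \<open>g\<close> and on its inverse, which makes the hypotheses symmetric: surjectivity
  will use the operators of the inverse.
\<close>

locale restricted_symplectic = symplectic g
  for g :: "'v::complex_hilbert \<Rightarrow> 'v" +
  fixes h :: real
  assumes hs_A: "hs_bound (A_part g) h" and hs_A': "hs_bound (A_part (inv g)) h"
begin

lemma inv_restricted_symplectic: "restricted_symplectic (inv g) h"
proof -
  interpret I: symplectic "inv g" by (rule inv_symplectic)
  show ?thesis by unfold_locales (simp_all add: hs_A hs_A')
qed

lemma h_ge_0: "0 \<le> h"
  using hs_A[unfolded hs_bound_def, rule_format, of "{}"] by (simp add: V.orthonormal_def)

lemma A_bound: "(norm (A_part g x))\<^sup>2 \<le> h * (norm x)\<^sup>2"
proof (rule hs_bound_unit[OF hs_A])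
  show "linear (A_part g)"
    by (rule linearI) (simp_all add: A_simps scaleR_scaleC)
qed

lemma C_bound: "(norm (C_part g x))\<^sup>2 \<le> (1 + h) * (norm x)\<^sup>2"
  using A_bound[of x] by (simp add: C_norm algebra_simps)

lemma C_expanding: "(norm x)\<^sup>2 \<le> (norm (C_part g x))\<^sup>2"
  by (simp add: C_norm)

text \<open>
  The adjoint of \<open>C\<close> is \<open>C_part (inv g)\<close>, and \<open>C C\<^sup>*\<close> is bounded by \<open>1 + h\<close> and at least \<open>1\<close>. So
  \<open>x \<mapsto> x - \<tau> (C C\<^sup>* x - y)\<close> is a contraction for \<open>\<tau> = 1 / (1 + h)\<close>, and its fixed point solves
  \<open>C C\<^sup>* x = y\<close>.
\<close>

lemma surj_C: "surj (C_part g)"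
  unfolding surj_def
proof
  fix y
  interpret I: restricted_symplectic "inv g" h by (rule inv_restricted_symplectic)
  define \<tau> where "\<tau> = 1 / (1 + h)"
  have \<tau>: "0 < \<tau>" "\<tau> \<le> 1" "\<tau> * (1 + h) = 1" using h_ge_0 by (auto simp: \<tau>_def)
  let ?K = "\<lambda>x. C_part g (C_part (inv g) x)"
  define T where "T x = x - \<tau> *\<^sub>R (?K x - y)" for x
  have contr: "(norm (x - \<tau> *\<^sub>R ?K x))\<^sup>2 \<le> (1 - \<tau>) * (norm x)\<^sup>2" for x
  proof -
    have "cinner (?K x) x = complex_of_real ((norm (C_part (inv g) x))\<^sup>2)"
      by (simp only: C_adjoint V.ip_self)
    then have "Re (cinner x (?K x)) = (norm (C_part (inv g) x))\<^sup>2"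
      using cinner_commute[of x "?K x"] by simp
    then have "Re (cinner x (- (\<tau> *\<^sub>R ?K x))) = - (\<tau> * (norm (C_part (inv g) x))\<^sup>2)"
      by (simp add: V.ip_right scaleR_scaleC)
    then have "(norm (x - \<tau> *\<^sub>R ?K x))\<^sup>2 =
        (norm x)\<^sup>2 + \<tau>\<^sup>2 * (norm (?K x))\<^sup>2 - 2 * \<tau> * (norm (C_part (inv g) x))\<^sup>2"
      using V.nrm_add_sq[of x "- (\<tau> *\<^sub>R ?K x)"] by (simp add: power_mult_distrib)
    also have "\<dots> \<le> (norm x)\<^sup>2 + \<tau>\<^sup>2 * ((1 + h) * (norm (C_part (inv g) x))\<^sup>2) - 2 * \<tau> * (norm (C_part (inv g) x))\<^sup>2"
      using C_bound by (intro diff_right_mono add_left_mono mult_left_mono) auto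
    also have "\<tau>\<^sup>2 * ((1 + h) * (norm (C_part (inv g) x))\<^sup>2) = \<tau> * (\<tau> * (1 + h)) * (norm (C_part (inv g) x))\<^sup>2"
      by (simp only: power2_eq_square mult_ac)
    also have "(norm x)\<^sup>2 + \<tau> * (\<tau> * (1 + h)) * (norm (C_part (inv g) x))\<^sup>2 - 2 * \<tau> * (norm (C_part (inv g) x))\<^sup>2 =
        (norm x)\<^sup>2 - \<tau> * (norm (C_part (inv g) x))\<^sup>2"
      unfolding \<tau>(3) by simp
    also have "\<dots> \<le> (norm x)\<^sup>2 - \<tau> * (norm x)\<^sup>2"
      using I.C_expanding \<tau> by (intro diff_left_mono mult_left_mono) auto
    finally show ?thesis by (simp add: algebra_simps)
  qed
  have lip: "dist (T x) (T x') \<le> sqrt (1 - \<tau>) * dist x x'" for x x'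
  proof -
    have "T x - T x' = (x - x') - \<tau> *\<^sub>R ?K (x - x')"
      by (simp add: T_def C_simps I.C_simps algebra_simps)
    then have "(dist (T x) (T x'))\<^sup>2 \<le> (sqrt (1 - \<tau>) * dist x x')\<^sup>2"
      using contr[of "x - x'"] \<tau> by (simp add: dist_norm power_mult_distrib)
    then show ?thesis by (rule power2_le_imp_le) (use \<tau> in simp)
  qed
  have "\<exists>!x. T x = x"
    by (rule banach_fix_type[of "sqrt (1 - \<tau>)"]) (use \<tau> lip in auto)
  then obtain x where "T x = x" by blast
  then have "y = ?K x" using \<tau> by (simp add: T_def)
  then show "\<exists>x. y = C_part g x" by blast
qed

lemma inj_C: "inj (C_part g)"
proof (rule injI)
  fix x y assume "C_part g x = C_part g y"
  then have "C_part g (x - y) = 0" by (simp add: C_simps)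
  then have "norm (x - y) = 0" using C_expanding[of "x - y"] by simp
  then show "x = y" by simp
qed

lemma Z_C: "Z_op g (C_part g x) = - A_part g x"
  by (simp add: Z_op_def inj_C)

lemma C_cases: obtains x where "w = C_part g x"
  using surj_C by (metis surjD)

sublocale symmetric_kernel g
proof
  show "antilinear (Z_op g)"
    unfolding antilinear_def
  proof (intro conjI allI)
    fix v w c
    obtain x y where xy: "v = C_part g x" "w = C_part g y" by (metis C_cases)
    show "Z_op g (v + w) = Z_op g v + Z_op g w"
      unfolding xy C_simps[symmetric] Z_C by (simp add: A_simps)
    show "Z_op g (c *\<^sub>C v) = cnj c *\<^sub>C Z_op g v"
      unfolding xy C_simps[symmetric] Z_C by (simp add: A_simps complex_vector.scale_minus_right)
  qed
  show "cinner w (Z_op g v) = cinner v (Z_op g w)" for v w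
  proof -
    obtain x y where xy: "v = C_part g x" "w = C_part g y" by (metis C_cases)
    have "cinner (C_part g y) (A_part g x) = cinner (C_part g x) (A_part g y)"
      by (metis CA_symmetric cinner_commute)
    then show ?thesis unfolding xy Z_C by (simp add: V.ip_right)
  qed
qed

text \<open>
  Since \<open>\<parallel>Cx\<parallel>\<^sup>2 = \<parallel>x\<parallel>\<^sup>2 + \<parallel>Ax\<parallel>\<^sup>2\<close> and \<open>\<parallel>Ax\<parallel>\<^sup>2 \<le> h \<parallel>x\<parallel>\<^sup>2\<close>, the vector \<open>Ax\<close> is shorter than \<open>Cx\<close> by a fixed factor.
\<close>

lemma Z_contraction: "(norm (Z_op g w))\<^sup>2 \<le> h / (1 + h) * (norm w)\<^sup>2"
proof -
  obtain x where x: "w = C_part g x" by (rule C_cases)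
  have "(norm (A_part g x))\<^sup>2 * (1 + h) \<le> h * ((norm x)\<^sup>2 + (norm (A_part g x))\<^sup>2)"
    using A_bound[of x] by (simp add: algebra_simps)
  then show ?thesis using h_ge_0 unfolding x Z_C by (simp add: C_norm field_simps)
qed

text \<open>
  If \<open>C'\<close> and \<open>A'\<close> are the parts of the inverse, then \<open>C' Z = A'\<close>, and \<open>C'\<close> does not shrink vectors.
\<close>

lemma hs_Z: "V.orthonormal B \<Longrightarrow> (\<Sum>e\<in>B. (norm (Z_op g e))\<^sup>2) \<le> h"
proof -
  assume B: "V.orthonormal B"
  interpret I: restricted_symplectic "inv g" h by (rule inv_restricted_symplectic)
  have "(norm (Z_op g w))\<^sup>2 \<le> (norm (A_part (inv g) w))\<^sup>2" for w
  proof -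
    obtain x where x: "w = C_part g x" by (rule C_cases)
    have "C_part (inv g) (Z_op g w) = A_part (inv g) w"
      using I.inverse_parts(2)[of x] by (simp add: x Z_C I.C_simps add_eq_0_iff)
    then show ?thesis using I.C_expanding[of "Z_op g w"] by simp
  qed
  then have "(\<Sum>e\<in>B. (norm (Z_op g e))\<^sup>2) \<le> (\<Sum>e\<in>B. (norm (A_part (inv g) e))\<^sup>2)" by (intro sum_mono)
  also have "\<dots> \<le> h" using hs_A' B unfolding hs_bound_def by blast
  finally show ?thesis .
qed

lemma dilatable_exp_Z: "dilatable (exp_Z g)"
proof (rule gaussian_dilatable[where Z = "Z_op g" and t = "h / (1 + h)" and h = h])
  show "exp_Z g (sym_incl v * \<psi>) = exp_Z g (annihilator (Z_op g v) \<psi>)" for v \<psi>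
    using fun_cong[OF annihilator_exp_Z, of v \<psi>] by (simp add: dual_annihilator_def creator_def dual_creator_def)
  show "0 \<le> h / (1 + h)" "h / (1 + h) < 1" using h_ge_0 by auto
qed (fact antilinear_exp_Z Z_antilinear Z_symmetric Z_contraction hs_Z)+

end

section \<open>The operators \<open>U\<close>\<close>

text \<open>
  The operator \<open>a\<^sub>g(v)\<close>: the adjoint of \<open>c\<^sub>g(v)\<close>, and the annihilator for the vacuum \<open>e\<^sup>Z\<close>.
\<close>

definition a_op :: "('v::complex_hilbert \<Rightarrow> 'v) \<Rightarrow> 'v \<Rightarrow> ('v symalg \<Rightarrow> complex) \<Rightarrow> 'v symalg \<Rightarrow> complex"
  where "a_op g v \<Phi> = dual_annihilator (C_part g v) \<Phi> + dual_creator (A_part g v) \<Phi>"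

lemma c_op_add: "c_op g v (\<Phi> + \<Psi>) = c_op g v \<Phi> + c_op g v \<Psi>"
  unfolding c_op_def dual_creator_add dual_annihilator_add by (simp only: add_ac)

lemma c_op_scale: "c_op g v (c *\<^sub>C \<Phi>) = c *\<^sub>C c_op g v \<Phi>"
  unfolding c_op_def dual_creator_scale dual_annihilator_scale by (simp only: scaleC_add_right)

lemma a_op_add: "a_op g v (\<Phi> + \<Psi>) = a_op g v \<Phi> + a_op g v \<Psi>"
  unfolding a_op_def dual_creator_add dual_annihilator_add by (simp only: add_ac)

lemma a_op_scale: "a_op g v (c *\<^sub>C \<Phi>) = c *\<^sub>C a_op g v \<Phi>"
  unfolding a_op_def dual_creator_scale dual_annihilator_scale by (simp only: scaleC_add_right)

lemma antilinear_c_op: "antilinear \<Phi> \<Longrightarrow> antilinear (c_op g v \<Phi>)"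
  unfolding c_op_def by (intro antilinear_add_fun antilinear_dual_creator antilinear_dual_annihilator)

lemma dilatable_c_op: "dilatable \<Phi> \<Longrightarrow> dilatable (c_op g v \<Phi>)"
  unfolding c_op_def by (intro dilatable_add dilatable_ladder)

lemma dilatable_a_op: "dilatable \<Phi> \<Longrightarrow> dilatable (a_op g v \<Phi>)"
  unfolding a_op_def by (intro dilatable_add dilatable_ladder)

lemma antilinear_foldr_c_op: "antilinear \<Phi> \<Longrightarrow> antilinear (foldr (c_op g) vs \<Phi>)"
  by (induction vs) (simp_all add: antilinear_c_op)

lemma dip_c_op:
  assumes "dilatable \<Phi>" "dilatable \<Psi>"
  shows "S.dip (c_op g v \<Phi>) \<Psi> = S.dip \<Phi> (a_op g v \<Psi>)"
proof -
  note d = assms[THEN dilatable_antidual] assms(1)[THEN dilatable_ladder(1), THEN dilatable_antidual]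
    assms(1)[THEN dilatable_ladder(2), THEN dilatable_antidual]
    assms(2)[THEN dilatable_ladder(1), THEN dilatable_antidual]
    assms(2)[THEN dilatable_ladder(2), THEN dilatable_antidual]
  have "S.dip (c_op g v \<Phi>) \<Psi> = S.dip (dual_creator (C_part g v) \<Phi>) \<Psi> + S.dip (dual_annihilator (A_part g v) \<Phi>) \<Psi>"
    unfolding c_op_def
    by (subst (1 2 3) S.dip_commute) (simp_all add: d S.antidual_add S.dip_add_right)
  then show ?thesis
    unfolding a_op_def by (simp add: d S.dip_add_right dip_creator[OF assms] dip_annihilator[OF assms])
qed

context restricted_symplectic
begin

text \<open>
  The mixed terms contribute the commutators \<open>\<langle>Ax|Cy\<rangle>\<close> and \<open>\<langle>Ay|Cx\<rangle>\<close>, which are equal.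
\<close>

lemma c_op_commute:
  assumes \<Phi>: "antilinear \<Phi>"
  shows "c_op g x (c_op g y \<Phi>) = c_op g y (c_op g x \<Phi>)"
  unfolding c_op_def dual_creator_add dual_annihilator_add dual_CCR[OF \<Phi>]
  using CA_symmetric[of x y] dual_creator_commute[of "C_part g x" "C_part g y" \<Phi>]
    dual_annihilator_commute[of "A_part g x" "A_part g y" \<Phi>] by (simp only: add_ac)

text \<open>
  The two surviving commutators add up to \<open>\<langle>Cv|Cw\<rangle> - \<langle>Aw|Av\<rangle> = \<langle>v|w\<rangle>\<close>.
\<close>

lemma a_op_c_op:
  assumes \<Phi>: "antilinear \<Phi>"
  shows "a_op g v (c_op g w \<Phi>) = c_op g w (a_op g v \<Phi>) + cinner v w *\<^sub>C \<Phi>"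
proof -
  have "cinner v w = cinner (C_part g v) (C_part g w) - cinner (A_part g w) (A_part g v)"
    by (rule CA_inner[symmetric])
  then have vw: "cinner v w *\<^sub>C \<Phi> =
      cinner (C_part g v) (C_part g w) *\<^sub>C \<Phi> - cinner (A_part g w) (A_part g v) *\<^sub>C \<Phi>"
    by (simp only: complex_vector.scale_left_diff_distrib)
  show ?thesis
    unfolding c_op_def a_op_def dual_creator_add dual_annihilator_add dual_CCR[OF \<Phi>] vw
      dual_creator_commute[of "A_part g v" "C_part g w" \<Phi>]
      dual_annihilator_commute[of "C_part g v" "A_part g w" \<Phi>]
    by (simp only: algebra_simps)
qed

lemma c_op_add_vec: "antilinear \<Phi> \<Longrightarrow> c_op g (v + w) \<Phi> = c_op g v \<Phi> + c_op g w \<Phi>"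
  unfolding c_op_def C_simps A_simps by (simp only: dual_creator_add_vec dual_annihilator_add_vec add_ac)

lemma c_op_scale_vec: "antilinear \<Phi> \<Longrightarrow> c_op g (c *\<^sub>C v) \<Phi> = c *\<^sub>C c_op g v \<Phi>"
  unfolding c_op_def C_simps A_simps
  by (simp only: dual_creator_scale_vec dual_annihilator_scale_vec complex_cnj_cnj scaleC_add_right)

lemma foldr_c_op_mset:
  assumes "mset xs = mset ys"
  shows "foldr (c_op g) xs (exp_Z g) = foldr (c_op g) ys (exp_Z g)"
proof -
  have "fold (c_op g) (rev xs) (exp_Z g) = fold (c_op g) (rev ys) (exp_Z g)"
    by (rule fold_permuted_eq[where P = antilinear])
      (use assms in \<open>auto intro: antilinear_exp_Z antilinear_c_op c_op_commute\<close>)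
  then show ?thesis by (simp add: foldr_conv_fold)
qed

lemma U_op_ex1: "\<exists>!L. clinear L \<and> (\<forall>vs. L (sym_prod vs) = foldr (c_op g) vs (exp_Z g))"
proof (rule ex_ex1I)
  define l :: "'v multiset \<Rightarrow> 'v list" where "l m = (SOME xs. mset xs = m)" for m
  have l: "mset (l m) = m" for m unfolding l_def using ex_mset[of m] by (rule someI_ex)
  define H where "H m = foldr (c_op g) (l m) (exp_Z g)" for m
  have H: "H (mset xs) = foldr (c_op g) xs (exp_Z g)" for xs
    unfolding H_def by (rule foldr_c_op_mset) (rule l)
  have Hadd: "H (add_mset x m) = c_op g x (H m)" for x m
  proof -
    obtain xs where "m = mset xs" using ex_mset by metis
    then show ?thesis using H[of "x # xs"] H[of xs] by simp
  qed
  have Hlin: "antilinear (H m)" for m unfolding H_def by (intro antilinear_foldr_c_op antilinear_exp_Z)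
  have "\<exists>F. clinear F \<and> (\<forall>p. F (abs_symalg p) = lin_ext H p)"
    by (rule symalg_linear_lift) (simp_all only: Hadd c_op_add_vec[OF Hlin] c_op_scale_vec[OF Hlin])
  then obtain F where F: "clinear F" "\<And>p. F (abs_symalg p) = lin_ext H p" by blast
  have "F (sym_prod vs) = foldr (c_op g) vs (exp_Z g)" for vs
    using F(2)[of "Poly_Mapping.single (mset vs) 1"] by (simp add: abs_symalg_single sym_prod_mset H)
  then show "\<exists>L. clinear L \<and> (\<forall>vs. L (sym_prod vs) = foldr (c_op g) vs (exp_Z g))" using F(1) by blast
next
  fix L L' assume "clinear L \<and> (\<forall>vs. L (sym_prod vs) = foldr (c_op g) vs (exp_Z g))"
    "clinear L' \<and> (\<forall>vs. L' (sym_prod vs) = foldr (c_op g) vs (exp_Z g))"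
  then show "L = L'" by (auto intro: clinear_symalg_unique[of L L'])
qed

lemma clinear_U: "clinear (U_op g)"
  and U_prod: "U_op g (sym_prod vs) = foldr (c_op g) vs (exp_Z g)"
  using theI'[OF U_op_ex1] unfolding U_op_def by auto

lemmas U_linear = clinear_lemmas[OF clinear_U]

lemma U_one: "U_op g 1 = exp_Z g"
  using U_prod[of "[]"] by simp

lemma U_incl_mult: "U_op g (sym_incl v * \<phi>) = c_op g v (U_op g \<phi>)"
proof (induction \<phi> rule: symalg_induct)
  case (prod vs)
  show ?case using U_prod[of "v # vs"] U_prod[of vs] by simp
next
  case (add x y)
  then show ?case by (simp only: distrib_left U_linear c_op_add)
next
  case (scale c x)
  then show ?case by (simp only: scaleC_mult_right U_linear c_op_scale)
qed

lemma dilatable_U: "dilatable (U_op g \<phi>)"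
proof (induction \<phi> rule: symalg_induct)
  case (prod vs)
  show ?case unfolding U_prod by (induction vs) (simp_all add: dilatable_exp_Z dilatable_c_op)
qed (simp_all only: U_linear dilatable_add dilatable_scale)

lemmas antilinear_U = dilatable_antilinear[OF dilatable_U]
lemmas U_antidual = dilatable_antidual[OF dilatable_U]

text \<open>
  By the differential equation the left-hand side is \<open>c(ZCv + Av) e\<^sup>Z\<close>, and \<open>ZC = - A\<close>.
\<close>

lemma a_op_exp_Z: "a_op g v (exp_Z g) = 0 *\<^sub>C exp_Z g"
proof -
  have "Z_op g (C_part g v) + A_part g v = 0 *\<^sub>C v" by (simp add: Z_C)
  then show ?thesis
    unfolding a_op_def annihilator_exp_Z dual_creator_add_vec[OF antilinear_exp_Z, symmetric]
    by (simp only: dual_creator_scale_vec[OF antilinear_exp_Z]) (simp add: fun_eq_iff scaleC_apply)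
qed

lemma a_op_U: "a_op g v (U_op g \<psi>) = U_op g (annihilator v \<psi>)"
proof (induction \<psi> rule: symalg_induct)
  case (prod vs)
  show ?case
  proof (induction vs)
    case Nil
    show ?case by (simp only: sym_prod_Nil U_one a_op_exp_Z annihilator_one U_linear) simp
  next
    case (Cons w ws)
    show ?case
      unfolding sym_prod_Cons U_incl_mult a_op_c_op[OF antilinear_U] Cons annihilator_incl_mult U_linear
      by (simp only: add.commute)
  qed
next
  case (add x y)
  then show ?case by (simp only: annihilator_linear U_linear a_op_add)
next
  case (scale c x)
  then show ?case by (simp only: annihilator_linear U_linear a_op_scale)
qed

lemma sym_inner_one_incl_mult: "sym_inner 1 (sym_incl v * \<psi>) = 0"
  using sym_inner_annihilator[of v 1 \<psi>] by (simp add: sym_inner_left)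

text \<open>
  Moving one factor \<open>v\<close> of \<open>\<phi>\<close> to the other side as \<open>a(v)\<close> is possible for both forms. This reduces the
  claim to \<open>\<phi> = 1\<close>, where both forms vanish on arguments \<open>\<psi>\<close> of positive degree, because
  \<open>a\<^sub>g(w) e\<^sup>Z = 0\<close> and \<open>a(w) 1 = 0\<close>.
\<close>

lemma dip_U:
  "S.dip (U_op g \<phi>) (U_op g \<psi>) = complex_of_real ((S.dnorm (exp_Z g))\<^sup>2) * sym_inner \<phi> \<psi>"
proof -
  let ?\<kappa> = "complex_of_real ((S.dnorm (exp_Z g))\<^sup>2)"
  note E = dilatable_antidual[OF dilatable_exp_Z]
  have vac: "S.dip (U_op g 1) (U_op g \<psi>) = ?\<kappa> * sym_inner 1 \<psi>" for \<psi>
  proof (induction \<psi> rule: symalg_induct)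
    case (prod ws)
    show ?case
    proof (cases ws)
      case Nil
      then show ?thesis by (simp add: U_one S.dip_self[OF E])
    next
      case (Cons w us)
      have "S.dip (U_op g 1) (U_op g (sym_incl w * sym_prod us)) = cnj (S.dip (c_op g w (U_op g (sym_prod us))) (exp_Z g))"
        unfolding U_incl_mult U_one
        by (rule S.dip_commute) (intro E dilatable_antidual dilatable_c_op dilatable_U)+
      also have "\<dots> = cnj (S.dip (U_op g (sym_prod us)) (0 *\<^sub>C exp_Z g))"
        unfolding dip_c_op[OF dilatable_U dilatable_exp_Z] a_op_exp_Z ..
      also have "\<dots> = 0" unfolding S.dip_scale_right[OF U_antidual E] by simp
      finally show ?thesis by (simp add: Cons sym_inner_one_incl_mult)
    qed
  qed (simp_all only: U_linear S.dip_add_right S.dip_scale_right U_antidual sym_inner_right distrib_left mult.left_commute)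
  have *: "S.dip (U_op g (sym_prod vs)) (U_op g \<psi>) = ?\<kappa> * sym_inner (sym_prod vs) \<psi>" for vs \<psi>
  proof (induction vs arbitrary: \<psi>)
    case Nil
    then show ?case using vac by simp
  next
    case (Cons v vs)
    then show ?case
      by (simp add: U_incl_mult dip_c_op[OF dilatable_U dilatable_U] a_op_U sym_inner_incl_mult)
  qed
  have com: "S.dip (U_op g x) (U_op g y) = cnj (S.dip (U_op g y) (U_op g x))" for x y
    by (rule S.dip_commute[OF U_antidual U_antidual])
  show ?thesis
  proof (induction \<phi> rule: symalg_induct)
    case (prod vs) show ?case by (rule *)
  next
    case (add x y)
    have "S.dip (U_op g (x + y)) (U_op g \<psi>) = S.dip (U_op g x) (U_op g \<psi>) + S.dip (U_op g y) (U_op g \<psi>)"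
      unfolding com[of x \<psi>] com[of y \<psi>] com[of "x + y" \<psi>]
      by (simp only: U_linear S.dip_add_right U_antidual complex_cnj_add)
    then show ?case using add by (simp add: sym_inner_left distrib_left)
  next
    case (scale c x)
    have "S.dip (U_op g (c *\<^sub>C x)) (U_op g \<psi>) = cnj c * S.dip (U_op g x) (U_op g \<psi>)"
      unfolding com[of x \<psi>] com[of "c *\<^sub>C x" \<psi>]
      by (simp only: U_linear S.dip_scale_right U_antidual complex_cnj_mult)
    then show ?case using scale by (simp add: sym_inner_left)
  qed
qed

lemma dnorm_U: "S.dnorm (U_op g \<phi>) = S.dnorm (exp_Z g) * sym_norm \<phi>"
proof -
  have "complex_of_real ((S.dnorm (U_op g \<phi>))\<^sup>2) = complex_of_real ((S.dnorm (exp_Z g) * sym_norm \<phi>)\<^sup>2)"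
    using dip_U[of \<phi> \<phi>] unfolding S.dip_self[OF U_antidual] S.ip_self power_mult_distrib of_real_mult .
  then have "(S.dnorm (U_op g \<phi>))\<^sup>2 = (S.dnorm (exp_Z g) * sym_norm \<phi>)\<^sup>2" by (simp only: of_real_eq_iff)
  then show ?thesis
    using S.dnorm_ge_0[OF U_antidual, of \<phi>] S.dnorm_ge_0[OF dilatable_antidual[OF dilatable_exp_Z]]
    by (simp add: power2_eq_iff_nonneg)
qed

lemma dnorm_exp_Z_pos: "0 < S.dnorm (exp_Z g)"
proof -
  have "exp_Z g \<in> S.antidual" by (rule dilatable_antidual[OF dilatable_exp_Z])
  moreover have "exp_Z g \<noteq> 0"
  proof
    assume "exp_Z g = 0"
    then have "exp_Z g 1 = 0" by simp
    then show False by (simp add: exp_Z_one)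
  qed
  ultimately have "S.dnorm (exp_Z g) \<noteq> 0" "0 \<le> S.dnorm (exp_Z g)"
    using S.dnorm_eq_0[of "exp_Z g"] S.dnorm_ge_0[of "exp_Z g"] by blast+
  then show ?thesis by linarith
qed

end

section \<open>The continuous extension\<close>

lemma continuous_extension_tends:
  assumes T: "continuous_extension L T" and F: "\<Phi> \<in> fock_space" and t: "S.tends (\<lambda>n. dual_embed (\<phi> n)) \<Phi>"
  shows "S.tends (\<lambda>n. L (\<phi> n)) (T \<Phi>)"
proof -
  have TF: "T \<Psi> \<in> fock_space" if "\<Psi> \<in> fock_space" for \<Psi>
    using T that unfolding continuous_extension_def by auto
  have Te: "T (dual_embed \<psi>) = L \<psi>" for \<psi>
    using T unfolding continuous_extension_def by blast
  have emb: "dual_embed \<psi> \<in> fock_space" for \<psi> :: "'a symalg"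
    unfolding fock_space_eq_antidual by (rule S.emb_antidual)
  have diff: "\<Psi> - \<Psi>' \<in> fock_space" if "\<Psi> \<in> fock_space" "\<Psi>' \<in> fock_space" for \<Psi> \<Psi>' :: "'a symalg \<Rightarrow> complex"
    using that unfolding fock_space_eq_antidual by (rule S.antidual_diff)
  have LF: "L \<psi> \<in> fock_space" for \<psi> using TF[OF emb] by (simp add: Te)
  show ?thesis unfolding S.tends_def
  proof (rule LIMSEQ_I)
    fix \<epsilon> :: real assume "\<epsilon> > 0"
    then obtain \<delta> where \<delta>: "\<delta> > 0" "\<And>\<Psi>. \<Psi> \<in> fock_space \<Longrightarrow> fock_norm (\<Psi> - \<Phi>) < \<delta> \<Longrightarrow> fock_norm (T \<Psi> - T \<Phi>) < \<epsilon>"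
      using T F unfolding continuous_extension_def by blast
    obtain N where N: "\<forall>n\<ge>N. norm (S.dnorm (dual_embed (\<phi> n) - \<Phi>) - 0) < \<delta>"
      using LIMSEQ_D[OF t[unfolded S.tends_def] \<delta>(1)] by blast
    have "norm (S.dnorm (L (\<phi> n) - T \<Phi>) - 0) < \<epsilon>" if "n \<ge> N" for n
    proof -
      have "S.dnorm (dual_embed (\<phi> n) - \<Phi>) < \<delta>" using N that by auto
      then have "fock_norm (T (dual_embed (\<phi> n)) - T \<Phi>) < \<epsilon>"
        using \<delta>(2)[OF emb] fock_norm_eq_dnorm[OF diff[OF emb F]] by simp
      moreover have d: "L (\<phi> n) - T \<Phi> \<in> fock_space" by (rule diff[OF LF TF[OF F]])
      moreover have "0 \<le> S.dnorm (L (\<phi> n) - T \<Phi>)" using d unfolding fock_space_eq_antidual by (rule S.dnorm_ge_0)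
      ultimately show ?thesis using fock_norm_eq_dnorm[OF d] by (simp add: Te)
    qed
    then show "\<exists>N. \<forall>n\<ge>N. norm (S.dnorm (L (\<phi> n) - T \<Phi>) - 0) < \<epsilon>" by blast
  qed
qed

lemma continuous_extension_unique:
  assumes T: "continuous_extension L T" "continuous_extension L T'"
  shows "T = T'"
proof
  fix \<Phi>
  show "T \<Phi> = T' \<Phi>"
  proof (cases "\<Phi> \<in> fock_space")
    case True
    then have \<Phi>: "\<Phi> \<in> S.antidual" by (simp add: fock_space_eq_antidual)
    have TF: "T \<Psi> \<in> S.antidual" "T' \<Psi> \<in> S.antidual" if "\<Psi> \<in> S.antidual" for \<Psi>
      using T that unfolding continuous_extension_def fock_space_eq_antidual by auto
    have Te: "T (dual_embed \<psi>) = L \<psi>" for \<psi> using T(1) unfolding continuous_extension_def by blast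
    note t = S.tends_approx[OF \<Phi>]
    have L: "L (S.approx \<Phi> n) \<in> S.antidual" for n using TF(1)[OF S.emb_antidual] by (simp add: Te)
    show ?thesis
      by (rule S.tends_unique[OF L TF(1)[OF \<Phi>] TF(2)[OF \<Phi>]])
        (rule continuous_extension_tends[OF T(1) True t], rule continuous_extension_tends[OF T(2) True t])
  next
    case False
    then show ?thesis using T unfolding continuous_extension_def by (metis PiE_arb)
  qed
qed

lemma isometric_continuous_extension:
  fixes L :: "'v::complex_hilbert symalg \<Rightarrow> 'v symalg \<Rightarrow> complex"
  assumes lin: "clinear L" and L: "\<And>\<phi>. L \<phi> \<in> S.antidual" and Lnorm: "\<And>\<phi>. S.dnorm (L \<phi>) = sym_norm \<phi>"
  obtains T where "continuous_extension L T"
    "\<And>\<Phi>. \<Phi> \<in> S.antidual \<Longrightarrow> T \<Phi> \<in> S.antidual"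
    "\<And>\<Phi> \<phi>. \<Phi> \<in> S.antidual \<Longrightarrow> S.tends (\<lambda>n. dual_embed (\<phi> n)) \<Phi> \<Longrightarrow> S.tends (\<lambda>n. L (\<phi> n)) (T \<Phi>)"
    "\<And>\<Phi> \<Psi>. \<Phi> \<in> S.antidual \<Longrightarrow> \<Psi> \<in> S.antidual \<Longrightarrow> T (\<Phi> + \<Psi>) = T \<Phi> + T \<Psi>"
    "\<And>c \<Phi>. \<Phi> \<in> S.antidual \<Longrightarrow> T (c *\<^sub>C \<Phi>) = c *\<^sub>C T \<Phi>"
    "\<And>\<Phi>. \<Phi> \<in> S.antidual \<Longrightarrow> S.dnorm (T \<Phi>) = S.dnorm \<Phi>"
proof -
  note Ll = clinear_lemmas[OF lin]
  obtain T0 where T0: "\<And>\<Phi>. \<Phi> \<in> S.antidual \<Longrightarrow> T0 \<Phi> \<in> S.antidual"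
    "\<And>\<Phi> \<phi>. \<Phi> \<in> S.antidual \<Longrightarrow> S.tends (\<lambda>n. dual_embed (\<phi> n)) \<Phi> \<Longrightarrow> S.tends (\<lambda>n. L (\<phi> n)) (T0 \<Phi>)"
    using S.isometric_extension[OF L Ll(5) Lnorm] by blast
  define T where "T = restrict T0 S.antidual"
  have T: "T \<Phi> \<in> S.antidual" if "\<Phi> \<in> S.antidual" for \<Phi> using that T0 by (simp add: T_def)
  have lim: "S.tends (\<lambda>n. L (\<phi> n)) (T \<Phi>)" if "\<Phi> \<in> S.antidual" "S.tends (\<lambda>n. dual_embed (\<phi> n)) \<Phi>" for \<Phi> \<phi>
    using T0(2)[OF that] that(1) by (simp add: T_def)
  have unique: "T \<Phi> = G" if "\<Phi> \<in> S.antidual" "S.tends (\<lambda>n. dual_embed (\<phi> n)) \<Phi>" "G \<in> S.antidual"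
      "S.tends (\<lambda>n. L (\<phi> n)) G" for \<Phi> \<phi> G
    by (rule S.tends_unique[OF L T[OF that(1)] that(3) lim[OF that(1,2)] that(4)])
  have add: "T (\<Phi> + \<Psi>) = T \<Phi> + T \<Psi>" if "\<Phi> \<in> S.antidual" "\<Psi> \<in> S.antidual" for \<Phi> \<Psi>
  proof (rule unique)
    note a = S.tends_approx[OF that(1)] and b = S.tends_approx[OF that(2)]
    show "\<Phi> + \<Psi> \<in> S.antidual" "T \<Phi> + T \<Psi> \<in> S.antidual" using that T by (auto intro: S.antidual_add)
    show "S.tends (\<lambda>n. dual_embed (S.approx \<Phi> n + S.approx \<Psi> n)) (\<Phi> + \<Psi>)"
      unfolding S.emb_add by (rule S.tends_add[OF S.emb_antidual that(1) a S.emb_antidual that(2) b])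
    show "S.tends (\<lambda>n. L (S.approx \<Phi> n + S.approx \<Psi> n)) (T \<Phi> + T \<Psi>)"
      unfolding Ll by (rule S.tends_add[OF L T[OF that(1)] lim[OF that(1) a] L T[OF that(2)] lim[OF that(2) b]])
  qed
  have scale: "T (c *\<^sub>C \<Phi>) = c *\<^sub>C T \<Phi>" if "\<Phi> \<in> S.antidual" for c \<Phi>
  proof (rule unique)
    note a = S.tends_approx[OF that]
    show "c *\<^sub>C \<Phi> \<in> S.antidual" "c *\<^sub>C T \<Phi> \<in> S.antidual" using that T by (auto intro: S.antidual_scale)
    show "S.tends (\<lambda>n. dual_embed (c *\<^sub>C S.approx \<Phi> n)) (c *\<^sub>C \<Phi>)"
      unfolding S.emb_scale by (rule S.tends_scale[OF S.emb_antidual that a])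
    show "S.tends (\<lambda>n. L (c *\<^sub>C S.approx \<Phi> n)) (c *\<^sub>C T \<Phi>)"
      unfolding Ll by (rule S.tends_scale[OF L T[OF that] lim[OF that a]])
  qed
  have norm: "S.dnorm (T \<Phi>) = S.dnorm \<Phi>" if "\<Phi> \<in> S.antidual" for \<Phi>
  proof (rule LIMSEQ_unique)
    note a = S.tends_approx[OF that]
    show "(\<lambda>n. S.dnorm (L (S.approx \<Phi> n))) \<longlonglongrightarrow> S.dnorm (T \<Phi>)"
      by (rule S.tends_dnorm[OF L T[OF that] lim[OF that a]])
    show "(\<lambda>n. S.dnorm (L (S.approx \<Phi> n))) \<longlonglongrightarrow> S.dnorm \<Phi>"
      using S.tends_dnorm[OF S.emb_antidual that a] by (simp add: Lnorm S.dnorm_emb)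
  qed
  have emb: "T (dual_embed \<phi>) = L \<phi>" for \<phi>
    by (rule unique[of _ "\<lambda>n. \<phi>"]) (auto intro: S.emb_antidual L S.tends_const)
  have "continuous_extension L T"
    unfolding continuous_extension_def fock_space_eq_antidual
  proof (intro conjI allI ballI impI)
    show "T \<in> S.antidual \<rightarrow>\<^sub>E S.antidual" using T by (auto simp: T_def)
    show "T (dual_embed \<phi>) = L \<phi>" for \<phi> by (rule emb)
    fix \<Phi> :: "'v symalg \<Rightarrow> complex" and \<epsilon> :: real
    assume \<Phi>: "\<Phi> \<in> S.antidual" and \<epsilon>: "\<epsilon> > 0"
    have "fock_norm (T \<Psi> - T \<Phi>) = fock_norm (\<Psi> - \<Phi>)" if "\<Psi> \<in> S.antidual" for \<Psi>
    proof -
      have d: "\<Psi> - \<Phi> \<in> S.antidual" by (rule S.antidual_diff[OF that \<Phi>])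
      have "T (\<Psi> - \<Phi>) + T \<Phi> = T \<Psi>" using add[OF d \<Phi>] by simp
      then have "T (\<Psi> - \<Phi>) = T \<Psi> - T \<Phi>" by (simp only: eq_diff_eq)
      then show ?thesis using norm[OF d] fock_norm_eq_dnorm[of "\<Psi> - \<Phi>"] fock_norm_eq_dnorm[of "T (\<Psi> - \<Phi>)"] d T[OF d]
        unfolding fock_space_eq_antidual by simp
    qed
    then show "\<exists>\<delta>>0. \<forall>\<Psi>\<in>S.antidual. fock_norm (\<Psi> - \<Phi>) < \<delta> \<longrightarrow> fock_norm (T \<Psi> - T \<Phi>) < \<epsilon>"
      using \<epsilon> by auto
  qed
  then show thesis using T lim add scale norm by (rule that)
qed

context restricted_symplectic
begin

lemma U_normalized_eq: "U_normalized g \<phi> = complex_of_real (inverse (S.dnorm (exp_Z g))) *\<^sub>C U_op g \<phi>"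
proof -
  have "exp_Z g \<in> fock_space" unfolding fock_space_eq_antidual by (rule dilatable_antidual[OF dilatable_exp_Z])
  then show ?thesis by (simp only: U_normalized_def fock_norm_eq_dnorm)
qed

lemma clinear_U_normalized: "clinear (U_normalized g)"
  unfolding clinear_def U_normalized_eq U_linear by (simp only: scaleC_add_right scaleC_scaleC mult.commute) simp

lemma U_normalized_antidual: "U_normalized g \<phi> \<in> S.antidual"
  unfolding U_normalized_eq by (rule S.antidual_scale[OF U_antidual])

lemma dnorm_U_normalized: "S.dnorm (U_normalized g \<phi>) = sym_norm \<phi>"
  using dnorm_exp_Z_pos by (simp add: U_normalized_eq S.dnorm_scale[OF U_antidual] dnorm_U norm_inverse norm_divide)

text \<open>
  The inverse transformation expresses \<open>c(v)\<close> as \<open>c\<^sub>g(C'v) + a\<^sub>g(A'v)\<close>, where \<open>C'\<close> and \<open>A'\<close> are the parts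
  of the inverse of \<open>g\<close>. In \<open>SV\<close> this corresponds to the creator that belongs to the inverse of \<open>g\<close>.
\<close>

lemma creator_U_normalized:
  "dual_creator v (U_normalized g \<phi>) =
    U_normalized g (sym_incl (C_part (inv g) v) * \<phi> + annihilator (A_part (inv g) v) \<phi>)"
proof -
  let ?u = "U_op g \<phi>"
  let ?C = "C_part g" and ?A = "A_part g" and ?C' = "C_part (inv g) v" and ?A' = "A_part (inv g) v"
  have "U_op g (sym_incl ?C' * \<phi> + annihilator ?A' \<phi>) = c_op g ?C' ?u + a_op g ?A' ?u"
    by (simp only: U_linear U_incl_mult a_op_U)
  also have "\<dots> = (dual_creator (?C ?C') ?u + dual_creator (?A ?A') ?u) +
      (dual_annihilator (?C ?A') ?u + dual_annihilator (?A ?C') ?u)"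
    unfolding c_op_def a_op_def by (simp only: add_ac)
  also have "\<dots> = dual_creator v ?u + dual_annihilator 0 ?u"
    by (simp only: dual_creator_add_vec[OF antilinear_U, symmetric] dual_annihilator_add_vec[OF antilinear_U, symmetric]
        inverse_parts)
  also have "dual_annihilator 0 ?u = 0"
    by (simp add: dual_annihilator_def creator_def fun_eq_iff antilinear_lemmas[OF antilinear_U])
  finally show ?thesis unfolding U_normalized_eq dual_creator_scale by simp
qed

lemma annihilator_U_normalized:
  "dual_annihilator v (U_normalized g \<phi>) =
    U_normalized g (annihilator (C_part (inv g) v) \<phi> + sym_incl (A_part (inv g) v) * \<phi>)"
proof -
  let ?u = "U_op g \<phi>"
  let ?C = "C_part g" and ?A = "A_part g" and ?C' = "C_part (inv g) v" and ?A' = "A_part (inv g) v"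
  have "U_op g (annihilator ?C' \<phi> + sym_incl ?A' * \<phi>) = a_op g ?C' ?u + c_op g ?A' ?u"
    by (simp only: U_linear U_incl_mult a_op_U)
  also have "\<dots> = (dual_annihilator (?C ?C') ?u + dual_annihilator (?A ?A') ?u) +
      (dual_creator (?C ?A') ?u + dual_creator (?A ?C') ?u)"
    unfolding c_op_def a_op_def by (simp only: add_ac)
  also have "\<dots> = dual_annihilator v ?u + dual_creator 0 ?u"
    by (simp only: dual_creator_add_vec[OF antilinear_U, symmetric] dual_annihilator_add_vec[OF antilinear_U, symmetric]
        inverse_parts)
  also have "dual_creator 0 ?u = 0"
    by (simp add: dual_creator_def fun_eq_iff antilinear_lemmas[OF antilinear_U])
  finally show ?thesis unfolding U_normalized_eq dual_annihilator_scale by simp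
qed

text \<open>
  The isometric extension \<open>T\<close> carries the operators \<open>c, a\<close> of the inverse of \<open>g\<close> to the plain \<open>c, a\<close>.
  So it maps the Gaussian \<open>\<Theta>\<close> of the inverse to a vacuum, that is, to a nonzero multiple of \<open>1\<close>, and
  it maps everything that creators make from \<open>\<Theta>\<close> to all of \<open>SV\<close>. Completeness does the rest.
\<close>

theorem U_normalized_unitary:
  "(\<exists>!T. continuous_extension (U_normalized g) T) \<and>
   (\<forall>T. continuous_extension (U_normalized g) T \<longrightarrow> fock_unitary T)"
proof -
  interpret I: restricted_symplectic "inv g" h by (rule inv_restricted_symplectic)
  let ?L = "U_normalized g"
  note L = U_normalized_antidual
  obtain T where T: "continuous_extension ?L T"
    and TF: "\<And>\<Phi>. \<Phi> \<in> S.antidual \<Longrightarrow> T \<Phi> \<in> S.antidual"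
    and lim: "\<And>\<Phi> \<phi>. \<Phi> \<in> S.antidual \<Longrightarrow> S.tends (\<lambda>n. dual_embed (\<phi> n)) \<Phi> \<Longrightarrow> S.tends (\<lambda>n. ?L (\<phi> n)) (T \<Phi>)"
    and T_add: "\<And>\<Phi> \<Psi>. \<Phi> \<in> S.antidual \<Longrightarrow> \<Psi> \<in> S.antidual \<Longrightarrow> T (\<Phi> + \<Psi>) = T \<Phi> + T \<Psi>"
    and T_scale: "\<And>c \<Phi>. \<Phi> \<in> S.antidual \<Longrightarrow> T (c *\<^sub>C \<Phi>) = c *\<^sub>C T \<Phi>"
    and iso: "\<And>\<Phi>. \<Phi> \<in> S.antidual \<Longrightarrow> S.dnorm (T \<Phi>) = S.dnorm \<Phi>"
    using isometric_continuous_extension[OF clinear_U_normalized L dnorm_U_normalized] by blast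
  have diff: "T (\<Psi> - \<Phi>) = T \<Psi> - T \<Phi>" if "\<Psi> \<in> S.antidual" "\<Phi> \<in> S.antidual" for \<Phi> \<Psi>
  proof -
    have "T (\<Psi> - \<Phi>) + T \<Phi> = T \<Psi>" using T_add[OF S.antidual_diff[OF that] that(2)] by simp
    then show ?thesis by (simp only: eq_diff_eq)
  qed
  have inj: "\<Phi> = \<Psi>" if "\<Phi> \<in> S.antidual" "\<Psi> \<in> S.antidual" "T \<Phi> = T \<Psi>" for \<Phi> \<Psi>
  proof -
    have d: "\<Phi> - \<Psi> \<in> S.antidual" by (rule S.antidual_diff[OF that(1,2)])
    have "S.dnorm (\<Phi> - \<Psi>) = S.dnorm 0" using iso[OF d] unfolding diff[OF that(1,2)] that(3) by simp
    then have "\<Phi> - \<Psi> = 0" by (intro S.dnorm_eq_0[OF d]) simp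
    then show ?thesis by simp
  qed
  have T_creator: "T (c_op (inv g) v \<Phi>) = dual_creator v (T \<Phi>)" if \<Phi>: "dilatable \<Phi>" for v \<Phi>
  proof
    fix \<psi>
    obtain \<phi> where \<phi>: "S.tends (\<lambda>n. dual_embed (\<phi> n)) \<Phi>"
      "\<And>w. S.tends (\<lambda>n. dual_embed (sym_incl w * \<phi> n)) (dual_creator w \<Phi>)"
      "\<And>w. S.tends (\<lambda>n. dual_embed (annihilator w (\<phi> n))) (dual_annihilator w \<Phi>)"
      using dilatable_approx[OF \<Phi>] by blast
    let ?\<chi> = "\<lambda>n. sym_incl (C_part (inv g) v) * \<phi> n + annihilator (A_part (inv g) v) (\<phi> n)"
    note d = dilatable_antidual[OF \<Phi>] dilatable_antidual[OF dilatable_c_op[OF \<Phi>], of "inv g" v]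
      dilatable_antidual[OF dilatable_ladder(1)[OF \<Phi>]] dilatable_antidual[OF dilatable_ladder(2)[OF \<Phi>]]
    have "S.tends (\<lambda>n. dual_embed (?\<chi> n)) (c_op (inv g) v \<Phi>)"
      unfolding c_op_def S.emb_add
      by (rule S.tends_add[OF S.emb_antidual d(3) \<phi>(2) S.emb_antidual d(4) \<phi>(3)])
    then have "S.tends (\<lambda>n. ?L (?\<chi> n)) (T (c_op (inv g) v \<Phi>))" by (rule lim[OF d(2)])
    then have "(\<lambda>n. ?L (?\<chi> n) \<psi>) \<longlonglongrightarrow> T (c_op (inv g) v \<Phi>) \<psi>" by (rule S.tends_pointwise[OF L TF[OF d(2)]])
    moreover have "(\<lambda>n. ?L (?\<chi> n) \<psi>) \<longlonglongrightarrow> dual_creator v (T \<Phi>) \<psi>"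
      unfolding creator_U_normalized[symmetric] unfolding dual_creator_def
      by (rule S.tends_pointwise[OF L TF[OF d(1)] lim[OF d(1) \<phi>(1)]])
    ultimately show "T (c_op (inv g) v \<Phi>) \<psi> = dual_creator v (T \<Phi>) \<psi>" by (rule LIMSEQ_unique)
  qed
  have T_annihilator: "T (a_op (inv g) v \<Phi>) = dual_annihilator v (T \<Phi>)" if \<Phi>: "dilatable \<Phi>" for v \<Phi>
  proof
    fix \<psi>
    obtain \<phi> where \<phi>: "S.tends (\<lambda>n. dual_embed (\<phi> n)) \<Phi>"
      "\<And>w. S.tends (\<lambda>n. dual_embed (sym_incl w * \<phi> n)) (dual_creator w \<Phi>)"
      "\<And>w. S.tends (\<lambda>n. dual_embed (annihilator w (\<phi> n))) (dual_annihilator w \<Phi>)"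
      using dilatable_approx[OF \<Phi>] by blast
    let ?\<chi> = "\<lambda>n. annihilator (C_part (inv g) v) (\<phi> n) + sym_incl (A_part (inv g) v) * \<phi> n"
    note d = dilatable_antidual[OF \<Phi>] dilatable_antidual[OF dilatable_a_op[OF \<Phi>], of "inv g" v]
      dilatable_antidual[OF dilatable_ladder(1)[OF \<Phi>]] dilatable_antidual[OF dilatable_ladder(2)[OF \<Phi>]]
    have "S.tends (\<lambda>n. dual_embed (?\<chi> n)) (a_op (inv g) v \<Phi>)"
      unfolding a_op_def S.emb_add
      by (rule S.tends_add[OF S.emb_antidual d(4) \<phi>(3) S.emb_antidual d(3) \<phi>(2)])
    then have "S.tends (\<lambda>n. ?L (?\<chi> n)) (T (a_op (inv g) v \<Phi>))" by (rule lim[OF d(2)])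
    then have "(\<lambda>n. ?L (?\<chi> n) \<psi>) \<longlonglongrightarrow> T (a_op (inv g) v \<Phi>) \<psi>" by (rule S.tends_pointwise[OF L TF[OF d(2)]])
    moreover have "(\<lambda>n. ?L (?\<chi> n) \<psi>) \<longlonglongrightarrow> dual_annihilator v (T \<Phi>) \<psi>"
      unfolding annihilator_U_normalized[symmetric] unfolding dual_annihilator_def
      by (rule S.tends_pointwise[OF L TF[OF d(1)] lim[OF d(1) \<phi>(1)]])
    ultimately show "T (a_op (inv g) v \<Phi>) \<psi> = dual_annihilator v (T \<Phi>) \<psi>" by (rule LIMSEQ_unique)
  qed
  let ?\<Theta> = "exp_Z (inv g)"
  have \<Theta>: "dilatable ?\<Theta>" by (rule I.dilatable_exp_Z)
  note \<Theta>F = dilatable_antidual[OF \<Theta>]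
  define \<mu> where "\<mu> = T ?\<Theta> 1"
  have vac: "T ?\<Theta> = \<mu> *\<^sub>C dual_embed 1"
  proof (rule antilinear_symalg_unique)
    show "antilinear (T ?\<Theta>)" by (rule S.antidual_antilinear[OF TF[OF \<Theta>F]])
    show "antilinear (\<mu> *\<^sub>C dual_embed 1)" by (rule antilinear_scale_fun[OF antilinear_dual_embed])
    fix vs :: "'v list"
    show "T ?\<Theta> (sym_prod vs) = (\<mu> *\<^sub>C dual_embed 1) (sym_prod vs)"
    proof (cases vs)
      case Nil
      then show ?thesis by (simp add: \<mu>_def scaleC_apply S.emb_apply)
    next
      case (Cons v ws)
      have "dual_annihilator v (T ?\<Theta>) = 0 *\<^sub>C T ?\<Theta>"
        unfolding T_annihilator[OF \<Theta>, symmetric] I.a_op_exp_Z by (rule T_scale[OF \<Theta>F])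
      from fun_cong[OF this, of "sym_prod ws"] have "T ?\<Theta> (sym_prod vs) = 0"
        by (simp add: dual_annihilator_def creator_def Cons scaleC_apply)
      then show ?thesis by (simp add: Cons scaleC_apply S.emb_apply sym_inner_incl_mult sym_inner_right)
    qed
  qed
  have "\<mu> \<noteq> 0"
  proof
    assume "\<mu> = 0"
    then have "S.dnorm (T ?\<Theta>) = S.dnorm 0" unfolding vac by simp
    then show False using iso[OF \<Theta>F] I.dnorm_exp_Z_pos by simp
  qed
  have TU: "T (U_op (inv g) \<phi>) = \<mu> *\<^sub>C dual_embed \<phi>" for \<phi>
  proof (induction \<phi> rule: symalg_induct)
    case (prod vs)
    show ?case
    proof (induction vs)
      case Nil show ?case by (simp only: sym_prod_Nil I.U_one vac)
    next
      case (Cons v vs)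
      then show ?case
        by (simp only: sym_prod_Cons I.U_incl_mult T_creator[OF I.dilatable_U] dual_creator_scale dual_creator_embed)
    qed
  next
    case (add x y)
    then show ?case by (simp only: I.U_linear S.emb_add T_add[OF I.U_antidual I.U_antidual] scaleC_add_right)
  next
    case (scale c x)
    then show ?case
      by (simp only: I.U_linear S.emb_scale T_scale[OF I.U_antidual] complex_vector.scale_left_commute)
  qed
  have surj: "\<exists>\<Phi>\<in>S.antidual. T \<Phi> = \<Xi>" if \<Xi>: "\<Xi> \<in> S.antidual" for \<Xi>
  proof -
    let ?\<phi> = "S.approx \<Xi>"
    define y where "y n = inverse \<mu> *\<^sub>C U_op (inv g) (?\<phi> n)" for n
    have y: "y n \<in> S.antidual" for n unfolding y_def by (rule S.antidual_scale[OF I.U_antidual])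
    have Ty: "T (y n) = dual_embed (?\<phi> n)" for n
      using \<open>\<mu> \<noteq> 0\<close> unfolding y_def T_scale[OF I.U_antidual] TU by (simp only: scaleC_scaleC) (simp add: scaleC_one)
    note t = S.tends_approx[OF \<Xi>]
    have dy: "S.dnorm (y m - y n) = S.dnorm (dual_embed (?\<phi> m) - dual_embed (?\<phi> n))" for m n
      using iso[OF S.antidual_diff[OF y y]] unfolding diff[OF y y] Ty by metis
    have cauchy: "\<exists>N. \<forall>m\<ge>N. \<forall>n\<ge>N. S.dnorm (y m - y n) < \<epsilon>" if "\<epsilon> > 0" for \<epsilon>
      unfolding dy by (rule S.tends_Cauchy[OF S.emb_antidual \<Xi> t that])
    obtain Y where Y: "Y \<in> S.antidual" "S.tends y Y"
      by (rule S.antidual_complete[of y, OF y cauchy])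
    have "S.dnorm (dual_embed (?\<phi> n) - T Y) = S.dnorm (y n - Y)" for n
      using iso[OF S.antidual_diff[OF y Y(1)]] unfolding diff[OF y Y(1)] Ty .
    then have "S.tends (\<lambda>n. dual_embed (?\<phi> n)) (T Y)" using Y(2) unfolding S.tends_def by simp
    then have "T Y = \<Xi>" using S.tends_unique[OF S.emb_antidual TF[OF Y(1)] \<Xi> _ t] by blast
    then show ?thesis using Y(1) by blast
  qed
  have fn: "fock_norm (T \<Phi>) = fock_norm \<Phi>" if "\<Phi> \<in> S.antidual" for \<Phi>
    using iso[OF that] fock_norm_eq_dnorm[of \<Phi>] fock_norm_eq_dnorm[of "T \<Phi>"] that TF[OF that]
    unfolding fock_space_eq_antidual by simp
  have "fock_unitary T"
    unfolding fock_unitary_def fock_space_eq_antidual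
  proof (intro conjI ballI allI)
    show "bij_betw T S.antidual S.antidual"
    proof (rule bij_betw_imageI)
      show "inj_on T S.antidual" using inj by (intro inj_onI)
      show "T ` S.antidual = S.antidual"
      proof (intro equalityI subsetI)
        fix \<Xi> :: "'v symalg \<Rightarrow> complex" assume "\<Xi> \<in> S.antidual"
        then show "\<Xi> \<in> T ` S.antidual" using surj[of \<Xi>] by force
      qed (use TF in auto)
    qed
    show "T (\<Phi> + \<Psi>) = T \<Phi> + T \<Psi>" if "\<Phi> \<in> S.antidual" "\<Psi> \<in> S.antidual" for \<Phi> \<Psi> by (rule T_add[OF that])
    show "T (c *\<^sub>C \<Phi>) = c *\<^sub>C T \<Phi>" if "\<Phi> \<in> S.antidual" for c \<Phi> by (rule T_scale[OF that])
    show "fock_inner (T \<Phi>) (T \<Psi>) = fock_inner \<Phi> \<Psi>" if "\<Phi> \<in> S.antidual" "\<Psi> \<in> S.antidual" for \<Phi> \<Psi>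
    proof -
      have "fock_norm (T \<Phi> + c *\<^sub>C T \<Psi>) = fock_norm (\<Phi> + c *\<^sub>C \<Psi>)" for c
        unfolding T_scale[OF that(2), symmetric] T_add[OF that(1) S.antidual_scale[OF that(2)], symmetric]
        by (rule fn[OF S.antidual_add[OF that(1) S.antidual_scale[OF that(2)]]])
      then show ?thesis unfolding fock_inner_def by (simp only:)
    qed
  qed
  then show ?thesis using T continuous_extension_unique by blast
qed

end

text \<open>
  The parts \<open>A\<close> of \<open>g\<close> and of its inverse are transposes of each other up to sign. Transposing once
  leads from the given orthonormal basis to a bound for the inverse, transposing a second time
  leads back to \<open>g\<close>, now for arbitrary orthonormal sets.
\<close>

lemma hilbert_schmidt_restricted_symplectic:
  fixes g :: "'v::complex_hilbert \<Rightarrow> 'v"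
  assumes "g \<in> Sp" "hilbert_schmidt (A_part g)"
  obtains h where "restricted_symplectic g h"
proof -
  interpret symplectic g by unfold_locales fact
  interpret I: symplectic "inv g" by (rule inv_symplectic)
  obtain E where E: "orthonormal_basis E" "(\<lambda>e. (norm (A_part g e))\<^sup>2) summable_on E"
    using assms(2) unfolding hilbert_schmidt_def by blast
  define h where "h = infsum (\<lambda>e. (norm (A_part g e))\<^sup>2) E"
  have adj: "cmod (cinner x (A_part (inv g) y)) = cmod (cinner y (A_part g x))" for x y
    by (metis A_adjoint cinner_commute complex_mod_cnj norm_minus_cancel)
  have 1: "(\<Sum>e\<in>F. (norm (A_part g e))\<^sup>2) \<le> h" if "finite F" "F \<subseteq> E" for F
    unfolding h_def using E(2) that by (intro finite_sum_le_infsum) auto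
  have A': "hs_bound (A_part (inv g)) h" by (rule hs_bound_transpose[OF E(1) adj 1])
  have "V.orthonormal F" if "finite F" "F \<subseteq> E" for F
    using E(1) that unfolding orthonormal_basis_def V.orthonormal_def by blast
  then have 2: "(\<Sum>e\<in>F. (norm (A_part (inv g) e))\<^sup>2) \<le> h" if "finite F" "F \<subseteq> E" for F
    using A' that unfolding hs_bound_def by blast
  have "hs_bound (A_part g) h" by (rule hs_bound_transpose[OF E(1) adj[symmetric] 2])
  then have "restricted_symplectic g h" using A' by unfold_locales
  then show thesis by (rule that)
qed

theorem theorem3p12:
  fixes g :: "'v::complex_hilbert \<Rightarrow> 'v"
  assumes "g \<in> Sp"
    and "hilbert_schmidt (A_part g)"
  shows "(\<forall>\<phi>. U_normalized g \<phi> \<in> fock_space) \<and>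
    (\<exists>!T. continuous_extension (U_normalized g) T) \<and>
    (\<forall>T. continuous_extension (U_normalized g) T \<longrightarrow> fock_unitary T)"
proof -
  obtain h where "restricted_symplectic g h"
    by (rule hilbert_schmidt_restricted_symplectic[OF assms])
  then interpret restricted_symplectic g h .
  show ?thesis
    using U_normalized_antidual U_normalized_unitary unfolding fock_space_eq_antidual by blast
qed

end
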